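(* Let $K,P\geqslant1/2$ be real numbers, let $h(\kappa,p)=\exp\left(-(\kappa/K)^2-(p/P)^2\right)$ for $(\kappa,p)\in\mathbb{R}\times\mathbb{Z}$, and for $z\in\mathbb{C}\smallsetminus\{0\}$ let $$\mathcal{H}(z)=\iint_{\mathcal{A}}h(\kappa,p)\,\boldsymbol{J}_{i\kappa,p}(z)\,(\kappa^2+p^2)\,\mathrm{d}\mu(\kappa,p).$$ Then for all $z\in\mathbb{C}\smallsetminus\{0\}$ $$\mathcal{H}(z)=|2z|^2\iint_{\widehat{\mathcal{A}}}\cos\big(2\,\mathrm{Re}(z\,\mathrm{trh}(r,\omega))\big)\,\big(\sinh^2r+\sin^2\omega\big)\,k(r)\,\theta(\omega)\,\mathrm{d}\widehat{\mu}(r,\omega),$$ where $$\mathrm{trh}(r,\omega)=\cosh r\cos\omega+i\sinh r\sin\omega,$$ $$k(r)=\sqrt{\pi}\,K\exp\big(-(Kr)^2\big),\qquad\theta(\omega)=\sqrt{\pi}\,P\sum_{q\in\mathbb{Z}}\exp\big(-(P(\omega+\pi q))^2\big).$$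
   Context: $\mathcal{A}=\mathbb{R}\times\mathbb{Z}$ with $\mathrm{d}\mu(\kappa,p)$ equal to Lebesgue measure on $\mathbb{R}$ times counting measure on $\mathbb{Z}$; $\widehat{\mathcal{A}}=\mathbb{R}\times\mathbb{R}/\pi\mathbb{Z}$ with $\mathrm{d}\widehat{\mu}(r,\omega)$ the usual Lebesgue measure $\mathrm{d}r\,\mathrm{d}\omega$ (total mass $\pi$ in $\omega$). With $J_\nu(z)=\sum_{n=0}^\infty\frac{(-1)^n(z/2)^{\nu+2n}}{n!\,\Gamma(\nu+n+1)}$ the classical Bessel function, for $\nu\in\mathbb{C}$, $p\in\mathbb{Z}$ and $z\in\mathbb{C}\smallsetminus\{0\}$ define $$J_{\nu,p}(z)=J_{\nu+p}(z)\,J_{\nu-p}(\overline{z}),\qquad\boldsymbol{J}_{\nu,p}(z)=\frac{2\pi^2}{\sin(\pi\nu)}\big(J_{-\nu,-p}(z)-J_{\nu,p}(z)\big),$$ where $J_{\nu,p}(z)$ is single-valued (taking conjugate branches for $z$ and $\overline z$, so that $z^{\nu+p}\overline z^{\,\nu-p}=|z|^{2\nu}(z/|z|)^{2p}$), and $\boldsymbol{J}_{\nu,p}(z)$ is defined by its limit in $\nu$ when $\sin(\pi\nu)=0$; it is complex analytic in $\nu$. *)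

theory Defs
  imports "HOL-Analysis.Analysis"
begin

(* The classical Bessel function on the Riemann surface of the logarithm: w plays the role of
   log z, so that (z/2)^(\<nu>+2n) is exp ((\<nu>+2n) * (w - ln 2)).  At the poles of Gamma, Gamma is 0
   by convention and so is the quotient, in agreement with 1/Gamma = 0 there. *)
definition bessel_J_log :: "complex \<Rightarrow> complex \<Rightarrow> complex" where
  "bessel_J_log \<nu> w =
     (\<Sum>n. (-1) ^ n * exp ((\<nu> + 2 * of_nat n) * (w - of_real (ln 2)))
            / (fact n * Gamma (\<nu> + of_nat n + 1)))"

definition bessel_J :: "complex \<Rightarrow> complex \<Rightarrow> complex" where
  "bessel_J \<nu> z =
     (\<Sum>n. (-1) ^ n * (z / 2) powr (\<nu> + 2 * of_nat n) / (fact n * Gamma (\<nu> + of_nat n + 1)))"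

(* The branches of log at z and at cnj z have to be conjugate to each other, whereas
   Ln (cnj z) = cnj (Ln z) fails on the negative real axis; hence cnj (Ln z) below. The lemma
   bessel_J2_any_branch shows that the choice of the branch at z is irrelevant. *)
definition bessel_J2 :: "complex \<Rightarrow> int \<Rightarrow> complex \<Rightarrow> complex" where
  "bessel_J2 \<nu> p z =
     bessel_J_log (\<nu> + of_int p) (Ln z) * bessel_J_log (\<nu> - of_int p) (cnj (Ln z))"

definition bessel_quot :: "complex \<Rightarrow> int \<Rightarrow> complex \<Rightarrow> complex" where
  "bessel_quot \<nu> p z =
     2 * of_real pi ^ 2 / sin (of_real pi * \<nu>) * (bessel_J2 (- \<nu>) (- p) z - bessel_J2 \<nu> p z)"

definition bold_J :: "complex \<Rightarrow> int \<Rightarrow> complex \<Rightarrow> complex" where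
  "bold_J \<nu> p z =
     (if sin (of_real pi * \<nu>) = 0 then Lim (at \<nu>) (\<lambda>\<nu>'. bessel_quot \<nu>' p z)
      else bessel_quot \<nu> p z)"

definition mu_A :: "(real \<times> int) measure" where
  "mu_A = lborel \<Otimes>\<^sub>M count_space UNIV"

(* The circle \<real>/\<pi>\<int> is represented by its fundamental domain [0,\<pi>); only functions that are
   \<pi>-periodic in the second variable are to be integrated against this measure. *)
definition mu_A_hat :: "(real \<times> real) measure" where
  "mu_A_hat = lborel \<Otimes>\<^sub>M restrict_space lborel {0..<pi}"

definition gauss_h :: "real \<Rightarrow> real \<Rightarrow> real \<Rightarrow> int \<Rightarrow> real" where
  "gauss_h K P \<kappa> p = exp (- (\<kappa> / K)\<^sup>2 - (of_int p / P)\<^sup>2)"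

definition H_integrand :: "real \<Rightarrow> real \<Rightarrow> complex \<Rightarrow> real \<times> int \<Rightarrow> complex" where
  "H_integrand K P z =
     (\<lambda>(\<kappa>, p). of_real (gauss_h K P \<kappa> p) * bold_J (\<i> * of_real \<kappa>) p z
                * of_real (\<kappa>\<^sup>2 + (of_int p)\<^sup>2))"

definition H_transform :: "real \<Rightarrow> real \<Rightarrow> complex \<Rightarrow> complex" where
  "H_transform K P z = integral\<^sup>L mu_A (H_integrand K P z)"

definition trh :: "real \<Rightarrow> real \<Rightarrow> complex" where
  "trh r \<omega> = of_real (cosh r * cos \<omega>) + \<i> * of_real (sinh r * sin \<omega>)"

definition gauss_k :: "real \<Rightarrow> real \<Rightarrow> real" where
  "gauss_k K r = sqrt pi * K * exp (- (K * r)\<^sup>2)"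

definition theta :: "real \<Rightarrow> real \<Rightarrow> real" where
  "theta P \<omega> = sqrt pi * P * (\<Sum>\<^sub>\<infinity>q\<in>(UNIV :: int set). exp (- (P * (\<omega> + pi * of_int q))\<^sup>2))"

definition dual_integrand :: "real \<Rightarrow> real \<Rightarrow> complex \<Rightarrow> real \<times> real \<Rightarrow> real" where
  "dual_integrand K P z =
     (\<lambda>(r, \<omega>). cos (2 * Re (z * trh r \<omega>)) * ((sinh r)\<^sup>2 + (sin \<omega>)\<^sup>2)
                * gauss_k K r * theta P \<omega>)"


lemma bessel_J_log_summable:
  "summable (\<lambda>n. (-1) ^ n * exp ((\<nu> + 2 * of_nat n) * (w - of_real (ln 2)))
            / (fact n * Gamma (\<nu> + of_nat n + 1)) :: complex)"
proof -
  define u where "u = w - of_real (ln 2)"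
  define c where "c = norm (exp (2 * u))"
  define f where "f = (\<lambda>n. (-1) ^ n * exp ((\<nu> + 2 * of_nat n) * u)
            * rGamma (\<nu> + of_nat n + 1) / fact n)"
  obtain N :: nat where N: "real N > norm \<nu> + 1 + 2 * c"
    using reals_Archimedean2 by blast
  have "summable f"
  proof (rule summable_ratio_test[of "1/2" N])
    fix n assume n: "n \<ge> N"
    define x where "x = \<nu> + of_nat n + 1"
    have "norm (of_nat n + 1 :: complex) \<le> norm x + norm \<nu>"
      using norm_triangle_ineq4[of x \<nu>] by (simp add: x_def algebra_simps)
    moreover have "norm (of_nat n + 1 :: complex) = real n + 1"
      by (metis norm_of_nat of_nat_Suc add.commute)
    ultimately have x: "norm x \<ge> 1"
      using N n by (smt (verit) c_def norm_ge_zero of_nat_le_iff)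
    have r: "rGamma x = x * rGamma (x + 1)"
      by (simp add: rGamma_plus1)
    have fn: "f n = (-1) ^ n * exp ((\<nu> + 2 * of_nat n) * u) * (x * rGamma (x + 1)) / fact n"
      by (simp add: f_def r flip: x_def)
    have "\<nu> + of_nat (Suc n) + 1 = x + 1" by (simp add: x_def)
    moreover have "(\<nu> + 2 * of_nat (Suc n)) * u = (\<nu> + 2 * of_nat n) * u + 2 * u"
      by (simp add: algebra_simps)
    ultimately have fs: "f (Suc n) = - ((-1) ^ n * (exp ((\<nu> + 2 * of_nat n) * u) * exp (2 * u))
        * rGamma (x + 1) / (of_nat (Suc n) * fact n))"
      by (simp only: f_def exp_add fact_Suc of_nat_mult of_nat_fact power_Suc) simp
    have c: "c \<ge> 0" by (simp add: c_def)
    have sn: "real (Suc n) \<ge> 2 * c" using N n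
      by (smt (verit) norm_ge_zero of_nat_le_iff of_nat_Suc)
    define A where "A = norm (exp ((\<nu> + 2 * of_nat n) * u)) * norm (rGamma (x + 1)) / fact n"
    have A: "A \<ge> 0" by (simp add: A_def)
    have e1: "norm (f (Suc n)) = A * (c / real (Suc n))"
      unfolding fs A_def c_def norm_minus_cancel norm_mult norm_divide norm_power norm_of_nat
      by (simp del: norm_exp_eq_Re add: mult_ac)
    have e2: "norm (f n) = A * norm x"
      unfolding fn A_def norm_mult norm_divide norm_power by simp
    have "c / real (Suc n) \<le> 1/2" using sn by (simp add: field_simps)
    hence "c / real (Suc n) \<le> 1/2 * norm x" using x by linarith
    thus "norm (f (Suc n)) \<le> 1/2 * norm (f n)"
      unfolding e1 e2 using mult_left_mono[OF _ A] by (metis mult.left_commute)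
  qed simp
  thus ?thesis
    by (simp add: f_def u_def Gamma_def field_simps)
qed

lemma bessel_J_log_Ln:
  assumes "z \<noteq> 0"
  shows "bessel_J_log \<nu> (Ln z) = bessel_J \<nu> z"
proof -
  have "Ln (z / of_real 2) = Ln z - of_real (ln 2)"
    using assms by (subst Ln_divide_of_real) (auto simp: Ln_of_real)
  thus ?thesis
    using assms by (simp add: bessel_J_log_def bessel_J_def powr_def)
qed

lemma bessel_J2_eq:
  assumes "z \<notin> \<real>\<^sub>\<le>\<^sub>0"
  shows "bessel_J2 \<nu> p z = bessel_J (\<nu> + of_int p) z * bessel_J (\<nu> - of_int p) (cnj z)"
proof -
  have "z \<noteq> 0" using assms by auto
  thus ?thesis
    using assms by (simp add: bessel_J2_def cnj_Ln bessel_J_log_Ln)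
qed

lemma bessel_J_log_shift:
  "bessel_J_log \<nu> (w + 2 * of_int k * of_real pi * \<i>)
     = exp (2 * of_int k * of_real pi * \<i> * \<nu>) * bessel_J_log \<nu> w"
proof -
  let ?s = "2 * of_int k * of_real pi * \<i> :: complex"
  have "exp ((\<nu> + 2 * of_nat n) * (w + ?s - of_real (ln 2)))
      = exp (?s * \<nu>) * exp ((\<nu> + 2 * of_nat n) * (w - of_real (ln 2)))" for n
  proof -
    have "(\<nu> + 2 * of_nat n) * (w + ?s - of_real (ln 2))
        = ?s * \<nu> + (\<nu> + 2 * of_nat n) * (w - of_real (ln 2))
          + \<i> * (of_int (2 * (2 * int n * k)) * of_real pi)"
      by (simp add: algebra_simps)
    moreover have "exp (\<i> * (of_int (2 * (2 * int n * k)) * of_real pi)) = 1"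
      unfolding exp_eq_1 by (auto intro!: exI[of _ "2 * int n * k"])
    ultimately show ?thesis by (simp only: exp_add) simp
  qed
  thus ?thesis
    unfolding bessel_J_log_def
    by (subst suminf_mult[OF bessel_J_log_summable, symmetric]) (simp add: mult_ac)
qed

lemma bessel_J2_any_branch:
  assumes "exp w = z"
  shows "bessel_J_log (\<nu> + of_int p) w * bessel_J_log (\<nu> - of_int p) (cnj w) = bessel_J2 \<nu> p z"
proof -
  have "z \<noteq> 0" using assms by auto
  hence "exp w = exp (Ln z)" using assms by simp
  then obtain k :: int where k: "w = Ln z + 2 * of_int k * of_real pi * \<i>"
    unfolding exp_eq by (auto simp: mult_ac)
  have k': "cnj w = cnj (Ln z) + 2 * of_int (- k) * of_real pi * \<i>"
    by (simp add: k)
  have "exp (2 * of_int k * of_real pi * \<i> * (\<nu> + of_int p))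
        * exp (2 * of_int (- k) * of_real pi * \<i> * (\<nu> - of_int p))
      = exp (\<i> * (of_int (2 * (2 * k * p)) * of_real pi))"
    by (simp add: algebra_simps flip: exp_add)
  also have "\<dots> = 1"
    unfolding exp_eq_1 by (auto intro!: exI[of _ "2 * k * p"])
  finally have e: "exp (2 * of_int k * of_real pi * \<i> * (\<nu> + of_int p))
        * exp (2 * of_int (- k) * of_real pi * \<i> * (\<nu> - of_int p)) = 1" .
  have *: "(a * x) * (b * y) = x * y" if "a * b = 1" for a b x y :: complex
    using that by (metis mult.assoc mult.left_commute mult_1)
  show ?thesis
    unfolding k' unfolding k bessel_J_log_shift bessel_J2_def
    by (rule *[OF e])
qed

lemma theta_periodic: "theta P (\<omega> + pi) = theta P \<omega>"
proof -
  have "bij (\<lambda>q::int. q + 1)"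
    by (rule bij_betwI[of _ _ _ "\<lambda>q. q - 1"]) auto
  hence "(\<Sum>\<^sub>\<infinity>q\<in>UNIV. exp (- (P * (\<omega> + pi * of_int (q + 1 :: int)))\<^sup>2))
      = (\<Sum>\<^sub>\<infinity>q\<in>UNIV. exp (- (P * (\<omega> + pi * of_int (q :: int)))\<^sup>2))"
    by (rule infsum_reindex_bij_betw)
  thus ?thesis by (simp add: theta_def algebra_simps)
qed

lemma dual_integrand_periodic: "dual_integrand K P z (r, \<omega> + pi) = dual_integrand K P z (r, \<omega>)"
proof -
  have "trh r (\<omega> + pi) = - trh r \<omega>" by (simp add: trh_def)
  hence "2 * Re (z * trh r (\<omega> + pi)) = - (2 * Re (z * trh r \<omega>))"
    by (simp only: mult_minus_right uminus_complex.sel)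
  hence "cos (2 * Re (z * trh r (\<omega> + pi))) = cos (2 * Re (z * trh r \<omega>))"
    by (simp only: cos_minus)
  thus ?thesis by (simp add: dual_integrand_def theta_periodic)
qed

end

theory Submission
  imports Defs "HOL-Probability.Probability"
begin

text \<open>
The idea is to write the Bessel kernel as a Fourier transform on the cylinder
\<open>\<real> \<times> \<real>/\<pi>\<int>\<close> and to apply Parseval's formula to it and a Gaussian.

Put \<open>w = r + i \<omega>\<close>, so that \<open>trh (r, \<omega>) = cosh w\<close>, and
\<open>F (r, \<omega>) = cos (2 Re (z cosh w))\<close>. For \<open>\<kappa> \<noteq> 0\<close> the kernel of order
\<open>(i \<kappa>, p)\<close> equals
  \<open>4 \<integral>_\<real> \<integral>_0^\<pi> F (r, \<omega>) e^{2 i \<kappa> r + 2 i p \<omega>} d\<omega> dr\<close>,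
where the inner integral is done first: it is a multiple of a Bessel function of integer order in
an argument of size about \<open>e^{|r|}\<close>, hence decays exponentially in \<open>r\<close>, so that the outer
integral converges absolutely (lemma bold_J_eq_integral).

To prove this, the two half-lines are exchanged by \<open>w \<mapsto> -w\<close>. On \<open>r > 0\<close> the plane wave is
the product of \<open>exp (i Re (z e^w))\<close> and \<open>exp (i Re (z e^{-w}))\<close>. The second factor is expanded
in powers of \<open>e^{-w}\<close> and its complex conjugate. What remains are Mellin transforms over
\<open>(1, \<infinity>)\<close> of Bessel functions of integer order, and each of them is a quotient of Gamma factors
minus a series of simple fractions (theorem mellin_eq). By the reflection formula the Gamma
factors sum up to \<open>\<pi> / (2 sin \<pi>\<nu>)\<close> times the product of two Bessel series. The
simple fractions form a quadruple sum which is odd under \<open>(\<nu>, p) \<mapsto> (-\<nu>, -p)\<close>, so they cancel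
when the two half-lines are added (lemma bold_J_eq_half_tr).

For the theorem itself, \<open>F\<close> satisfies \<open>\<Delta>F = -|2 z sinh w|^2 F\<close> and
\<open>|sinh w|^2 = sinh^2 r + sin^2 \<omega>\<close>. Unfolding the theta function turns the dual side into an
integral over the plane of \<open>-\<Delta>F\<close> against the Gaussian \<open>k (r) k_P (\<omega>)\<close>, where \<open>k_P\<close> is the
summand of \<open>\<theta>\<close>, and two integrations by parts move the Laplacian onto the Gaussian. Expanding
\<open>F\<close> in its Fourier series in \<open>\<omega>\<close> and using that the Gaussians are Fourier transforms of
Gaussians produces the weight \<open>h (\<kappa>, p) (\<kappa>^2 + p^2)\<close>, and Fubini's theorem, whose hypotheses hold
because of the exponential decay in \<open>r\<close>, gives the left-hand side. Poisson
summation does not enter, since the theta function is unfolded.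
\<close>
section \<open>Exchange of sums and integrals\<close>

lemma integrable_count_space_iff:
  fixes f :: "'a \<Rightarrow> 'b::{banach,second_countable_topology}"
  shows
  "integrable (count_space A) f \<longleftrightarrow> (\<lambda>i. norm (f i)) summable_on A"
  using abs_summable_equivalent[of f A] by (simp add: abs_summable_on_def)

lemma lebesgue_integral_count_space_eq_infsum:
  fixes f :: "'a \<Rightarrow> 'b::{banach,second_countable_topology}"
  assumes "(\<lambda>i. norm (f i)) summable_on A"
  shows "integral\<^sup>L (count_space A) f = infsum f A"
  using infsetsum_infsum[of f A] assms abs_summable_equivalent[of f A] by (simp add: infsetsum_def)

text \<open>Fubini's theorem for the product of a measure with the counting measure of a countable index
type, in the language of unordered sums.\<close>
lemma has_sum_integral:
  fixes f :: "'i::countable \<Rightarrow> 'a \<Rightarrow> complex"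
  assumes M: "sigma_finite_measure M"
    and int: "\<And>i. integrable M (f i)"
    and summ: "(\<lambda>i. \<integral>x. norm (f i x) \<partial>M) summable_on UNIV"
    and has_sum: "\<And>x. x \<in> space M \<Longrightarrow> ((\<lambda>i. f i x) has_sum F x) UNIV"
  shows "integrable M F" and "((\<lambda>i. \<integral>x. f i x \<partial>M) has_sum (\<integral>x. F x \<partial>M)) UNIV"
proof -
  interpret M: sigma_finite_measure M by fact
  interpret N: sigma_finite_measure "count_space (UNIV :: 'i set)"
    by (rule sigma_finite_measure_count_space)
  interpret NM: pair_sigma_finite "count_space (UNIV :: 'i set)" M ..
  define g where "g = (\<lambda>(i, x). f i x)"
  have [measurable]: "f i \<in> borel_measurable M" for i
    using int by (rule borel_measurable_integrable)
  have g_meas [measurable]: "g \<in> borel_measurable (count_space UNIV \<Otimes>\<^sub>M M)"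
    by (rule measurable_pair_measure_countable1) (auto simp: g_def)
  have norm_summ: "(\<lambda>i. norm (\<integral>x. norm (f i x) \<partial>M)) summable_on UNIV"
    using summ by simp
  have g: "integrable (count_space UNIV \<Otimes>\<^sub>M M) g"
  proof (rule NM.Fubini_integrable[OF g_meas])
    show "integrable (count_space UNIV) (\<lambda>i. \<integral>x. norm (g (i, x)) \<partial>M)"
      unfolding integrable_count_space_iff using norm_summ by (simp add: g_def)
    show "AE i in count_space UNIV. integrable M (\<lambda>x. g (i, x))"
      using int by (simp add: g_def)
  qed
  have norm_f: "(\<lambda>i. norm (f i x)) summable_on UNIV" if "x \<in> space M" for x
    using has_sum_imp_summable[OF has_sum[OF that]]
    by (simp add: summable_on_iff_abs_summable_on_complex)
  have F: "(\<integral>i. f i x \<partial>count_space UNIV) = F x" if "x \<in> space M" for x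
    using lebesgue_integral_count_space_eq_infsum[OF norm_f[OF that]] infsumI[OF has_sum[OF that]]
    by simp
  have g': "integrable (count_space UNIV \<Otimes>\<^sub>M M) (\<lambda>(i, x). f i x)"
    using g by (simp add: g_def)
  have "integrable M (\<lambda>x. \<integral>i. f i x \<partial>count_space UNIV)"
    by (rule NM.integrable_snd[OF g'])
  thus "integrable M F"
    by (rule Bochner_Integration.integrable_cong[THEN iffD1, rotated -1]) (auto simp: F)
  have "(\<lambda>i. norm (\<integral>x. f i x \<partial>M)) summable_on UNIV"
    using NM.integrable_fst[OF g'] unfolding integrable_count_space_iff .
  hence s: "((\<lambda>i. \<integral>x. f i x \<partial>M) has_sum (\<integral>i. (\<integral>x. f i x \<partial>M) \<partial>count_space UNIV)) UNIV"
    by (simp only: lebesgue_integral_count_space_eq_infsum has_sum_infsum[OF abs_summable_summable])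
  have "(\<integral>i. (\<integral>x. f i x \<partial>M) \<partial>count_space UNIV) = (\<integral>x. (\<integral>i. f i x \<partial>count_space UNIV) \<partial>M)"
    by (rule NM.Fubini_integral[OF g', symmetric])
  also have "\<dots> = (\<integral>x. F x \<partial>M)"
    by (rule Bochner_Integration.integral_cong) (auto simp: F)
  finally show "((\<lambda>i. \<integral>x. f i x \<partial>M) has_sum (\<integral>x. F x \<partial>M)) UNIV"
    using s by simp
qed

lemma has_sum_mult_prod:
  fixes f :: "'a \<Rightarrow> complex" and g :: "'b \<Rightarrow> complex"
  assumes "(f has_sum a) A" "(g has_sum b) B"
  shows "((\<lambda>(x, y). f x * g y) has_sum a * b) (A \<times> B)"
proof -
  have "(\<lambda>x. norm (f x)) summable_on A" and "(\<lambda>x. norm (g x)) summable_on B"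
    using assms[THEN has_sum_imp_summable]
    by (simp_all add: summable_on_iff_abs_summable_on_complex)
  hence "(\<lambda>z. norm ((\<lambda>(x, y). f x * g y) z)) summable_on A \<times> B"
    unfolding Infinite_Sum.abs_summable_on_Sigma_iff
    by (auto simp: norm_mult abs_mult infsum_nonneg infsum_cmult_right' intro: summable_on_cmult_right
        summable_on_cmult_left)
  hence "(\<lambda>(x, y). f x * g y) summable_on A \<times> B"
    by (rule abs_summable_summable)
  thus ?thesis
    using assms by (intro has_sum_SigmaI[where g = "\<lambda>x. f x * b"])
      (auto intro: has_sum_cmult_right has_sum_cmult_left)
qed

text \<open>The form of integration by parts on the real line that is used throughout.\<close>
lemma integral_deriv_eq_0:
  fixes f f' :: "real \<Rightarrow> 'a::euclidean_space"
  assumes deriv: "\<And>x. (f has_vector_derivative f' x) (at x)"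
    and cont: "continuous_on UNIV f'"
    and int: "integrable lborel f'"
    and lim: "(f \<longlongrightarrow> 0) at_top" "(f \<longlongrightarrow> 0) at_bot"
  shows "(\<integral>x. f' x \<partial>lborel) = 0"
proof -
  have "(LBINT x=-\<infinity>..\<infinity>. f' x) = 0 - 0"
  proof (rule interval_integral_FTC_integrable[where F = f])
    show "set_integrable lborel (einterval (- \<infinity>) \<infinity>) f'"
      using int by (simp add: set_integrable_def)
    show "((f \<circ> real_of_ereal) \<longlongrightarrow> 0) (at_right (- \<infinity>))" "((f \<circ> real_of_ereal) \<longlongrightarrow> 0) (at_left \<infinity>)"
      using lim by (simp_all add: ereal_tendsto_simps)
  qed (use deriv cont in \<open>auto simp: continuous_on_eq_continuous_at\<close>)
  thus ?thesis
    by (simp add: interval_lebesgue_integral_def set_lebesgue_integral_def)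
qed

section \<open>Angular Fourier coefficients of plane waves\<close>

text \<open>The coefficient of \<open>e^{i (c - d) \<omega>}\<close> in the double power series of
\<open>exp (i Re (Z e^{i \<omega>})) = exp (i Z e^{i \<omega>} / 2) exp (i cnj Z e^{-i \<omega>} / 2)\<close>.\<close>
definition ecoeff :: "nat \<Rightarrow> nat \<Rightarrow> complex \<Rightarrow> complex" where
  "ecoeff c d Z = (\<i> * Z / 2) ^ c * (\<i> * cnj Z / 2) ^ d / (fact c * fact d)"

text \<open>Lebesgue measure on \<open>[0, 2\<pi>]\<close>, not normalized.\<close>
abbreviation circle_measure :: "real measure" where
  "circle_measure \<equiv> restrict_space lborel {0..2 * pi}"

text \<open>The Fourier coefficient
\<open>1/(2\<pi>) \<integral>_0^{2\<pi>} exp (i Re (Z e^{i \<omega>})) e^{i n \<omega>} d\<omega>\<close> of the plane wave of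
frequency \<open>Z\<close> on the unit circle. For \<open>n \<ge> 0\<close> and real \<open>Z = y \<ge> 0\<close> it is \<open>i^n J_n (y)\<close>.\<close>
definition acoeff :: "int \<Rightarrow> complex \<Rightarrow> complex" where
  "acoeff n Z = (\<integral>\<omega>. exp (\<i> * of_real (Re (Z * cis \<omega>))) * cis (of_int n * \<omega>) \<partial>circle_measure)
              / of_real (2 * pi)"

lemma norm_ecoeff: "norm (ecoeff c d Z) = (norm Z / 2) ^ (c + d) / (fact c * fact d)"
  by (simp add: ecoeff_def norm_mult norm_divide norm_power power_add)

lemma ecoeff_cnj: "ecoeff c d (cnj Z) = ecoeff d c Z"
  by (simp add: ecoeff_def mult_ac)

lemma exp_has_sum: "((\<lambda>n. x ^ n / fact n) has_sum exp x) UNIV" for x :: complex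
proof (rule norm_summable_imp_has_sum)
  show "summable (\<lambda>n. norm (x ^ n / fact n))"
    using summable_norm_exp[of x] by (simp add: divide_inverse mult.commute scaleR_conv_of_real
        norm_mult norm_inverse)
  show "(\<lambda>n. x ^ n / fact n) sums exp x"
    using exp_converges[of x] by (simp add: scaleR_conv_of_real divide_inverse mult.commute)
qed

lemma exp_Re_has_sum:
  "((\<lambda>(c, d). ecoeff c d Z * cis (of_int (int c - int d) * \<omega>)) has_sum
     exp (\<i> * of_real (Re (Z * cis \<omega>)))) UNIV"
proof -
  have e: "exp (\<i> * of_real (Re (Z * cis \<omega>)))
      = exp (\<i> * Z * cis \<omega> / 2) * exp (\<i> * cnj Z * cis (- \<omega>) / 2)"
  proof -
    have "\<i> * of_real (Re (Z * cis \<omega>)) = \<i> * Z * cis \<omega> / 2 + \<i> * cnj Z * cis (- \<omega>) / 2"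
      by (simp add: complex_eq_iff field_simps)
    thus ?thesis by (simp only: exp_add)
  qed
  have "((\<lambda>(c, d). (\<i> * Z * cis \<omega> / 2) ^ c / fact c * ((\<i> * cnj Z * cis (- \<omega>) / 2) ^ d / fact d))
     has_sum (exp (\<i> * Z * cis \<omega> / 2) * exp (\<i> * cnj Z * cis (- \<omega>) / 2))) (UNIV \<times> UNIV)"
    by (intro has_sum_mult_prod exp_has_sum)
  moreover have "(\<i> * Z * cis \<omega> / 2) ^ c / fact c * ((\<i> * cnj Z * cis (- \<omega>) / 2) ^ d / fact d)
     = ecoeff c d Z * cis (of_int (int c - int d) * \<omega>)" for c d
  proof -
    have "cis (of_int (int c - int d) * \<omega>) = cis \<omega> ^ c * cis (- \<omega>) ^ d"
      unfolding Complex.DeMoivre cis_mult by (simp add: algebra_simps)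
    thus ?thesis
      by (simp add: ecoeff_def power_mult_distrib power_divide mult_ac del: cis_cnj)
  qed
  ultimately show ?thesis unfolding e by simp
qed

lemma norm_ecoeff_has_sum: "((\<lambda>(c, d). norm (ecoeff c d Z)) has_sum exp (norm Z)) UNIV"
proof -
  define x where "x = complex_of_real (norm Z / 2)"
  have "((\<lambda>(c, d). x ^ c / fact c * (x ^ d / fact d)) has_sum (exp x * exp x)) (UNIV \<times> UNIV)"
    by (intro has_sum_mult_prod exp_has_sum)
  also have "exp x * exp x = of_real (exp (norm Z))"
    by (simp add: x_def exp_of_real flip: exp_add)
  finally have "((\<lambda>y. complex_of_real (case y of (c, d) \<Rightarrow> norm (ecoeff c d Z))) has_sum of_real (exp (norm Z))) UNIV"
    by (simp add: case_prod_unfold norm_ecoeff x_def power_add)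
  from has_sum_bounded_linear[OF bounded_linear_Re this] show ?thesis by (simp add: o_def case_prod_unfold)
qed

text \<open>Termwise integration of the plane wave against an arbitrary integrable weight. The lemma is
applied to the circle, where it gives the expansion of the angular coefficients and their addition
theorem, and to the real line with a Gaussian weight.\<close>
lemma has_sum_integral_exp_Re:
  assumes "sigma_finite_measure M" and id: "(\<lambda>x. x) \<in> borel_measurable M" and g: "integrable M g"
  shows "((\<lambda>(c, d). ecoeff c d Z * (\<integral>\<omega>. cis (of_int (int c - int d) * \<omega>) * g \<omega> \<partial>M)) has_sum
           (\<integral>\<omega>. exp (\<i> * of_real (Re (Z * cis \<omega>))) * g \<omega> \<partial>M)) UNIV"
proof -
  define f where "f = (\<lambda>(c, d) \<omega>. ecoeff c d Z * (cis (of_int (int c - int d) * \<omega>) * g \<omega>))"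
  note [measurable] = id
  have [measurable]: "g \<in> borel_measurable M" using g by simp
  have [measurable]: "cis \<in> borel_measurable borel"
    by (intro borel_measurable_continuous_onI continuous_intros)
  have int: "integrable M (\<lambda>\<omega>. cis (of_int m * \<omega>) * g \<omega>)" for m
    by (rule Bochner_Integration.integrable_bound[OF g]) (auto simp: norm_mult)
  have "((\<lambda>i. \<integral>\<omega>. f i \<omega> \<partial>M) has_sum (\<integral>\<omega>. exp (\<i> * of_real (Re (Z * cis \<omega>))) * g \<omega> \<partial>M)) UNIV"
  proof (rule has_sum_integral(2))
    show "integrable M (f i)" for i
      using int by (cases i) (simp add: f_def del: of_int_diff)
    have "(\<lambda>(c, d). norm (ecoeff c d Z)) summable_on UNIV"
      using norm_ecoeff_has_sum by (rule has_sum_imp_summable)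
    hence "(\<lambda>i. (case i of (c, d) \<Rightarrow> norm (ecoeff c d Z)) * (\<integral>\<omega>. norm (g \<omega>) \<partial>M)) summable_on UNIV"
      by (rule summable_on_cmult_left)
    thus "(\<lambda>i. \<integral>\<omega>. norm (f i \<omega>) \<partial>M) summable_on UNIV"
      by (rule summable_on_cong[THEN iffD1, rotated]) (auto simp: f_def norm_mult)
    show "((\<lambda>i. f i \<omega>) has_sum exp (\<i> * of_real (Re (Z * cis \<omega>))) * g \<omega>) UNIV" for \<omega>
      using has_sum_cmult_left[OF exp_Re_has_sum[of Z \<omega>], of "g \<omega>"]
      by (simp add: f_def case_prod_unfold mult_ac)
  qed fact
  thus ?thesis by (simp add: f_def case_prod_unfold)
qed

lemma finite_circle_measure: "finite_measure circle_measure"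
  by (rule finite_measureI) (simp add: emeasure_restrict_space space_restrict_space)

lemma integral_cis_circle:
  "(\<integral>\<omega>. cis (of_int m * \<omega>) \<partial>circle_measure) = (if m = 0 then of_real (2 * pi) else 0)"
proof (cases "m = 0")
  case True
  thus ?thesis
    by (simp add: measure_restrict_space scaleR_conv_of_real)
next
  case False
  define F where "F = (\<lambda>\<omega>. cis (of_int m * \<omega>) / (\<i> * of_int m))"
  have "has_bochner_integral lborel (\<lambda>x. indicator {0..2 * pi} x *\<^sub>R cis (of_int m * x)) (F (2 * pi) - F 0)"
  proof (rule has_bochner_integral_FTC_Icc)
    fix x :: real
    show "(F has_vector_derivative cis (of_int m * x)) (at x within {0..2 * pi})"
    proof -
      have "((\<lambda>\<omega>. exp (\<i> * of_int m * \<omega>)) has_field_derivative (exp (\<i> * of_int m * w) * (\<i>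
          * of_int m))) (at w)" for w :: complex
        by (auto intro!: derivative_eq_intros)
      from has_vector_derivative_real_field[OF this[of "of_real x"], of "{0..2 * pi}"]
      have "((\<lambda>\<omega>. cis (of_int m * \<omega>)) has_vector_derivative (cis (of_int m * x) * (\<i>
          * of_int m))) (at x within {0..2 * pi})"
        by (simp add: cis_conv_exp o_def mult_ac)
      from has_vector_derivative_divide[OF this, of "\<i> * of_int m"]
      show ?thesis using False unfolding F_def by simp
    qed
  qed (auto intro!: continuous_intros)
  moreover have "F (2 * pi) = F 0"
    using cis_multiple_2pi[of "of_int m"] by (simp add: F_def mult_ac)
  ultimately show ?thesis
    using False by (simp add: integral_restrict_space has_bochner_integral_iff)
qed

lemma integrable_circle_measure:
  fixes f :: "real \<Rightarrow> complex"
  assumes "continuous_on UNIV f" "\<And>x. norm (f x) \<le> B"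
  shows "integrable circle_measure f"
proof -
  interpret finite_measure circle_measure by (rule finite_circle_measure)
  have "f \<in> borel_measurable borel" using assms(1) by (rule borel_measurable_continuous_onI)
  thus ?thesis
    by (intro integrable_const_bound[where B = B])
       (auto simp: assms measurable_restrict_space1)
qed

lemma acoeff_has_sum:
  "((\<lambda>(c, d). if int d - int c = n then ecoeff c d Z else 0) has_sum acoeff n Z) UNIV"
proof -
  interpret finite_measure circle_measure by (rule finite_circle_measure)
  have "((\<lambda>(c, d). ecoeff c d Z * (\<integral>\<omega>. cis (of_int (int c - int d) * \<omega>) * cis (of_int n * \<omega>) \<partial>circle_measure)) has_sum
          (\<integral>\<omega>. exp (\<i> * of_real (Re (Z * cis \<omega>))) * cis (of_int n * \<omega>) \<partial>circle_measure)) UNIV"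
    by (intro has_sum_integral_exp_Re sigma_finite_measure integrable_circle_measure[where B
        = 1] sigma_finite_measure_axioms)
       (auto intro!: continuous_intros measurable_restrict_space1)
  from has_sum_cmult_left[OF this, of "1 / of_real (2 * pi)"]
  have "((\<lambda>(c, d). ecoeff c d Z * (\<integral>\<omega>. cis (of_int (int c - int d + n)
      * \<omega>) \<partial>circle_measure) / of_real (2 * pi)) has_sum
          acoeff n Z) UNIV"
    by (simp add: acoeff_def case_prod_unfold cis_mult algebra_simps)
  thus ?thesis
    by (rule has_sum_cong[THEN iffD1, rotated])
       (auto simp: integral_cis_circle simp del: of_int_add of_int_diff)
qed

lemma norm_acoeff_le_1: "norm (acoeff n Z) \<le> 1"
proof -
  interpret finite_measure circle_measure by (rule finite_circle_measure)
  let ?f = "\<lambda>\<omega>. exp (\<i> * of_real (Re (Z * cis \<omega>))) * cis (of_int n * \<omega>)"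
  have "norm (\<integral>\<omega>. ?f \<omega> \<partial>circle_measure) \<le> (\<integral>\<omega>. norm (?f \<omega>) \<partial>circle_measure)"
    by (rule integral_norm_bound)
  also have "\<dots> = 2 * pi"
    by (simp add: norm_mult measure_restrict_space)
  finally show ?thesis by (simp add: acoeff_def norm_divide)
qed

text \<open>Addition theorem: the plane wave of frequency \<open>Z + W\<close> is a product, and only the factor of
frequency \<open>W\<close> is expanded.\<close>
lemma acoeff_add_has_sum:
  "((\<lambda>(a, b). ecoeff a b W * acoeff (n + int a - int b) Z) has_sum acoeff n (Z + W)) UNIV"
proof -
  interpret finite_measure circle_measure by (rule finite_circle_measure)
  let ?g = "\<lambda>\<omega>. exp (\<i> * of_real (Re (Z * cis \<omega>))) * cis (of_int n * \<omega>)"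
  have "((\<lambda>(c, d). ecoeff c d W * (\<integral>\<omega>. cis (of_int (int c - int d) * \<omega>) * ?g \<omega> \<partial>circle_measure)) has_sum
          (\<integral>\<omega>. exp (\<i> * of_real (Re (W * cis \<omega>))) * ?g \<omega> \<partial>circle_measure)) UNIV"
    by (intro has_sum_integral_exp_Re sigma_finite_measure integrable_circle_measure[where B
        = 1] sigma_finite_measure_axioms)
       (auto intro!: continuous_intros measurable_restrict_space1 simp: norm_mult)
  from has_sum_cmult_left[OF this, of "1 / of_real (2 * pi)"]
  have "((\<lambda>(c, d). ecoeff c d W * (\<integral>\<omega>. cis (of_int (int c - int d) * \<omega>)
      * ?g \<omega> \<partial>circle_measure) / of_real (2 * pi)) has_sum
      (\<integral>\<omega>. exp (\<i> * of_real (Re (W * cis \<omega>))) * ?g \<omega> \<partial>circle_measure) / of_real (2 * pi)) UNIV"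
    by (simp add: case_prod_unfold)
  moreover have "(\<integral>\<omega>. exp (\<i> * of_real (Re (W * cis \<omega>))) * ?g \<omega> \<partial>circle_measure) / of_real (2 * pi)
      = acoeff n (Z + W)"
  proof -
    have "exp (\<i> * of_real (Re (W * cis \<omega>))) * ?g \<omega>
       = exp (\<i> * of_real (Re ((Z + W) * cis \<omega>))) * cis (of_int n * \<omega>)" for \<omega>
    proof -
      have "exp (\<i> * of_real (Re ((Z + W) * cis \<omega>)))
          = exp (\<i> * of_real (Re (W * cis \<omega>)) + \<i> * of_real (Re (Z * cis \<omega>)))"
        by (simp add: algebra_simps)
      thus ?thesis by (simp only: exp_add mult.assoc)
    qed
    thus ?thesis by (simp only: acoeff_def)
  qed
  moreover have "(\<integral>\<omega>. cis (of_int (int c - int d) * \<omega>) * ?g \<omega> \<partial>circle_measure) / of_real (2 * pi)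
      = acoeff (n + int c - int d) Z" for c d
  proof -
    have "cis (of_int (int c - int d) * \<omega>) * ?g \<omega>
       = exp (\<i> * of_real (Re (Z * cis \<omega>))) * cis (of_int (n + int c - int d) * \<omega>)" for \<omega>
    proof -
      have "cis (of_int (n + int c - int d) * \<omega>) = cis (of_int (int c - int d) * \<omega>) * cis (of_int n * \<omega>)"
        by (simp add: cis_mult algebra_simps)
      thus ?thesis by (simp only: mult_ac)
    qed
    thus ?thesis by (simp only: acoeff_def)
  qed
  ultimately show ?thesis
    by (simp only: times_divide_eq_right[symmetric])
qed

lemma acoeff_cnj: "acoeff n (cnj Z) = acoeff (- n) Z"
proof -
  have "((\<lambda>(c, d). if int d - int c = n then ecoeff c d (cnj Z) else 0) has_sum acoeff (-n) Z) UNIV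
    \<longleftrightarrow> ((\<lambda>(c, d). if int d - int c = - n then ecoeff c d Z else 0) has_sum acoeff (-n) Z) UNIV"
    by (rule has_sum_reindex_bij_witness[of _ prod.swap prod.swap]) (auto simp: ecoeff_cnj)
  thus ?thesis using acoeff_has_sum[of n "cnj Z"] acoeff_has_sum[of "-n" Z] has_sum_unique by blast
qed

lemma ecoeff_rotate:
  assumes "norm u = 1" shows "ecoeff c d (Z * u) = ecoeff c d Z * u powi (int c - int d)"
proof -
  have "u \<noteq> 0" using assms by auto
  have "u * cnj u = 1"
    using assms complex_norm_square[of u] by simp
  hence "u ^ d * cnj u ^ d = 1"
    by (metis power_mult_distrib power_one)
  thus ?thesis
    using \<open>u \<noteq> 0\<close> by (simp add: ecoeff_def power_mult_distrib power_int_diff field_simps)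
qed

lemma acoeff_rotate:
  assumes "norm u = 1" shows "acoeff n (Z * u) = acoeff n Z * u powi (- n)"
proof -
  have "(\<lambda>(c, d). if int d - int c = n then ecoeff c d (Z * u) else 0)
      = (\<lambda>x. (case x of (c, d) \<Rightarrow> if int d - int c = n then ecoeff c d Z else 0) * u powi (- n))"
    by (auto simp: fun_eq_iff ecoeff_rotate[OF assms])
  hence "((\<lambda>(c, d). if int d - int c = n then ecoeff c d (Z * u) else 0) has_sum (acoeff n Z * u powi (- n))) UNIV"
    using has_sum_cmult_left[OF acoeff_has_sum[of n Z], of "u powi (- n)"] by simp
  thus ?thesis using has_sum_unique[OF acoeff_has_sum[of n "Z * u"]] by blast
qed

section \<open>Decay of the angular coefficients\<close>

lemma half_le_sin:
  assumes "0 \<le> x" "x \<le> 1" shows "x / 2 \<le> sin (x :: real)"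
proof -
  have "sin 0 - 0 / 2 \<le> sin x - x / 2"
  proof (rule DERIV_nonneg_imp_nondecreasing[OF assms(1)])
    fix t assume t: "0 \<le> t" "t \<le> x"
    have "cos t \<ge> cos (pi / 3)"
      using t assms pi_gt3 by (intro cos_monotone_0_pi_le) auto
    hence "0 \<le> cos t - 1 / 2" by (simp add: cos_60)
    moreover have "((\<lambda>x. sin x - x / 2) has_real_derivative (cos t - 1 / 2)) (at t)"
      by (auto intro!: derivative_eq_intros)
    ultimately show "\<exists>y. ((\<lambda>x. sin x - x / 2) has_real_derivative y) (at t) \<and> 0 \<le> y" by blast
  qed
  thus ?thesis by simp
qed

text \<open>The stationary points of \<open>cos\<close> are cut out at distance \<open>\<delta>\<close>, and the rest is integrated by
parts. The choice \<open>\<delta> = |s|^{-1/3}\<close> then gives decay of order \<open>|s|^{-1/3}\<close>, which is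
not the true order \<open>|s|^{-1/2}\<close> but is sufficient here.\<close>
lemma norm_oscillatory_integral_le:
  fixes s \<delta> m :: real
  assumes s: "s \<noteq> 0" and \<delta>: "0 < \<delta>" "\<delta> \<le> 1"
  shows "norm (integral {0..pi} (\<lambda>\<omega>. exp (\<i> * of_real (s * cos \<omega>)) * cis (m * \<omega>)))
    \<le> 2 * \<delta> + 24 * (1 + \<bar>m\<bar>) / (\<bar>s\<bar> * \<delta>\<^sup>2)"
proof -
  define f where "f = (\<lambda>\<omega>. exp (\<i> * of_real (s * cos \<omega>)) * cis (m * \<omega>))"
  have cont: "continuous_on A f" for A
    unfolding f_def by (intro continuous_intros)
  have int: "f integrable_on {a..b}" for a b
    by (intro integrable_continuous_interval cont)
  have norm_f: "norm (f \<omega>) = 1" for \<omega> by (simp add: f_def norm_mult)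
  have \<delta>pi: "\<delta> < pi / 2" using \<delta> pi_gt3 by linarith
  have split: "integral {0..pi} f = integral {0..\<delta>} f + integral {\<delta>..pi-\<delta>} f + integral {pi-\<delta>..pi} f"
    using \<delta> \<delta>pi int by (simp add: Henstock_Kurzweil_Integration.integral_combine)
  have outer: "norm (integral {0..\<delta>} f) \<le> 1 * (\<delta> - 0)" "norm (integral {pi-\<delta>..pi} f) \<le> 1 * (pi - (pi - \<delta>))"
    using \<delta> by (intro integral_bound cont; simp add: norm_f)+
  have sin_ge: "sin \<omega> \<ge> \<delta> / 2" if "\<omega> \<in> {\<delta>..pi-\<delta>}" for \<omega>
  proof -
    have "sin \<delta> \<le> sin \<omega>"
    proof (cases "\<omega> \<le> pi / 2")
      case True
      thus ?thesis using that \<delta> by (intro sin_monotone_2pi_le) auto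
    next
      case False
      hence "sin \<delta> \<le> sin (pi - \<omega>)" using that \<delta> by (intro sin_monotone_2pi_le) auto
      thus ?thesis by simp
    qed
    thus ?thesis using half_le_sin[of \<delta>] \<delta> by linarith
  qed
  \<comment> \<open>The derivative of F is f + g, because i/s times the derivative of the exponential is sin times the exponential.\<close>
  define F where "F = (\<lambda>\<omega>. \<i> / of_real s * (f \<omega> / of_real (sin \<omega>)))"
  define g where "g = (\<lambda>\<omega>. \<i> / of_real s * (f \<omega> * (\<i> * of_real m / of_real (sin \<omega>)
      - of_real (cos \<omega>) / of_real (sin \<omega>) ^ 2)))"
  have F: "(F has_vector_derivative f \<omega> + g \<omega>) (at \<omega> within A)" if "\<omega> \<in> {\<delta>..pi-\<delta>}" for \<omega> A
  proof -
    have nz: "sin (of_real \<omega> :: complex) \<noteq> 0"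
      using sin_ge[OF that] \<delta> by (auto simp: sin_of_real)
    have "((\<lambda>w. \<i> / of_real s * (exp (\<i> * (of_real s * cos w)) * exp (\<i> * (of_real m
        * w)) / sin w)) has_field_derivative
       (exp (\<i> * (of_real s * cos w)) * exp (\<i> * (of_real m * w)) +
         \<i> / of_real s * (exp (\<i> * (of_real s * cos w)) * exp (\<i> * (of_real m * w)) * (\<i>
             * of_real m / sin w - cos w / sin w ^ 2)))) (at w)"
      if "sin w \<noteq> 0" for w :: complex
      using that s
      by (auto intro!: derivative_eq_intros simp: field_simps power2_eq_square)
    from has_vector_derivative_real_field[OF this[OF nz], of A]
    show ?thesis
      by (simp add: F_def f_def g_def cis_conv_exp o_def sin_of_real cos_of_real)
  qed
  have gc: "continuous_on {\<delta>..pi-\<delta>} g"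
    unfolding g_def using cont \<delta> sin_ge by (intro continuous_intros) force+
  have "((\<lambda>\<omega>. f \<omega> + g \<omega>) has_integral (F (pi - \<delta>) - F \<delta>)) {\<delta>..pi-\<delta>}"
    using \<delta>pi F by (intro fundamental_theorem_of_calculus) auto
  hence mid: "integral {\<delta>..pi-\<delta>} f = F (pi - \<delta>) - F \<delta> - integral {\<delta>..pi-\<delta>} g"
    using Henstock_Kurzweil_Integration.integral_add[OF int integrable_continuous_interval[OF gc]]
    by (simp add: integral_unique algebra_simps)
  have inv_sin: "1 / sin \<omega> \<le> 2 / \<delta>" "0 < sin \<omega>" if "\<omega> \<in> {\<delta>..pi-\<delta>}" for \<omega>
    using sin_ge[OF that] \<delta> by (auto simp: field_simps)
  have bd1: "norm (F \<omega>) \<le> 4 / (\<bar>s\<bar> * \<delta>\<^sup>2)" if "\<omega> \<in> {\<delta>..pi-\<delta>}" for \<omega>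
  proof -
    have "norm (F \<omega>) = 1 / sin \<omega> / \<bar>s\<bar>" using inv_sin[OF that] s
      by (simp add: F_def norm_mult norm_divide norm_f)
    also have "\<dots> \<le> 2 / \<delta> / \<bar>s\<bar>" using inv_sin[OF that] by (intro divide_right_mono) auto
    also have "\<dots> \<le> 4 / \<delta>\<^sup>2 / \<bar>s\<bar>" using \<delta> by (intro divide_right_mono) (auto simp: field_simps power2_eq_square)
    finally show ?thesis by (simp add: field_simps)
  qed
  have bd2: "norm (g \<omega>) \<le> 4 * (1 + \<bar>m\<bar>) / (\<bar>s\<bar> * \<delta>\<^sup>2)" if "\<omega> \<in> {\<delta>..pi-\<delta>}" for \<omega>
  proof -
    have "2 / \<delta> \<le> 4 / \<delta>\<^sup>2" using \<delta> by (auto simp: field_simps power2_eq_square)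
    hence a1: "1 / sin \<omega> \<le> 4 / \<delta>\<^sup>2" using inv_sin[OF that] by linarith
    have "(1 / sin \<omega>)\<^sup>2 \<le> (2 / \<delta>)\<^sup>2" using inv_sin[OF that] by (intro power_mono) auto
    hence a2: "1 / (sin \<omega>)\<^sup>2 \<le> 4 / \<delta>\<^sup>2" by (simp add: power_divide)
    have "norm (\<i> * of_real m / of_real (sin \<omega>) - of_real (cos \<omega>) / of_real (sin \<omega>) ^ 2 :: complex)
       \<le> norm (\<i> * of_real m / of_real (sin \<omega>) :: complex) + norm (of_real (cos \<omega>) / of_real (sin \<omega>) ^ 2 :: complex)"
      by (rule norm_triangle_ineq4)
    also have "\<dots> = \<bar>m\<bar> * (1 / sin \<omega>) + \<bar>cos \<omega>\<bar> * (1 / (sin \<omega>)\<^sup>2)"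
      using inv_sin[OF that] by (simp add: norm_divide norm_mult norm_power)
    also have "\<dots> \<le> \<bar>m\<bar> * (4 / \<delta>\<^sup>2) + 1 * (4 / \<delta>\<^sup>2)"
      using a1 a2 inv_sin[OF that] by (intro add_mono mult_mono) auto
    finally have "norm (g \<omega>) \<le> 1 / \<bar>s\<bar> * (\<bar>m\<bar> * (4 / \<delta>\<^sup>2) + 1 * (4 / \<delta>\<^sup>2))"
      unfolding g_def norm_mult norm_f norm_divide using s by (simp add: divide_right_mono)
    also have "\<dots> = 4 * (1 + \<bar>m\<bar>) / (\<bar>s\<bar> * \<delta>\<^sup>2)" using s \<delta> by (simp add: field_simps)
    finally show ?thesis .
  qed
  define A where "A = 4 / (\<bar>s\<bar> * \<delta>\<^sup>2)"
  have A: "A \<ge> 0" using \<delta> by (simp add: A_def)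
  have "norm (integral {\<delta>..pi-\<delta>} g) \<le> 4 * (1 + \<bar>m\<bar>) / (\<bar>s\<bar> * \<delta>\<^sup>2) * (pi - \<delta> - \<delta>)"
    using \<delta>pi bd2 by (intro integral_bound gc) auto
  also have "\<dots> \<le> 4 * (1 + \<bar>m\<bar>) / (\<bar>s\<bar> * \<delta>\<^sup>2) * 4"
    using \<delta> pi_less_4 by (intro mult_left_mono) auto
  finally have "norm (integral {\<delta>..pi-\<delta>} g) \<le> A * (1 + \<bar>m\<bar>) * 4" by (simp add: A_def)
  moreover have "norm (F (pi - \<delta>)) \<le> A" "norm (F \<delta>) \<le> A"
    unfolding A_def using \<delta>pi \<delta> by (intro bd1; simp)+
  ultimately have "norm (integral {\<delta>..pi-\<delta>} f) \<le> A + A + A * (1 + \<bar>m\<bar>) * 4"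
    unfolding mid by (smt (verit) norm_triangle_ineq4)
  also have "\<dots> \<le> A * (1 + \<bar>m\<bar>) + A * (1 + \<bar>m\<bar>) + A * (1 + \<bar>m\<bar>) * 4"
    using A by (simp add: algebra_simps)
  also have "\<dots> = A * (6 * (1 + \<bar>m\<bar>))" by (simp add: algebra_simps)
  also have "\<dots> = 24 * (1 + \<bar>m\<bar>) / (\<bar>s\<bar> * \<delta>\<^sup>2)" by (simp add: A_def)
  finally have mid_le: "norm (integral {\<delta>..pi-\<delta>} f) \<le> 24 * (1 + \<bar>m\<bar>) / (\<bar>s\<bar> * \<delta>\<^sup>2)" .
  have "norm (integral {0..pi} f) \<le> \<delta> + norm (integral {\<delta>..pi-\<delta>} f) + \<delta>"
    unfolding split using outer by (intro order.trans[OF norm_triangle_ineq] add_mono) simp_all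
  thus ?thesis
    using mid_le unfolding f_def[symmetric] by (smt (verit))
qed

lemma acoeff_of_real_eq:
  "acoeff n (of_real y) = (integral {0..pi} (\<lambda>\<omega>. exp (\<i> * of_real (y * cos \<omega>)) * cis (of_int n * \<omega>))
     + cis (of_int n * pi) * integral {0..pi} (\<lambda>\<omega>. exp (\<i> * of_real (- y * cos \<omega>)) * cis (of_int n
         * \<omega>))) / of_real (2 * pi)"
proof -
  define f where "f = (\<lambda>\<omega>. exp (\<i> * of_real (y * cos \<omega>)) * cis (of_int n * \<omega>))"
  have cont: "continuous_on A f" for A
    unfolding f_def by (intro continuous_intros)
  have int: "f integrable_on {a..b}" for a b
    by (intro integrable_continuous_interval cont)
  have "(\<integral>\<omega>. f \<omega> \<partial>circle_measure) = (LINT \<omega>:{0..2*pi}|lborel. f \<omega>)"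
    by (simp add: integral_restrict_space set_lebesgue_integral_def)
  also have "\<dots> = integral {0..2*pi} f"
    by (intro set_borel_integral_eq_integral(2) borel_integrable_atLeastAtMost' cont)
  also have "\<dots> = integral {0..pi} f + integral {pi..2*pi} f"
    using int by (simp add: Henstock_Kurzweil_Integration.integral_combine)
  also have "integral {pi..2*pi} f = integral {0..pi} (f \<circ> (\<lambda>x. x + pi))"
    using integral_shift[of 0 pi pi f] cont by simp
  also have "f \<circ> (\<lambda>x. x + pi) = (\<lambda>\<omega>. cis (of_int n * pi) * (exp (\<i> * of_real (- y * cos \<omega>)) * cis (of_int n * \<omega>)))"
    by (simp add: fun_eq_iff f_def algebra_simps flip: cis_mult)
  finally have "(\<integral>\<omega>. f \<omega> \<partial>circle_measure) = integral {0..pi} f +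
     cis (of_int n * pi) * integral {0..pi} (\<lambda>\<omega>. exp (\<i> * of_real (- y * cos \<omega>)) * cis (of_int n * \<omega>))"
    by simp
  thus ?thesis by (simp add: acoeff_def f_def)
qed

lemma norm_acoeff_eq: "norm (acoeff n Z) = norm (acoeff n (of_real (norm Z)))"
proof (cases "Z = 0")
  case False
  have "acoeff n Z = acoeff n (of_real (norm Z) * (Z / of_real (norm Z)))" using False by simp
  also have "\<dots> = acoeff n (of_real (norm Z)) * (Z / of_real (norm Z)) powi (- n)"
    using False by (intro acoeff_rotate) (simp add: norm_divide)
  finally show ?thesis using False by (simp add: norm_mult norm_power_int norm_divide)
qed simp

text \<open>The dependence on \<open>n\<close> is kept explicit, since the bound is summed over \<open>n\<close> later.\<close>
lemma norm_acoeff_le: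
  assumes "Z \<noteq> 0"
  shows "norm (acoeff n Z) \<le> 26 * (1 + \<bar>of_int n\<bar>) * norm Z powr (- 1 / 3)"
proof (cases "norm Z \<ge> 1")
  case False
  have "1 \<le> norm Z powr (- 1 / 3)"
    using False assms powr_mono2'[of "-1/3" "norm Z" 1] by simp
  hence "1 * 1 \<le> 26 * (1 + \<bar>of_int n\<bar>) * norm Z powr (- 1 / 3)"
    by (intro mult_mono) auto
  thus ?thesis using norm_acoeff_le_1[of n Z] by simp
next
  case True
  define y where "y = norm Z"
  define \<delta> where "\<delta> = y powr (- 1 / 3)"
  have y: "y \<ge> 1" using True by (simp add: y_def)
  have \<delta>: "0 < \<delta>" "\<delta> \<le> 1" using y powr_mono2'[of "-1/3" 1 y] by (auto simp: \<delta>_def)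
  have "\<delta> ^ 3 = y powr (of_nat 3 * (- 1 / 3))"
    unfolding \<delta>_def using y by (intro powr_power) simp
  hence "\<delta> ^ 3 = 1 / y" using y by (simp add: powr_minus_divide)
  hence *: "1 / (y * \<delta>\<^sup>2) = \<delta>" using y \<delta> by (simp add: field_simps power3_eq_cube power2_eq_square)
  have b: "norm (integral {0..pi} (\<lambda>\<omega>. exp (\<i> * of_real (s * cos \<omega>)) * cis (of_int n * \<omega>)))
     \<le> 26 * (1 + \<bar>of_int n\<bar>) * \<delta>" if "\<bar>s\<bar> = y" for s
  proof -
    have "norm (integral {0..pi} (\<lambda>\<omega>. exp (\<i> * of_real (s * cos \<omega>)) * cis (of_int n * \<omega>)))
       \<le> 2 * \<delta> + 24 * (1 + \<bar>of_int n\<bar>) / (\<bar>s\<bar> * \<delta>\<^sup>2)"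
      using that y \<delta> by (intro norm_oscillatory_integral_le) auto
    also have "24 * (1 + \<bar>of_int n\<bar>) / (\<bar>s\<bar> * \<delta>\<^sup>2) = 24 * (1 + \<bar>of_int n\<bar>) * \<delta>"
      unfolding that using * by (metis mult.right_neutral times_divide_eq_right)
    also have "2 * \<delta> + 24 * (1 + \<bar>of_int n\<bar>) * \<delta> \<le> 26 * (1 + \<bar>of_int n\<bar>) * \<delta>"
      using \<delta> by (simp add: algebra_simps)
    finally show ?thesis .
  qed
  have "norm (acoeff n Z) = norm (acoeff n (of_real y))" by (simp add: norm_acoeff_eq[of n Z] y_def)
  also have "\<dots> \<le> (26 * (1 + \<bar>of_int n\<bar>) * \<delta> + 26 * (1 + \<bar>of_int n\<bar>) * \<delta>) / (2 * pi)"
    unfolding acoeff_of_real_eq norm_divide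
    by (intro frac_le order.trans[OF norm_triangle_ineq] add_mono)
       (use y \<delta> b[of y] b[of "-y"] in \<open>auto simp: norm_mult\<close>)
  also have "\<dots> = 26 * (1 + \<bar>of_int n\<bar>) * \<delta> / pi" by simp
  also have "\<dots> \<le> 26 * (1 + \<bar>of_int n\<bar>) * \<delta> / 1" using \<delta> pi_gt3 by (intro divide_left_mono) auto
  finally show ?thesis by (simp add: \<delta>_def y_def)
qed

lemma borel_measurable_acoeff [measurable]: "acoeff n \<in> borel_measurable borel"
proof -
  interpret finite_measure circle_measure by (rule finite_circle_measure)
  have [measurable]: "cis \<in> borel_measurable borel"
    by (intro borel_measurable_continuous_onI continuous_intros)
  have [measurable]: "(\<lambda>x. x) \<in> borel_measurable circle_measure"
    by (rule measurable_restrict_space1) simp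
  have "(\<lambda>Z. \<integral>\<omega>. exp (\<i> * of_real (Re (Z * cis \<omega>))) * cis (of_int n * \<omega>) \<partial>circle_measure) \<in> borel_measurable borel"
    by measurable
  thus ?thesis unfolding acoeff_def[abs_def] by measurable
qed

section \<open>Integrals of exponentials and the Gamma function\<close>

lemma lborel_integrable_boundI:
  fixes f :: "real \<Rightarrow> 'a::{banach,second_countable_topology}"
  assumes "f \<in> borel_measurable borel" "integrable lborel g" "\<And>x. norm (f x) \<le> g x"
  shows "integrable lborel f"
  using assms(2) by (rule Bochner_Integration.integrable_bound) (use assms(1,3) order.trans[OF assms(3)
      abs_ge_self] in \<open>auto\<close>)

lemma set_integrable_exp_Ioi: "a < 0 \<Longrightarrow> set_integrable lborel {0<..} (\<lambda>r :: real. exp (a * r))"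
  using integrable_I0i_exp_mscale[of "-a"] by (simp add: mult.commute)

lemma integrable_exp_abs: "a < 0 \<Longrightarrow> integrable lborel (\<lambda>r :: real. exp (a * \<bar>r\<bar>))"
proof -
  assume a: "a < 0"
  have 1: "integrable lborel (\<lambda>r :: real. indicator {0<..} r * exp (a * r))"
    using set_integrable_exp_Ioi[OF a] by (simp add: set_integrable_def)
  have 2: "integrable lborel (\<lambda>r :: real. indicator {0<..} (-r) * exp (a * (-r)))"
    using lborel_integrable_real_affine[OF 1, of "-1" 0] by simp
  have "integrable lborel (\<lambda>r :: real. indicator {0<..} r * exp (a * r) + indicator {0<..} (-r) * exp (a * (-r)))"
    using 1 2 by (rule Bochner_Integration.integrable_add)
  moreover have "AE r in lborel. r \<noteq> (0::real)" by (rule AE_lborel_singleton)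
  ultimately show ?thesis
    by (elim integrable_cong_AE_imp) (auto elim!: eventually_mono simp: indicator_def)
qed

lemma set_integrable_exp_Iio: "0 < a \<Longrightarrow> set_integrable lborel {..<0} (\<lambda>r :: real. exp (a * r))"
proof -
  assume a: "0 < a"
  have "integrable lborel (\<lambda>r :: real. exp ((- a) * \<bar>r\<bar>))"
    using a by (intro integrable_exp_abs) auto
  thus ?thesis unfolding set_integrable_def
    by (rule Bochner_Integration.integrable_bound) (auto simp: indicator_def)
qed

lemma LINT_deriv_Ioi:
  fixes f f' :: "real \<Rightarrow> complex"
  assumes deriv: "\<And>x. (f has_vector_derivative f' x) (at x)"
    and cont: "continuous_on UNIV f'"
    and int: "set_integrable lborel {0<..} f'"
    and lim: "(f \<longlongrightarrow> 0) at_top"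
  shows "(LINT x:{0<..}|lborel. f' x) = - f 0"
proof -
  have "(f \<longlongrightarrow> f 0) (at_right 0)"
    using has_vector_derivative_continuous[OF deriv[of 0]] by (simp add: isCont_def filterlim_at_split)
  hence lim0: "((f \<circ> real_of_ereal) \<longlongrightarrow> f 0) (at_right 0)"
    unfolding zero_ereal_def by (simp add: ereal_tendsto_simps)
  have "(LBINT x=0..\<infinity>. f' x) = 0 - f 0"
  proof (rule interval_integral_FTC_integrable[where F = f, OF _ _ _ _ lim0])
    show "set_integrable lborel (einterval 0 \<infinity>) f'"
      unfolding zero_ereal_def using int by simp
    show "((f \<circ> real_of_ereal) \<longlongrightarrow> 0) (at_left \<infinity>)"
      using lim by (simp_all add: ereal_tendsto_simps)
  qed (use deriv cont in \<open>auto simp: continuous_on_eq_continuous_at\<close>)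
  thus ?thesis
    by (simp add: interval_lebesgue_integral_def zero_ereal_def)
qed

lemma exp_mult_of_real_has_vector_derivative:
  "((\<lambda>r. exp (s * of_real r)) has_vector_derivative (s * exp (s * of_real r))) (at r within A)" for s :: complex
proof -
  have "((\<lambda>w. exp (s * w)) has_field_derivative (s * exp (s * w))) (at w)" for w
    by (auto intro!: derivative_eq_intros)
  from has_vector_derivative_real_field[OF this[of "of_real r"], of A] show ?thesis by (simp add: o_def)
qed

lemma
  fixes s :: complex
  assumes "Re s > 0"
  shows set_integrable_cexp_Iio: "set_integrable lborel {..<0} (\<lambda>r. exp (s * of_real r))"
    and LINT_cexp_Iio: "(LINT r:{..<0}|lborel. exp (s * of_real r)) = 1 / s"
proof -
  show int: "set_integrable lborel {..<0} (\<lambda>r. exp (s * of_real r))"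
    using set_integrable_exp_Iio[OF assms]
    by (rule set_integrable_bound) (auto simp: set_borel_measurable_def intro!:
        borel_measurable_continuous_onI continuous_intros)
  define f where "f = (\<lambda>r. exp (s * of_real r) / s)"
  have s: "s \<noteq> 0" using assms by auto
  have "isCont f 0" unfolding f_def using s by (intro continuous_intros) auto
  hence "(f \<longlongrightarrow> f 0) (at_left 0)"
    by (simp add: isCont_def filterlim_at_split)
  hence lim0: "((f \<circ> real_of_ereal) \<longlongrightarrow> f 0) (at_left 0)"
    unfolding zero_ereal_def by (simp add: ereal_tendsto_simps)
  have "((\<lambda>r. norm (f r)) \<longlongrightarrow> 0) at_bot"
  proof -
    have "filterlim (\<lambda>r. Re s * r) at_bot at_bot"
      using assms by (intro filterlim_tendsto_pos_mult_at_bot[OF tendsto_const] filterlim_ident) auto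
    hence "((\<lambda>r. exp (Re s * r) / norm s) \<longlongrightarrow> 0 / norm s) at_bot"
      using s by (intro tendsto_divide tendsto_const filterlim_compose[OF exp_at_bot]) auto
    thus ?thesis by (simp add: f_def norm_divide)
  qed
  hence lim: "(f \<longlongrightarrow> 0) at_bot" by (rule tendsto_norm_zero_cancel)
  have "(LBINT x=-\<infinity>..0. exp (s * of_real x)) = f 0 - 0"
  proof (rule interval_integral_FTC_integrable[where F = f, OF _ _ _ _ _ lim0])
    show "set_integrable lborel (einterval (-\<infinity>) 0) (\<lambda>r. exp (s * of_real r))"
      unfolding zero_ereal_def using int by simp
    show "((f \<circ> real_of_ereal) \<longlongrightarrow> 0) (at_right (-\<infinity>))"
      using lim by (simp_all add: ereal_tendsto_simps)
    show "(f has_vector_derivative exp (s * of_real x)) (at x)" for x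
      using has_vector_derivative_divide[OF exp_mult_of_real_has_vector_derivative[of s x UNIV], of s] s
      by (simp add: f_def)
  qed (auto intro!: continuous_intros)
  thus "(LINT r:{..<0}|lborel. exp (s * of_real r)) = 1 / s"
    by (simp add: interval_lebesgue_integral_def zero_ereal_def f_def)
qed

lemma power_le_fact_exp: "0 \<le> u \<Longrightarrow> u ^ N \<le> fact N * exp (u :: real)"
proof -
  assume u: "0 \<le> u"
  have "u ^ N / fact N = (\<Sum>n\<in>{N}. u ^ n /\<^sub>R fact n)" by (simp add: divide_inverse mult.commute)
  also have "\<dots> \<le> (\<Sum>n. u ^ n /\<^sub>R fact n)"
    using u by (intro sum_le_suminf summable_exp_generic) auto
  finally show ?thesis by (simp add: exp_def field_simps)
qed

lemma integrable_exp_exp: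
  fixes a :: real
  assumes "a > 0"
  shows "integrable lborel (\<lambda>t. exp (a * t - exp t))"
proof -
  obtain N :: nat where N: "real N \<ge> 2 * a" using real_arch_simple by blast
  have "integrable lborel (\<lambda>t::real. fact N * exp ((-a) * \<bar>t\<bar>))"
    using assms by (intro integrable_mult_right integrable_exp_abs) auto
  thus ?thesis
  proof (rule Bochner_Integration.integrable_bound)
    have "exp (a * t - exp t) \<le> fact N * exp ((-a) * \<bar>t\<bar>)" for t
    \<comment> \<open>For positive t the double exponential beats exp (2 a t), as N is at least 2 a.\<close>
    proof (cases "t \<ge> 0")
      case True
      have "exp (2 * a * t) \<le> exp (real N * t)" using True N by (simp add: mult_right_mono)
      also have "\<dots> = exp t ^ N" by (simp add: exp_of_nat_mult)
      also have "\<dots> \<le> fact N * exp (exp t)" by (rule power_le_fact_exp) simp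
      finally have "exp (2 * a * t) * exp (- exp t - a * t) \<le> fact N * exp (exp t) * exp (- exp t - a * t)"
        by (rule mult_right_mono) simp
      thus ?thesis using True by (simp add: mult.assoc flip: exp_add)
    next
      case False
      hence "exp (a * t - exp t) \<le> 1 * exp ((-a) * \<bar>t\<bar>)" by simp
      also have "\<dots> \<le> fact N * exp ((-a) * \<bar>t\<bar>)" by (intro mult_right_mono) auto
      finally show ?thesis .
    qed
    thus "AE t in lborel. norm (exp (a * t - exp t)) \<le> norm (fact N * exp ((-a) * \<bar>t\<bar>))"
      by auto
  qed (auto intro!: borel_measurable_continuous_onI continuous_intros)
qed

text \<open>Euler's integral after the substitution \<open>x = e^t\<close>, which turns dilations into
translations.\<close>
lemma has_bochner_integral_Gamma:
  fixes s :: complex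
  assumes s: "Re s > 0"
  shows "has_bochner_integral lborel (\<lambda>t. exp (s * of_real t - of_real (exp t))) (Gamma s)"
proof -
  define f where "f = (\<lambda>t. of_real t powr (s - 1) / of_real (exp t) :: complex)"
  have int1: "integrable lborel (\<lambda>t. exp (s * of_real t - of_real (exp t)))"
    by (rule lborel_integrable_boundI[OF _ integrable_exp_exp[OF s]])
       (auto intro!: borel_measurable_continuous_onI continuous_intros)
  have fexp: "exp t *\<^sub>R f (exp t) = exp (s * of_real t - of_real (exp t))" for t
  proof -
    have "f (exp t) = exp ((s - 1) * of_real t - of_real (exp t))"
      by (simp add: f_def powr_def Ln_of_real exp_diff flip: exp_of_real)
    thus ?thesis by (simp add: scaleR_conv_of_real algebra_simps flip: exp_of_real exp_add)
  qed
  have fi: "f absolutely_integrable_on {0<..}"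
    unfolding f_def using absolutely_integrable_Gamma_integral'[OF s] .
  have fm: "set_borel_measurable borel {0<..} f"
    unfolding set_borel_measurable_def
  proof (rule borel_measurable_continuous_on_indicator)
    show "continuous_on {0<..} f" unfolding f_def
      by (intro continuous_intros) (auto simp: complex_nonpos_Reals_iff)
  qed auto
  have fi': "set_integrable lborel {0<..} f"
    using fi fm unfolding set_integrable_def set_borel_measurable_def by (simp add: integrable_completion)
  have "(LBINT x=0..\<infinity>. f x) = (LBINT x=-\<infinity>..\<infinity>. exp x *\<^sub>R f (exp x))"
  proof (rule interval_integral_substitution_integrable)
    show "isCont f (exp x)" for x
      unfolding f_def by (intro continuous_intros) (auto simp: complex_nonpos_Reals_iff)
    show "((ereal \<circ> exp \<circ> real_of_ereal) \<longlongrightarrow> 0) (at_right (- \<infinity>))"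
      by (simp only: ereal_tendsto_simps) (simp add: o_def zero_ereal_def exp_at_bot)
    show "((ereal \<circ> exp \<circ> real_of_ereal) \<longlongrightarrow> \<infinity>) (at_left \<infinity>)"
      by (simp only: ereal_tendsto_simps) (simp add: o_def tendsto_PInfty_eq_at_top exp_at_top)
    show "set_integrable lborel (einterval (- \<infinity>) \<infinity>) (\<lambda>x. exp x *\<^sub>R f (exp x))"
      unfolding fexp using int1 by (simp add: set_integrable_def)
    show "set_integrable lborel (einterval 0 \<infinity>) f"
      unfolding zero_ereal_def using fi' by simp
  qed (auto intro!: derivative_eq_intros)
  hence "(LINT x:{0<..}|lborel. f x) = (\<integral>x. exp (s * of_real x - of_real (exp x)) \<partial>lborel)"
    by (simp add: fexp interval_lebesgue_integral_def zero_ereal_def set_lebesgue_integral_def)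
  moreover have "(LINT x:{0<..}|lborel. f x) = Gamma s"
    using set_borel_integral_eq_integral(2)[OF fi'] integral_unique[OF Gamma_integral_complex'[OF s]]
    by (simp add: f_def)
  ultimately show ?thesis using int1 by (simp add: has_bochner_integral_iff)
qed

lemma has_bochner_integral_Gamma_affine:
  fixes s :: complex and c t :: real
  assumes s: "Re s > 0" and c: "c \<noteq> 0"
  shows "has_bochner_integral lborel (\<lambda>x. exp (s * of_real (c * x) - of_real (exp (t + c * x))))
           (Gamma s * exp (- s * of_real t) / of_real \<bar>c\<bar>)"
proof -
  have "has_bochner_integral lborel (\<lambda>x. exp (s * of_real (t + c * x) - of_real (exp (t + c * x)))) (Gamma s /\<^sub>R \<bar>c\<bar>)"
    using lborel_has_bochner_integral_real_affine_iff[OF c, of "\<lambda>t. exp (s * of_real t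
        - of_real (exp t))" "Gamma s" t]
      has_bochner_integral_Gamma[OF s] by simp
  hence "has_bochner_integral lborel (\<lambda>x. exp (- s * of_real t) * exp (s * of_real (t + c * x)
      - of_real (exp (t + c * x)))) (exp (- s * of_real t) * (Gamma s /\<^sub>R \<bar>c\<bar>))"
    by (rule has_bochner_integral_mult_right)
  moreover have "exp (- s * of_real t) * exp (s * of_real (t + c * x) - of_real (exp (t + c * x)))
     = exp (s * of_real (c * x) - of_real (exp (t + c * x)))" for x
    by (simp add: algebra_simps flip: exp_add)
  moreover have "exp (- s * of_real t) * (Gamma s /\<^sub>R \<bar>c\<bar>) = Gamma s * exp (- s * of_real t) / of_real \<bar>c\<bar>"
    by (simp add: scaleR_conv_of_real divide_inverse mult_ac)
  ultimately show ?thesis by simp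
qed

lemma has_bochner_integral_Gamma_affine_real:
  fixes a c t :: real
  assumes "a > 0" "c \<noteq> 0"
  shows "has_bochner_integral lborel (\<lambda>x. exp (a * (c * x) - exp (t + c * x)))
           (Gamma a * exp (- a * t) / \<bar>c\<bar>)"
proof -
  have "has_bochner_integral lborel (\<lambda>x. Re (exp (of_real a * of_real (c * x) - of_real (exp (t + c * x)))))
           (Re (Gamma (of_real a) * exp (- of_real a * of_real t) / of_real \<bar>c\<bar>))"
    using assms by (intro has_bochner_integral_bounded_linear[OF bounded_linear_Re]
        has_bochner_integral_Gamma_affine) auto
  moreover have "exp (of_real a * of_real (c * x) - of_real (exp (t + c * x)) :: complex)
    = of_real (exp (a * (c * x) - exp (t + c * x)))" for x
    by (simp flip: exp_of_real)
  moreover have "Gamma (of_real a) * exp (- of_real a * of_real t) / of_real \<bar>c\<bar>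
      = complex_of_real (Gamma a * exp (- a * t) / \<bar>c\<bar>)"
    by (simp add: Gamma_complex_of_real flip: exp_of_real)
  ultimately show ?thesis by (simp only: Re_complex_of_real)
qed

section \<open>Bessel functions of integer order\<close>

text \<open>The Taylor coefficients of the entire function \<open>\<Sum>k. (-t)^k / (k! (n + k)!)\<close>, which is
\<open>J_n (2 \<surd>t)\<close> divided by \<open>t^{n/2}\<close>.\<close>
definition bes_coeff :: "nat \<Rightarrow> nat \<Rightarrow> real" where
  "bes_coeff n k = (-1) ^ k / (fact k * fact (n + k))"

definition bes_entire :: "nat \<Rightarrow> real \<Rightarrow> real" where
  "bes_entire n t = (\<Sum>k. bes_coeff n k * t ^ k)"

text \<open>The Bessel function \<open>J_n\<close> of order \<open>n \<ge> 0\<close> on the real line.\<close>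
definition besJ :: "nat \<Rightarrow> real \<Rightarrow> real" where
  "besJ n y = (y / 2) ^ n * bes_entire n (y\<^sup>2 / 4)"

lemma abs_bes_coeff_le: "\<bar>bes_coeff n k\<bar> \<le> 1 / fact k"
  by (simp add: bes_coeff_def divide_simps)

lemma bes_coeff_Suc: "real (n + Suc k) * bes_coeff (Suc n) k = bes_coeff n k"
  by (simp add: bes_coeff_def divide_simps)

lemma abs_bes_coeff_power_le: "norm (bes_coeff n k * t ^ k) \<le> \<bar>t\<bar> ^ k / fact k"
  using mult_right_mono[OF abs_bes_coeff_le[of n k], of "\<bar>t\<bar> ^ k"] by (simp add: abs_mult power_abs)

lemma summable_power_fact: "summable (\<lambda>k. t ^ k / fact k :: real)"
  using summable_exp_generic[of t] by (simp add: divide_inverse mult.commute)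

lemma summable_norm_bes_entire: "summable (\<lambda>k. norm (bes_coeff n k * t ^ k))"
  by (rule summable_comparison_test'[OF summable_power_fact[of "\<bar>t\<bar>"]]) (use abs_bes_coeff_power_le in auto)

lemma bes_entire_sums: "(\<lambda>k. bes_coeff n k * t ^ k) sums bes_entire n t"
  unfolding bes_entire_def by (rule summable_sums, rule summable_norm_cancel, rule summable_norm_bes_entire)

lemma bes_entire_has_sum: "((\<lambda>k. bes_coeff n k * t ^ k) has_sum bes_entire n t) UNIV"
  by (rule norm_summable_imp_has_sum[OF summable_norm_bes_entire bes_entire_sums])

lemma abs_bes_entire_le: "\<bar>bes_entire n t\<bar> \<le> exp \<bar>t\<bar>"
proof -
  have "\<bar>bes_entire n t\<bar> \<le> (\<Sum>k. norm (bes_coeff n k * t ^ k))"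
    unfolding bes_entire_def using summable_norm[OF summable_norm_bes_entire] by simp
  also have "\<dots> \<le> (\<Sum>k. \<bar>t\<bar> ^ k / fact k)"
    by (intro suminf_le abs_bes_coeff_power_le summable_norm_bes_entire summable_power_fact)
  also have "\<dots> = exp \<bar>t\<bar>" by (simp add: exp_def divide_inverse mult.commute)
  finally show ?thesis .
qed

lemma bes_entire_deriv: "(bes_entire n has_field_derivative - bes_entire (Suc n) t) (at t)"
proof -
  have "((\<lambda>x. \<Sum>k. bes_coeff n k * x ^ k) has_field_derivative (\<Sum>k. diffs (bes_coeff n) k * t ^ k)) (at t)"
    by (rule termdiffs_strong_converges_everywhere) (rule summable_norm_cancel, rule summable_norm_bes_entire)
  moreover have "diffs (bes_coeff n) k = - bes_coeff (Suc n) k" for k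
    by (simp add: diffs_def bes_coeff_def divide_simps)
  moreover have "(\<Sum>k. - bes_coeff (Suc n) k * t ^ k) = - bes_entire (Suc n) t"
    using sums_unique[OF sums_minus[OF bes_entire_sums[of "Suc n" t]]] by simp
  ultimately show ?thesis by (simp add: bes_entire_def[abs_def])
qed

lemma bes_entire_rec: "bes_entire n t = real (n + 1) * bes_entire (Suc n) t - t * bes_entire (n + 2) t"
proof -
  have "(\<lambda>k. bes_coeff n k * t ^ k - real (n + 1) * (bes_coeff (Suc n) k * t ^ k)) sums (bes_entire n t
      - real (n + 1) * bes_entire (Suc n) t)"
    by (intro sums_diff sums_mult bes_entire_sums)
  hence "(\<lambda>k. bes_coeff n (Suc k) * t ^ Suc k - real (n + 1) * (bes_coeff (Suc n) (Suc k)
      * t ^ Suc k)) sums (bes_entire n t - real (n + 1) * bes_entire (Suc n) t)"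
    by (subst sums_Suc_iff) (simp add: bes_coeff_def divide_simps)
  moreover have "bes_coeff n (Suc k) * t ^ Suc k - real (n + 1) * (bes_coeff (Suc n) (Suc k)
      * t ^ Suc k) = - t * (bes_coeff (n + 2) k * t ^ k)" for k
  proof -
    have e1: "bes_coeff n (Suc k) = real (n + k + 2) * bes_coeff (Suc n) (Suc k)"
      using bes_coeff_Suc[of n "Suc k"] by simp
    have e2: "bes_coeff (n + 2) k = - real (Suc k) * bes_coeff (Suc n) (Suc k)"
      by (simp add: bes_coeff_def divide_simps) (simp add: algebra_simps)
    show ?thesis unfolding e1 e2 power_Suc by (simp add: algebra_simps)
  qed
  moreover have "(\<lambda>k. - t * (bes_coeff (n + 2) k * t ^ k)) sums (- t * bes_entire (n + 2) t)"
    by (intro sums_mult bes_entire_sums)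
  ultimately have "bes_entire n t - real (n + 1) * bes_entire (Suc n) t = - t * bes_entire (n + 2) t"
    by (simp only: sums_unique2)
  thus ?thesis by simp
qed

lemma ecoeff_nat: "ecoeff k (n + k) (of_real x) = \<i> ^ n * of_real (bes_coeff n k * (x / 2) ^ (n + 2 * k))"
proof -
  have "ecoeff k (n + k) (of_real x) = (\<i> * of_real (x / 2)) ^ (k + (n + k)) / (fact k * fact (n + k))"
    by (simp add: ecoeff_def power_add)
  also have "k + (n + k) = n + 2 * k" by simp
  also have "(\<i> * of_real (x / 2)) ^ (n + 2 * k) = \<i> ^ n * (-1) ^ k * of_real ((x / 2) ^ (n + 2 * k))"
    by (simp only: power_mult_distrib power_add power_mult power2_i of_real_power of_real_mult)
      (simp only: mult_ac)
  finally show ?thesis by (simp add: bes_coeff_def mult_ac)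
qed

text \<open>Bessel's integral for \<open>J_n\<close>, read off from the double series.\<close>
lemma acoeff_nat: "acoeff (int n) (of_real y) = \<i> ^ n * of_real (besJ n y)"
proof -
  have q: "ecoeff k (n + k) (of_real y) = \<i> ^ n * of_real ((y / 2) ^ n * (bes_coeff n k * (y\<^sup>2 / 4) ^ k))" for k
  proof -
    have "(y / 2) ^ (n + 2 * k) = (y / 2) ^ n * ((y / 2)\<^sup>2) ^ k" by (simp only: power_add power_mult)
    thus ?thesis by (simp add: ecoeff_nat power_divide)
  qed
  have "((\<lambda>k. \<i> ^ n * complex_of_real ((y / 2) ^ n * (bes_coeff n k * (y\<^sup>2 / 4) ^ k))) has_sum \<i> ^ n
      * of_real (besJ n y)) UNIV"
    unfolding besJ_def by (intro has_sum_cmult_right has_sum_of_real bes_entire_has_sum)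
  hence "((\<lambda>(c, d). ecoeff c d (of_real y)) \<circ> (\<lambda>k. (k, n + k)) has_sum \<i> ^ n * of_real (besJ n y)) UNIV"
    by (simp add: o_def q)
  hence "((\<lambda>(c, d). ecoeff c d (of_real y)) has_sum \<i> ^ n * of_real (besJ n y)) (range (\<lambda>k. (k, n + k)))"
    by (subst has_sum_reindex) (auto simp: inj_def)
  hence "((\<lambda>(c, d). if int d - int c = int n then ecoeff c d (of_real y) else 0) has_sum \<i> ^ n
      * of_real (besJ n y)) UNIV"
    by (rule has_sum_cong_neutral[THEN iffD1, rotated -1]) (auto simp: image_iff)
  thus ?thesis using has_sum_unique[OF acoeff_has_sum] by blast
qed

lemma abs_besJ_le_decay: "y > 0 \<Longrightarrow> \<bar>besJ n y\<bar> \<le> 26 * (1 + real n) * y powr (- 1 / 3)"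
  using norm_acoeff_le[of "of_real y" "int n"] by (simp add: acoeff_nat norm_mult norm_power)

lemma abs_besJ_le_small: "0 \<le> y \<Longrightarrow> \<bar>besJ n y\<bar> \<le> (y / 2) ^ n * exp (y\<^sup>2 / 4)"
  using mult_left_mono[OF abs_bes_entire_le[of n "y\<^sup>2 / 4"], of "(y / 2) ^ n"]
      by (simp add: besJ_def abs_mult power_abs)

lemma continuous_on_bes_entire: "continuous_on UNIV (bes_entire n)"
  by (rule DERIV_continuous_on[OF has_field_derivative_at_within[OF bes_entire_deriv]])

lemma continuous_on_besJ [continuous_intros]:
  assumes "continuous_on A f"
  shows "continuous_on A (\<lambda>x. besJ n (f x))"
  unfolding besJ_def
  by (rule continuous_on_mult[OF _ continuous_on_compose2[OF continuous_on_bes_entire]])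
     (auto intro!: continuous_intros assms)

lemma besJ_exp_has_sum:
  assumes "x > 0"
  shows "((\<lambda>k. bes_coeff n k * (x / 2) ^ (n + 2 * k) * exp (real (n + 2 * k) * r)) has_sum besJ n (x * exp r)) UNIV"
proof -
  have "((\<lambda>k. (x * exp r / 2) ^ n * (bes_coeff n k * ((x * exp r)\<^sup>2 / 4) ^ k)) has_sum besJ n (x * exp r)) UNIV"
    unfolding besJ_def by (intro has_sum_cmult_right bes_entire_has_sum)
  moreover have "(x * exp r / 2) ^ n * (bes_coeff n k * ((x * exp r)\<^sup>2 / 4) ^ k)
     = bes_coeff n k * (x / 2) ^ (n + 2 * k) * exp (real (n + 2 * k) * r)" for k
  proof -
    have "(x * exp r)\<^sup>2 / 4 = (x * exp r / 2)\<^sup>2" by (simp add: power2_eq_square)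
    hence "(x * exp r / 2) ^ n * (bes_coeff n k * ((x * exp r)\<^sup>2 / 4) ^ k) = bes_coeff n k * (x / 2
        * exp r) ^ (n + 2 * k)"
      by (simp add: power_add power_mult)
    also have "\<dots> = bes_coeff n k * ((x / 2) ^ (n + 2 * k) * exp r ^ (n + 2 * k))"
      by (simp only: power_mult_distrib)
    also have "exp r ^ (n + 2 * k) = exp (real (n + 2 * k) * r)" by (rule exp_of_nat_mult[symmetric])
    finally show ?thesis by simp
  qed
  ultimately show ?thesis by simp
qed

section \<open>Mellin transforms of Bessel functions over a half-line\<close>

context
  fixes x :: real
begin

text \<open>The Mellin transform \<open>\<integral>_1^\<infinity> J_n (x y) y^{S - 1} dy\<close> in the variable \<open>y = e^r\<close>.\<close>
definition mellin :: "nat \<Rightarrow> complex \<Rightarrow> complex" where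
  "mellin n S = (LINT r:{0<..}|lborel. exp (S * of_real r) * of_real (besJ n (x * exp r)))"

text \<open>The Mellin transform of \<open>y \<mapsto> J_n (x y)\<close> over \<open>(0, \<infinity>)\<close>,
\<open>1/2 (x/2)^{-S} \<Gamma> ((n + S)/2) / \<Gamma> ((n - S)/2 + 1)\<close>, with its meromorphic continuation in \<open>S\<close>.\<close>
definition gamma_part :: "nat \<Rightarrow> complex \<Rightarrow> complex" where
  "gamma_part n S = exp (- S * of_real (ln (x / 2))) * Gamma ((of_nat n + S) / 2) * rGamma ((of_nat n
      - S) / 2 + 1) / 2"

text \<open>The coefficient of \<open>y^{n + 2 k}\<close> in \<open>J_n (x y)\<close>.\<close>
definition scoeff :: "nat \<Rightarrow> nat \<Rightarrow> real" where
  "scoeff n k = bes_coeff n k * (x / 2) ^ (n + 2 * k)"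

text \<open>The contribution of \<open>(0, 1)\<close>, integrated term by term and continued to a series of simple
fractions in \<open>S\<close>.\<close>
definition pole_part :: "nat \<Rightarrow> complex \<Rightarrow> complex" where
  "pole_part n S = (\<Sum>k. of_real (scoeff n k) / (S + of_nat (n + 2 * k)))"

context
  assumes x: "x > 0"
begin

lemma continuous_on_mellin_integrand:
  "continuous_on A (\<lambda>r. exp (S * of_real r) * complex_of_real (besJ n (x * exp r)))"
  by (intro continuous_intros)

lemma set_borel_measurable_mellin_integrand:
  "A \<in> sets borel \<Longrightarrow> set_borel_measurable lborel A (\<lambda>r. exp (S * of_real r) * complex_of_real (besJ n (x * exp r)))"
  unfolding set_borel_measurable_def
  by (intro borel_measurable_scaleR) (auto intro!: borel_measurable_continuous_onI continuous_on_mellin_integrand)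

text \<open>The decay of the Bessel function makes the integral converge up to and including
\<open>Re S = 0\<close>.\<close>
lemma mellin_integrand_bound_pos:
  assumes "Re S \<le> 0" "r > 0"
  shows "norm (exp (S * of_real r) * complex_of_real (besJ n (x * exp r)))
           \<le> 26 * (1 + real n) * x powr (- 1 / 3) * exp ((- 1 / 3) * r)"
proof -
  have "norm (exp (S * of_real r) * complex_of_real (besJ n (x * exp r))) = exp (Re S * r) * \<bar>besJ n (x * exp r)\<bar>"
    by (simp add: norm_mult)
  also have "\<dots> \<le> 1 * (26 * (1 + real n) * (x * exp r) powr (- 1 / 3))"
    using assms x by (intro mult_mono abs_besJ_le_decay) (auto simp: mult_nonpos_nonneg)
  also have "(x * exp r) powr (- 1 / 3) = x powr (- 1 / 3) * exp ((- 1 / 3) * r)"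
    using x by (simp add: powr_mult exp_powr_real)
  finally show ?thesis by simp
qed

lemma set_integrable_mellin_pos:
  assumes "Re S \<le> 0"
  shows "set_integrable lborel {0<..} (\<lambda>r. exp (S * of_real r) * complex_of_real (besJ n (x * exp r)))"
proof -
  have "set_integrable lborel {0<..} (\<lambda>r. 26 * (1 + real n) * x powr (- 1 / 3) * exp ((- 1 / 3) * r))"
    by (intro set_integrable_mult_right set_integrable_exp_Ioi) auto
  thus ?thesis
    by (rule set_integrable_bound)
      (use order.trans[OF mellin_integrand_bound_pos[OF assms] abs_ge_self]
          set_borel_measurable_mellin_integrand in \<open>auto\<close>)
qed

lemma set_integrable_mellin_neg:
  assumes "Re S > - real n"
  shows "set_integrable lborel {..<0} (\<lambda>r. exp (S * of_real r) * complex_of_real (besJ n (x * exp r)))"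
proof -
  have bd: "norm (exp (S * of_real r) * complex_of_real (besJ n (x * exp r)))
      \<le> (x / 2) ^ n * exp (x\<^sup>2 / 4) * exp ((real n + Re S) * r)" if "r < 0" for r
  proof -
    have le: "x * exp r \<le> x" using that x by simp
    have "\<bar>besJ n (x * exp r)\<bar> \<le> (x * exp r / 2) ^ n * exp ((x * exp r)\<^sup>2 / 4)"
      using x by (intro abs_besJ_le_small) auto
    also have "\<dots> \<le> (x * exp r / 2) ^ n * exp (x\<^sup>2 / 4)"
      using x le by (intro mult_left_mono) (auto intro: power_mono)
    also have "(x * exp r / 2) ^ n = (x / 2) ^ n * exp (real n * r)"
      by (simp add: power_mult_distrib power_divide exp_of_nat_mult)
    finally have "\<bar>besJ n (x * exp r)\<bar> * exp (Re S * r) \<le> ((x / 2) ^ n * exp (real n * r)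
        * exp (x\<^sup>2 / 4)) * exp (Re S * r)"
      by (intro mult_right_mono) auto
    thus ?thesis by (simp add: norm_mult algebra_simps exp_add)
  qed
  have "set_integrable lborel {..<0} (\<lambda>r. (x / 2) ^ n * exp (x\<^sup>2 / 4) * exp ((real n + Re S) * r))"
    using assms by (intro set_integrable_mult_right set_integrable_exp_Iio) auto
  thus ?thesis
    by (rule set_integrable_bound)
      (use order.trans[OF bd abs_ge_self] set_borel_measurable_mellin_integrand in \<open>auto\<close>)
qed

lemma mellin_integrand_split:
  assumes "Re S \<le> 0" "Re S > - real n"
  shows "integrable lborel (\<lambda>r. exp (S * of_real r) * complex_of_real (besJ n (x * exp r)))"
    and "(\<integral>r. exp (S * of_real r) * complex_of_real (besJ n (x * exp r)) \<partial>lborel)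
      = mellin n S + (LINT r:{..<0}|lborel. exp (S * of_real r) * of_real (besJ n (x * exp r)))"
proof -
  let ?f = "\<lambda>r. exp (S * of_real r) * complex_of_real (besJ n (x * exp r))"
  note i1 = set_integrable_mellin_pos[OF assms(1), of n, unfolded set_integrable_def]
    and i2 = set_integrable_mellin_neg[OF assms(2), unfolded set_integrable_def]
  have i: "integrable lborel (\<lambda>r. indicator {0<..} r *\<^sub>R ?f r + indicator {..<0} r *\<^sub>R ?f r)"
    by (rule Bochner_Integration.integrable_add[OF i1 i2])
  have m: "?f \<in> borel_measurable lborel"
    using continuous_on_mellin_integrand by (simp add: borel_measurable_continuous_onI)
  have ae: "AE r in lborel. indicator {0<..} r *\<^sub>R ?f r + indicator {..<0} r *\<^sub>R ?f r = ?f r"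
    using AE_lborel_singleton[of 0] by eventually_elim (auto simp: indicator_def)
  show "integrable lborel ?f" by (rule integrable_cong_AE_imp[OF i m ae])
  have "(\<integral>r. ?f r \<partial>lborel) = (\<integral>r. indicator {0<..} r *\<^sub>R ?f r + indicator {..<0} r *\<^sub>R ?f r \<partial>lborel)"
    using ae i m by (intro integral_cong_AE) (auto elim!: eventually_mono)
  also have "\<dots> = mellin n S + (LINT r:{..<0}|lborel. ?f r)"
    unfolding mellin_def set_lebesgue_integral_def by (rule Bochner_Integration.integral_add[OF i1 i2])
  finally show "(\<integral>r. ?f r \<partial>lborel) = mellin n S + (LINT r:{..<0}|lborel. ?f r)" .
qed

lemma scoeff_has_sum: "((\<lambda>k. scoeff n k * exp (real (n + 2 * k) * r)) has_sum besJ n (x * exp r)) UNIV"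
  unfolding scoeff_def using besJ_exp_has_sum[OF x] by simp

lemma abs_scoeff_le: "\<bar>scoeff n k\<bar> \<le> (x / 2) ^ n * (((x / 2)\<^sup>2) ^ k / fact k)"
proof -
  have "\<bar>scoeff n k\<bar> = \<bar>bes_coeff n k\<bar> * (x / 2) ^ (n + 2 * k)" using x by (simp add: scoeff_def abs_mult)
  also have "\<dots> \<le> 1 / fact k * (x / 2) ^ (n + 2 * k)" using x by (intro mult_right_mono abs_bes_coeff_le) auto
  finally show ?thesis by (simp add: power_add power_mult)
qed

lemma summable_abs_scoeff: "summable (\<lambda>k. \<bar>scoeff n k\<bar>)"
proof (rule summable_comparison_test')
  show "summable (\<lambda>k. (x / 2) ^ n * (((x / 2)\<^sup>2) ^ k / fact k))"
    by (intro summable_mult summable_power_fact)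
qed (use abs_scoeff_le in auto)

lemma scoeff_sums: "scoeff n sums besJ n x"
proof -
  have "(scoeff n has_sum besJ n x) UNIV" using scoeff_has_sum[of n 0] by simp
  thus ?thesis by (rule has_sum_imp_sums)
qed

lemma summable_norm_pole_part: "summable (\<lambda>k. norm (of_real (scoeff n k) / (S + of_nat (n + 2 * k)) :: complex))"
proof -
  obtain N :: nat where N: "real N \<ge> norm S + 1" using real_arch_simple by blast
  show ?thesis
  proof (rule summable_comparison_test'[OF summable_abs_scoeff[of n], of N])
    fix k assume k: "k \<ge> N"
    have "real N \<le> norm (of_nat (n + 2 * k) :: complex)" using k unfolding norm_of_nat by linarith
    hence "1 \<le> norm (S + of_nat (n + 2 * k))"
      using N norm_diff_ineq[of "of_nat (n + 2 * k)" S] by (simp add: add.commute)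
    hence "norm (of_real (scoeff n k) / (S + of_nat (n + 2 * k))) \<le> \<bar>scoeff n k\<bar>"
      unfolding norm_divide norm_of_real by (intro divide_le_eq[THEN iffD2]) (auto simp: mult_le_cancel_left1)
    thus "norm (norm (of_real (scoeff n k) / (S + of_nat (n + 2 * k)))) \<le> \<bar>scoeff n k\<bar>" by simp
  qed
qed

lemma pole_part_sums: "(\<lambda>k. of_real (scoeff n k) / (S + of_nat (n + 2 * k))) sums pole_part n S"
  unfolding pole_part_def by (rule summable_sums[OF summable_norm_cancel[OF summable_norm_pole_part]])

lemma pole_part_has_sum: "((\<lambda>k. of_real (scoeff n k) / (S + of_nat (n + 2 * k))) has_sum pole_part n S) UNIV"
  by (rule norm_summable_imp_has_sum[OF summable_norm_pole_part pole_part_sums])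

lemma LINT_mellin_neg:
  assumes "Re S > - real n"
  shows "(LINT r:{..<0}|lborel. exp (S * of_real r) * of_real (besJ n (x * exp r))) = pole_part n S"
proof -
  define f where "f = (\<lambda>k r. indicator {..<0} r *\<^sub>R (of_real (scoeff n k) * exp ((S + of_nat (n + 2
      * k)) * of_real r)))"
  have re: "Re (S + of_nat (n + 2 * k)) > 0" for k using assms by simp
  have int: "integrable lborel (f k)" for k
    using set_integrable_mult_right[OF set_integrable_cexp_Iio[OF re[of k]], of "of_real (scoeff n k)"]
    by (simp add: f_def set_integrable_def)
  define c where "c = Re S + real n"
  have c: "c > 0" using assms by (simp add: c_def)
  have norm_le: "(\<integral>r. norm (f k r) \<partial>lborel) \<le> \<bar>scoeff n k\<bar> * (LINT r:{..<0}|lborel. exp (c * r))" for k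
  proof -
    have "(\<integral>r. norm (f k r) \<partial>lborel) \<le> (\<integral>r. \<bar>scoeff n k\<bar> * (indicator {..<0} r *\<^sub>R exp (c * r)) \<partial>lborel)"
    proof (rule integral_mono)
      show "integrable lborel (\<lambda>r. \<bar>scoeff n k\<bar> * (indicator {..<0} r *\<^sub>R exp (c * r)))"
        using set_integrable_exp_Iio[OF c] by (intro integrable_mult_right) (simp add: set_integrable_def)
      fix r :: real
      show "norm (f k r) \<le> \<bar>scoeff n k\<bar> * (indicator {..<0} r *\<^sub>R exp (c * r))"
      proof (cases "r < 0")
        case True
        hence "(Re S + real (n + 2 * k)) * r \<le> c * r"
          by (intro mult_right_mono_neg) (auto simp: c_def)
        thus ?thesis using True by (auto simp: f_def norm_mult intro!: mult_left_mono)
      qed (simp add: f_def)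
    qed (use int in auto)
    thus ?thesis by (simp add: set_lebesgue_integral_def)
  qed
  have "((\<lambda>k. \<integral>r. f k r \<partial>lborel) has_sum (\<integral>r. indicator {..<0} r *\<^sub>R (exp (S * of_real r)
      * of_real (besJ n (x * exp r))) \<partial>lborel)) UNIV"
  proof (rule has_sum_integral(2))
    have "summable (\<lambda>k. norm (\<integral>r. norm (f k r) \<partial>lborel))"
      by (rule summable_comparison_test'[OF summable_mult2[OF summable_abs_scoeff[of n]], of 0])
         (use norm_le in \<open>auto simp: abs_of_nonneg integral_nonneg_AE\<close>)
    thus "(\<lambda>k. \<integral>r. norm (f k r) \<partial>lborel) summable_on UNIV"
      by (rule norm_summable_imp_summable_on)
    fix r :: real
    have "((\<lambda>k. indicator {..<0} r *\<^sub>R (exp (S * of_real r) * of_real (scoeff n k * exp (real (n + 2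
        * k) * r)))) has_sum
            (indicator {..<0} r *\<^sub>R (exp (S * of_real r) * of_real (besJ n (x * exp r))))) UNIV"
      unfolding scaleR_conv_of_real by (intro has_sum_cmult_right has_sum_of_real scoeff_has_sum)
    moreover have "exp (S * of_real r) * of_real (scoeff n k * exp (real (n + 2 * k) * r))
       = of_real (scoeff n k) * exp ((S + of_nat (n + 2 * k)) * of_real r)" for k
    proof -
      have "exp ((S + of_nat (n + 2 * k)) * of_real r) = exp (S * of_real r) * of_real (exp (real (n + 2 * k) * r))"
        by (simp add: algebra_simps exp_of_real[symmetric] exp_add[symmetric])
      thus ?thesis by (simp add: mult_ac)
    qed
    ultimately show "((\<lambda>k. f k r) has_sum (indicator {..<0} r *\<^sub>R (exp (S * of_real r)
        * of_real (besJ n (x * exp r))))) UNIV"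
      by (simp only: f_def)
  qed (use int in \<open>auto intro: lborel.sigma_finite_measure_axioms\<close>)
  moreover have "(\<integral>r. f k r \<partial>lborel) = of_real (scoeff n k) / (S + of_nat (n + 2 * k))" for k
    using LINT_cexp_Iio[OF re[of k]] unfolding f_def set_lebesgue_integral_def
    by (simp add: mult_scaleR_right[symmetric] del: mult_scaleR_right of_nat_add)
  ultimately have "((\<lambda>k. of_real (scoeff n k) / (S + of_nat (n + 2 * k))) has_sum
      (LINT r:{..<0}|lborel. exp (S * of_real r) * of_real (besJ n (x * exp r)))) UNIV"
    unfolding set_lebesgue_integral_def by (simp only:)
  from sums_unique2[OF has_sum_imp_sums[OF this] pole_part_sums] show ?thesis .
qed

end

end

text \<open>For \<open>-n < Re S \<le> 0\<close> both half-lines converge, and the full Mellin transform is computed by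
writing \<open>e^{-2 s r} \<Gamma> (s)\<close> as the integral of \<open>exp (s \<tau> - e^{\<tau> + 2 r})\<close> over \<open>\<tau>\<close> and exchanging the
integrations. The inner integral is Weber's integral of a Bessel function against a Gaussian.\<close>
context
  fixes x :: real
  assumes x: "x > 0"
begin

lemma LINT_besJ_Gauss:
  fixes \<tau> :: real
  shows "(\<integral>r. complex_of_real (besJ n (x * exp r)) * exp (of_nat (n + 2) * of_real r - of_real (exp (\<tau>
      + 2 * r))) \<partial>lborel)
     = of_real ((x / 2) ^ n * exp (- real (n + 1) * \<tau>) * exp (- exp (2 * ln (x / 2) - \<tau>)) / 2)" (is "?L = _")
proof -
  define f where "f = (\<lambda>k r. complex_of_real (scoeff x n k * exp (real (n + 1 + k) * (2 * r) - exp (\<tau> + 2 * r))))"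
  have G: "has_bochner_integral lborel (\<lambda>r. exp (real (n + 1 + k) * (2 * r) - exp (\<tau> + 2 * r)))
             (Gamma (real (n + 1 + k)) * exp (- real (n + 1 + k) * \<tau>) / 2)" for k
    using has_bochner_integral_Gamma_affine_real[of "real (n + 1 + k)" 2 \<tau>] by simp
  have Gam: "Gamma (real (n + 1 + k)) = fact (n + k)" for k
    using Gamma_fact[of "n + k", where 'a = real] by (simp add: add_ac)
  define h where "h = (x / 2) ^ n * exp (- real (n + 1) * \<tau>) / 2"
  define y where "y = exp (2 * ln (x / 2) - \<tau>)"
  have "exp (ln (x / 2)) = x / 2" using x by (intro exp_ln) simp
  hence y: "y = (x / 2)\<^sup>2 * exp (- \<tau>)"
    unfolding y_def exp_diff exp_double exp_minus by (simp only: divide_inverse)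
  have coeff: "scoeff x n k * (Gamma (real (n + 1 + k)) * exp (- real (n + 1 + k) * \<tau>) / 2) = h
      * ((- y) ^ k / fact k)" for k
  proof -
    have "exp (- real (n + 1 + k) * \<tau>) = exp (- real (n + 1) * \<tau>) * exp (real k * (- \<tau>))"
      unfolding exp_add[symmetric] by (rule arg_cong[where f = exp]) (simp add: algebra_simps)
    also have "exp (real k * (- \<tau>)) = exp (- \<tau>) ^ k" by (rule exp_of_nat_mult)
    finally have e: "exp (- real (n + 1 + k) * \<tau>) = exp (- real (n + 1) * \<tau>) * exp (- \<tau>) ^ k" .
    have p: "(x / 2) ^ (n + 2 * k) = (x / 2) ^ n * ((x / 2)\<^sup>2) ^ k" by (simp only: power_add power_mult)
    have *: "c / (f * g) * (A * B) * (g * (E * F) / 2) = A * E / 2 * (c * (B * F) / f)" if "g \<noteq> 0"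
        for c f g A B E F :: real
      using that by (simp add: mult_ac)
    show ?thesis
      unfolding Gam e y power_minus[of "(x / 2)\<^sup>2 * exp (- \<tau>)"] scoeff_def bes_coeff_def h_def p power_mult_distrib
      by (rule *) simp
  qed
  have h: "h \<ge> 0" using x by (simp add: h_def)
  have yp: "y \<ge> 0" by (simp add: y_def)
  have "((\<lambda>k. \<integral>r. f k r \<partial>lborel) has_sum ?L) UNIV"
  proof (rule has_sum_integral(2))
    show "integrable lborel (f k)" for k
      unfolding f_def using G[of k] by (intro integrable_of_real integrable_mult_right) (simp add:
          has_bochner_integral_iff)
    have "(\<integral>r. norm (f k r) \<partial>lborel) = h * (y ^ k / fact k)" for k
    proof -
      have "(\<integral>r. norm (f k r) \<partial>lborel) = \<bar>scoeff x n k\<bar> * (Gamma (real (n + 1 + k)) * exp (- real (n + 1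
          + k) * \<tau>) / 2)"
        using has_bochner_integral_integral_eq[OF G[of k]] by (simp add: f_def norm_mult)
      also have "\<dots> = \<bar>scoeff x n k * (Gamma (real (n + 1 + k)) * exp (- real (n + 1 + k) * \<tau>) / 2)\<bar>"
        by (simp add: abs_mult Gam)
      also have "\<dots> = h * (y ^ k / fact k)"
        unfolding coeff using h yp by (simp add: abs_mult power_abs)
      finally show ?thesis .
    qed
    thus "(\<lambda>k. \<integral>r. norm (f k r) \<partial>lborel) summable_on UNIV"
      using norm_summable_imp_summable_on[of "\<lambda>k. h * (y ^ k / fact k)"]
        summable_mult[OF summable_power_fact[of y], of h] h yp by (simp add: abs_mult)
    fix r :: real
    have "((\<lambda>k. complex_of_real (scoeff x n k * exp (real (n + 2 * k) * r)) * exp (of_nat (n + 2)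
        * of_real r - of_real (exp (\<tau> + 2 * r))))
       has_sum of_real (besJ n (x * exp r)) * exp (of_nat (n + 2) * of_real r - of_real (exp (\<tau> + 2 * r)))) UNIV"
      by (intro has_sum_cmult_left has_sum_of_real scoeff_has_sum x)
    moreover have "of_real (scoeff x n k * exp (real (n + 2 * k) * r)) * exp (of_nat (n + 2) * of_real r
        - of_real (exp (\<tau> + 2 * r))) = f k r" for k
    proof -
      have "exp (of_nat (n + 2) * of_real r - of_real (exp (\<tau> + 2 * r))) = complex_of_real (exp (real (n
          + 2) * r - exp (\<tau> + 2 * r)))"
        by (simp flip: exp_of_real)
      moreover have "exp (real (n + 2 * k) * r) * exp (real (n + 2) * r - exp (\<tau> + 2 * r))
          = exp (real (n + 1 + k) * (2 * r) - exp (\<tau> + 2 * r))"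
        unfolding exp_add[symmetric] by (rule arg_cong[where f = exp]) (simp add: algebra_simps)
      ultimately show ?thesis
        by (simp only: f_def of_real_mult[symmetric] mult.assoc)
    qed
    ultimately show "((\<lambda>k. f k r) has_sum of_real (besJ n (x * exp r)) * exp (of_nat (n + 2) * of_real r
        - of_real (exp (\<tau> + 2 * r)))) UNIV"
      by (simp only:)
  qed (rule lborel.sigma_finite_measure_axioms)
  moreover have "(\<integral>r. f k r \<partial>lborel) = of_real (h * ((- y) ^ k / fact k))" for k
    unfolding coeff[symmetric] f_def integral_complex_of_real
    by (rule arg_cong[where f = of_real], rule has_bochner_integral_integral_eq,
        rule has_bochner_integral_mult_right, rule G)
  ultimately have "((\<lambda>k. of_real (h * ((- y) ^ k / fact k))) has_sum ?L) UNIV"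
    by (simp only:)
  moreover have "((\<lambda>k. complex_of_real (h * ((- y) ^ k / fact k))) has_sum of_real (h * exp (- y))) UNIV"
    using has_sum_cmult_right[OF exp_has_sum[of "of_real (- y)"], of "of_real h"]
    unfolding exp_of_real by simp
  ultimately have "?L = of_real (h * exp (- y))" by (rule has_sum_unique)
  thus ?thesis by (simp add: h_def y_def mult_ac)
qed

lemma LINT_mellin_full:
  assumes S: "Re S \<le> 0" "Re S > - real n"
  shows "(\<integral>r. exp (S * of_real r) * complex_of_real (besJ n (x * exp r)) \<partial>lborel) = gamma_part x n S"
proof -
  define s where "s = (of_nat n - S) / 2 + 1"
  define u where "u = (of_nat n + S) / 2"
  have s: "Re s > 0" and u: "Re u > 0" using S by (auto simp: s_def u_def field_simps)
  define \<Phi> where "\<Phi> = (\<lambda>(r, \<tau>). complex_of_real (besJ n (x * exp r)) *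
     (exp (of_nat (n + 2) * of_real r) * exp (s * of_real \<tau> - of_real (exp (2 * r + \<tau>)))))"
  let ?f = "\<lambda>r. exp (S * of_real r) * complex_of_real (besJ n (x * exp r))"
  have f_int: "integrable lborel ?f" using S by (rule mellin_integrand_split(1)[OF x])
  have sS: "2 * s = of_nat (n + 2) - S" by (simp add: s_def field_simps)
  have hb: "has_bochner_integral lborel (\<lambda>\<tau>. \<Phi> (r, \<tau>)) (?f r * Gamma s)" for r
  proof -
    have "has_bochner_integral lborel (\<lambda>\<tau>. exp (s * of_real \<tau> - of_real (exp (2 * r + \<tau>)))) (Gamma s
        * exp (- s * of_real (2 * r)))"
      using has_bochner_integral_Gamma_affine[OF s, of 1 "2 * r"] by simp
    hence "has_bochner_integral lborel (\<lambda>\<tau>. \<Phi> (r, \<tau>))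
       (complex_of_real (besJ n (x * exp r)) * (exp (of_nat (n + 2) * of_real r) * (Gamma s * exp (- s
           * of_real (2 * r)))))"
      unfolding \<Phi>_def split by (intro has_bochner_integral_mult_right)
    moreover have "exp (of_nat (n + 2) * of_real r) * exp (- s * of_real (2 * r)) = exp (S * of_real r)"
    proof -
      have "of_nat (n + 2) * of_real r + - s * of_real (2 * r) = (of_nat (n + 2) - 2 * s) * of_real r"
        by (simp add: algebra_simps)
      thus ?thesis by (simp only: exp_add[symmetric] sS) (simp add: algebra_simps)
    qed
    ultimately show ?thesis by (simp add: mult_ac)
  qed
  have norm_int: "(\<integral>\<tau>. norm (\<Phi> (r, \<tau>)) \<partial>lborel) = norm (?f r) * Gamma (Re s)" for r
  proof -
    have "(\<integral>\<tau>. norm (\<Phi> (r, \<tau>)) \<partial>lborel)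
       = (\<integral>\<tau>. \<bar>besJ n (x * exp r)\<bar> * (exp (real (n + 2) * r) * exp (Re s * (1 * \<tau>) - exp (2 * r + 1 * \<tau>))) \<partial>lborel)"
      by (simp add: \<Phi>_def norm_mult)
    also have "\<dots> = \<bar>besJ n (x * exp r)\<bar> * (exp (real (n + 2) * r) * (Gamma (Re s) * exp (- Re s * (2 * r)) / \<bar>1\<bar>))"
      using s by (intro has_bochner_integral_integral_eq has_bochner_integral_mult_right
          has_bochner_integral_Gamma_affine_real) auto
    also have "exp (real (n + 2) * r) * (Gamma (Re s) * exp (- Re s * (2 * r)) / \<bar>1\<bar>) = exp (Re S * r) * Gamma (Re s)"
    proof -
      have "exp (real (n + 2) * r) * exp (- Re s * (2 * r)) = exp (Re S * r)"
        unfolding exp_add[symmetric] by (rule arg_cong[where f = exp]) (simp add: s_def field_simps)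
      thus ?thesis by (simp add: mult_ac)
    qed
    finally show ?thesis by (simp add: norm_mult)
  qed
  have \<Phi>_cont: "continuous_on UNIV \<Phi>"
    unfolding \<Phi>_def case_prod_unfold by (intro continuous_intros)
  have \<Phi>: "integrable (lborel \<Otimes>\<^sub>M lborel) \<Phi>"
  proof (rule lborel_pair.Fubini_integrable)
    have "\<Phi> \<in> borel_measurable borel" using \<Phi>_cont by (rule borel_measurable_continuous_onI)
    thus "\<Phi> \<in> borel_measurable (lborel \<Otimes>\<^sub>M lborel)" by (simp add: lborel_prod)
    show "integrable lborel (\<lambda>r. \<integral>\<tau>. norm (\<Phi> (r, \<tau>)) \<partial>lborel)"
      unfolding norm_int using f_int by (intro integrable_mult_left integrable_norm)
    show "AE r in lborel. integrable lborel (\<lambda>\<tau>. \<Phi> (r, \<tau>))"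
      using hb by (auto simp: has_bochner_integral_iff)
  qed
  have "(\<integral>r. ?f r \<partial>lborel) * Gamma s = (\<integral>r. (\<integral>\<tau>. \<Phi> (r, \<tau>) \<partial>lborel) \<partial>lborel)"
    using hb by (simp add: has_bochner_integral_iff)
  also have "\<dots> = (\<integral>\<tau>. (\<integral>r. \<Phi> (r, \<tau>) \<partial>lborel) \<partial>lborel)"
    using lborel_pair.Fubini_integral[of "\<lambda>r \<tau>. \<Phi> (r, \<tau>)"] \<Phi> by simp
  also have "\<dots> = (\<integral>\<tau>. of_real ((x / 2) ^ n / 2) * exp (u * of_real ((-1) * \<tau>) - of_real (exp (2
      * ln (x / 2) + (-1) * \<tau>))) \<partial>lborel)"
  proof (rule Bochner_Integration.integral_cong[OF refl])
    fix \<tau> :: real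
    have "(\<integral>r. \<Phi> (r, \<tau>) \<partial>lborel) = (\<integral>r. exp (s * of_real \<tau>) * (of_real (besJ n (x * exp r))
        * exp (of_nat (n + 2) * of_real r - of_real (exp (\<tau> + 2 * r)))) \<partial>lborel)"
      by (intro Bochner_Integration.integral_cong) (auto simp: \<Phi>_def exp_diff add_ac)
    also have "\<dots> = exp (s * of_real \<tau>) * of_real ((x / 2) ^ n * exp (- real (n + 1) * \<tau>) * exp (- exp (2
        * ln (x / 2) - \<tau>)) / 2)"
      by (subst LINT_besJ_Gauss[symmetric]) simp
    also have "\<dots> = of_real ((x / 2) ^ n / 2) * (exp (s * of_real \<tau>) * (exp (of_real (- real (n + 1)
        * \<tau>)) * exp (of_real (- exp (2 * ln (x / 2) - \<tau>)))))"
      by (unfold exp_of_real) (simp only: of_real_mult of_real_divide mult_ac times_divide_eq_left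
          times_divide_eq_right)
    also have "exp (s * of_real \<tau>) * (exp (of_real (- real (n + 1) * \<tau>)) * exp (of_real (- exp (2 * ln (x / 2) - \<tau>))))
       = exp (u * of_real ((-1) * \<tau>) - of_real (exp (2 * ln (x / 2) + (-1) * \<tau>)))"
      unfolding exp_add[symmetric] by (rule arg_cong[where f = exp]) (simp add: s_def u_def field_simps)
    finally show "(\<integral>r. \<Phi> (r, \<tau>) \<partial>lborel) = of_real ((x / 2) ^ n / 2) * exp (u * of_real ((-1) * \<tau>)
        - of_real (exp (2 * ln (x / 2) + (-1) * \<tau>)))" .
  qed
  also have "\<dots> = of_real ((x / 2) ^ n / 2) * (Gamma u * exp (- u * of_real (2 * ln (x / 2))) / of_real \<bar>-1\<bar>)"
    by (intro has_bochner_integral_integral_eq has_bochner_integral_mult_right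
        has_bochner_integral_Gamma_affine u) auto
  also have "\<dots> = Gamma u * (of_real ((x / 2) ^ n) * exp (- u * of_real (2 * ln (x / 2)))) / 2"
    by simp
  also have "complex_of_real ((x / 2) ^ n) = exp (of_nat n * of_real (ln (x / 2)))"
  proof -
    have "exp (ln (x / 2)) = x / 2" using x by (intro exp_ln) simp
    hence "exp (real n * ln (x / 2)) = (x / 2) ^ n" by (simp only: exp_of_nat_mult)
    hence "complex_of_real ((x / 2) ^ n) = exp (of_real (real n * ln (x / 2)))" by (simp only: exp_of_real)
    thus ?thesis by (simp only: of_real_mult of_real_of_nat_eq)
  qed
  also have "exp (of_nat n * of_real (ln (x / 2))) * exp (- u * of_real (2 * ln (x / 2))) = exp (- S
      * of_real (ln (x / 2)))"
    unfolding exp_add[symmetric] by (rule arg_cong[where f = exp]) (simp add: u_def field_simps)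
  finally have *: "(\<integral>r. ?f r \<partial>lborel) * Gamma s = Gamma u * exp (- S * of_real (ln (x / 2))) / 2" .
  have "s \<notin> \<int>\<^sub>\<le>\<^sub>0" using s by (auto elim!: nonpos_Ints_cases)
  hence "Gamma s \<noteq> 0" by (simp add: Gamma_eq_zero_iff)
  hence "(\<integral>r. ?f r \<partial>lborel) = (\<integral>r. ?f r \<partial>lborel) * Gamma s * rGamma s"
    by (simp add: rGamma_inverse_Gamma)
  thus ?thesis unfolding * by (simp add: gamma_part_def s_def u_def mult_ac)
qed

text \<open>The recurrence that lowers \<open>n\<close> by 2 at the same \<open>S\<close> comes from
\<open>T = J_n + J_{n + 2}\<close>, for which \<open>T' = n J_n - (n + 2) J_{n + 2}\<close> with respect to \<open>r\<close>. The other
two parts of the formula satisfy the same recurrence, up to the same boundary term.\<close>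
lemma mellin_step:
  assumes S: "Re S \<le> 0"
  shows "(S + of_nat n) * mellin x n S - (of_nat (n + 2) - S) * mellin x (n + 2) S = - of_real (besJ n x
      + besJ (n + 2) x)"
proof -
  define T where "T = (\<lambda>r. besJ n (x * exp r) + besJ (n + 2) (x * exp r))"
  define T' where "T' = (\<lambda>r. real n * besJ n (x * exp r) - real (n + 2) * besJ (n + 2) (x * exp r))"
  have T_eq: "T r = real (n + 1) * (x * exp r / 2) ^ n * bes_entire (n + 1) ((x * exp r)\<^sup>2 / 4)" for r
  proof -
    define t where "t = (x * exp r)\<^sup>2 / 4"
    have j2: "besJ (n + 2) (x * exp r) = (x * exp r / 2) ^ n * t * bes_entire (n + 2) t"
      by (simp add: besJ_def t_def power_add power2_eq_square)
    show ?thesis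
      unfolding T_def j2 besJ_def[of n] t_def[symmetric] bes_entire_rec[of n t] by (simp add: algebra_simps)
  qed
  have T: "(T has_real_derivative T' r) (at r)" for r
  proof -
    define t where "t = (x * exp r)\<^sup>2 / 4"
    define h where "h = (x * exp r / 2) ^ n"
    have d1: "((\<lambda>r. (x * exp r / 2) ^ n) has_real_derivative real n * h) (at r)"
    proof -
      have "((\<lambda>r. x * exp r / 2) has_real_derivative x * exp r / 2) (at r)"
        by (auto intro!: derivative_eq_intros)
      from DERIV_power[OF this, of n] show ?thesis
        unfolding h_def by (cases n) (simp_all add: mult_ac)
    qed
    have d2: "((\<lambda>r. bes_entire (n + 1) ((x * exp r)\<^sup>2 / 4)) has_real_derivative (- bes_entire (n + 2) t)
        * (2 * t)) (at r)"
    proof (rule DERIV_chain2[of "bes_entire (n + 1)"])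
      show "(bes_entire (n + 1) has_real_derivative - bes_entire (n + 2) t) (at ((x * exp r)\<^sup>2 / 4))"
        using bes_entire_deriv[of "n + 1"] by (simp add: t_def)
      show "((\<lambda>r. (x * exp r)\<^sup>2 / 4) has_real_derivative 2 * t) (at r)"
        unfolding t_def by (auto intro!: derivative_eq_intros simp: power2_eq_square)
    qed
    have "(T has_real_derivative real (n + 1) * (real n * h * bes_entire (n + 1) t + (- bes_entire (n
        + 2) t) * (2 * t) * h)) (at r)"
      unfolding T_eq[abs_def] mult.assoc[of "real (n + 1)"]
      using DERIV_cmult[OF DERIV_mult[OF d1 d2], of "real (n + 1)"] by (simp add: h_def t_def)
    moreover have "T' r = real (n + 1) * (real n * h * bes_entire (n + 1) t + (- bes_entire (n + 2) t) * (2 * t) * h)"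
    proof -
      have j1: "besJ n (x * exp r) = h * bes_entire n t" by (simp add: besJ_def h_def t_def)
      have j2: "besJ (n + 2) (x * exp r) = h * t * bes_entire (n + 2) t"
        by (simp add: besJ_def h_def t_def power_add power2_eq_square)
      show ?thesis unfolding T'_def j1 j2 bes_entire_rec[of n t] by (simp add: algebra_simps)
    qed
    ultimately show ?thesis by simp
  qed
  define f where "f = (\<lambda>r. exp (S * of_real r) * of_real (T r) :: complex)"
  define f' where "f' = (\<lambda>r. (S + of_nat n) * (exp (S * of_real r) * of_real (besJ n (x * exp r)))
     - (of_nat (n + 2) - S) * (exp (S * of_real r) * complex_of_real (besJ (n + 2) (x * exp r))))"
  note i = set_integrable_mellin_pos[OF x S]
  have "(LINT r:{0<..}|lborel. f' r) = - f 0"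
  proof (rule LINT_deriv_Ioi)
    fix r :: real
    have "((\<lambda>r. complex_of_real (T r)) has_vector_derivative of_real (T' r)) (at r)"
      using T[of r] by (intro has_vector_derivative_of_real) (simp add: has_real_derivative_iff_has_vector_derivative)
    from has_vector_derivative_mult[OF exp_mult_of_real_has_vector_derivative[of S r UNIV] this]
    have "(f has_vector_derivative exp (S * of_real r) * of_real (T' r) + S * exp (S * of_real r)
        * of_real (T r)) (at r)"
      by (simp add: f_def)
    also have "exp (S * of_real r) * of_real (T' r) + S * exp (S * of_real r) * of_real (T r) = f' r"
      by (simp add: f'_def T_def T'_def algebra_simps)
    finally show "(f has_vector_derivative f' r) (at r)" .
  next
    show "continuous_on UNIV f'" unfolding f'_def by (intro continuous_intros)
    show "set_integrable lborel {0<..} f'"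
      unfolding f'_def by (intro set_integral_diff set_integrable_mult_right i)
    show "(f \<longlongrightarrow> 0) at_top"
    proof (rule Lim_null_comparison)
      define C where "C = 26 * (1 + real n) * x powr (- 1 / 3) + 26 * (1 + real (n + 2)) * x powr (- 1 / 3)"
      show "\<forall>\<^sub>F r in at_top. norm (f r) \<le> C * exp (- 1 / 3 * r)"
        using eventually_gt_at_top[of 0]
      proof eventually_elim
        fix r :: real assume r: "r > 0"
        have "norm (f r) = norm (exp (S * of_real r) * of_real (besJ n (x * exp r)) + exp (S
            * of_real r) * of_real (besJ (n + 2) (x * exp r)))"
          by (simp add: f_def T_def algebra_simps)
        also have "\<dots> \<le> 26 * (1 + real n) * x powr (- 1 / 3) * exp ((- 1 / 3) * r)
             + 26 * (1 + real (n + 2)) * x powr (- 1 / 3) * exp ((- 1 / 3) * r)"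
          by (intro order.trans[OF norm_triangle_ineq] add_mono mellin_integrand_bound_pos x S r)
        finally show "norm (f r) \<le> C * exp (- 1 / 3 * r)" by (simp add: C_def algebra_simps)
      qed
      have "filterlim (\<lambda>r::real. - 1 / 3 * r) at_bot at_top"
        by (intro filterlim_tendsto_neg_mult_at_bot[OF tendsto_const] filterlim_ident) auto
      hence "((\<lambda>r. C * exp (- 1 / 3 * r)) \<longlongrightarrow> C * 0) at_top"
        by (intro tendsto_mult tendsto_const filterlim_compose[OF exp_at_bot])
      thus "((\<lambda>r. C * exp (- 1 / 3 * r)) \<longlongrightarrow> 0) at_top" by simp
    qed
  qed
  moreover have "(LINT r:{0<..}|lborel. f' r) = (S + of_nat n) * mellin x n S - (of_nat (n + 2) - S)
      * mellin x (n + 2) S"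
    unfolding f'_def mellin_def
    by (subst set_integral_diff(2)) (auto intro!: set_integrable_mult_right i)
  ultimately show ?thesis by (simp add: f_def T_def)
qed

lemma pole_part_step:
  assumes nz: "\<And>k. S + of_nat (n + 2 * k) \<noteq> 0"
  shows "(S + of_nat n) * pole_part x n S - (of_nat (n + 2) - S) * pole_part x (n + 2) S
      = of_real (besJ n x + besJ (n + 2) x)"
proof -
  let ?t = "\<lambda>n k. complex_of_real (scoeff x n k)"
  have "(\<lambda>k. (S + of_nat n) * (?t n k / (S + of_nat (n + 2 * k))) - ?t n k) sums ((S + of_nat n)
      * pole_part x n S - of_real (besJ n x))"
    by (intro sums_diff sums_mult pole_part_sums sums_of_real scoeff_sums x)
  hence 1: "(\<lambda>k. (S + of_nat n) * (?t n (Suc k) / (S + of_nat (n + 2 * Suc k))) - ?t n (Suc k)) sums ((S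
      + of_nat n) * pole_part x n S - of_real (besJ n x))"
    by (subst sums_Suc_iff) (use nz[of 0] in simp)
  have 2: "(\<lambda>k. (of_nat (n + 2) - S) * (?t (n + 2) k / (S + of_nat (n + 2 + 2 * k))) + ?t (n + 2) k) sums
      ((of_nat (n + 2) - S) * pole_part x (n + 2) S + of_real (besJ (n + 2) x))"
    by (intro sums_add sums_mult pole_part_sums sums_of_real scoeff_sums x)
  have eq: "(S + of_nat n) * (?t n (Suc k) / (S + of_nat (n + 2 * Suc k))) - ?t n (Suc k)
      = (of_nat (n + 2) - S) * (?t (n + 2) k / (S + of_nat (n + 2 + 2 * k))) + ?t (n + 2) k" for k
  proof -
    define D where "D = S + of_nat (n + 2 + 2 * k)"
    have D: "D \<noteq> 0" using nz[of "Suc k"] by (simp add: D_def add_ac)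
    have D': "S + of_nat (n + 2 * Suc k) = D" by (simp add: D_def)
    have "real (Suc k) * bes_coeff n (Suc k) = - real (n + 2 + k) * bes_coeff (n + 2) k"
      by (simp add: bes_coeff_def divide_simps) (simp add: algebra_simps)
    hence tk: "real (Suc k) * scoeff x n (Suc k) = - real (n + 2 + k) * scoeff x (n + 2) k"
      by (simp add: scoeff_def power_add)
    have tk1: "of_nat (Suc k) * ?t n (Suc k) = - of_nat (n + 2 + k) * ?t (n + 2) k"
      using arg_cong[OF tk, of complex_of_real] by (simp only: of_real_mult of_real_minus of_real_of_nat_eq)
    have "S + of_nat n - D = - 2 * of_nat (Suc k)" "of_nat (n + 2) - S + D = 2 * of_nat (n + 2 + k)"
      by (simp_all add: D_def)
    hence tk': "(S + of_nat n - D) * ?t n (Suc k) = (of_nat (n + 2) - S + D) * ?t (n + 2) k"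
      by (simp only: mult.assoc tk1) (simp add: algebra_simps)
    show ?thesis unfolding D' D_def[symmetric] using D tk' by (simp add: field_simps)
  qed
  show ?thesis using sums_unique2[OF 1[unfolded eq] 2] by (simp add: algebra_simps)
qed

lemma gamma_part_step:
  assumes "S + of_nat n \<noteq> 0"
  shows "(S + of_nat n) * gamma_part x n S = (of_nat (n + 2) - S) * gamma_part x (n + 2) S"
proof -
  define u where "u = (of_nat n + S) / 2"
  define v where "v = (of_nat n - S) / 2 + 1"
  have u: "u \<noteq> 0" using assms by (simp add: u_def add.commute)
  have u': "(of_nat (n + 2) + S) / 2 = u + 1" and v': "(of_nat (n + 2) - S) / 2 + 1 = v + 1"
    by (simp_all add: u_def v_def field_simps)
  have a: "S + of_nat n = 2 * u" and b: "of_nat (n + 2) - S = 2 * v" by (simp_all add: u_def v_def field_simps)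
  have "rGamma u = u * rGamma (u + 1)" by (rule rGamma_plus1[symmetric])
  hence G: "Gamma (u + 1) = u * Gamma u"
    using u by (simp add: Gamma_def)
  have R: "rGamma v = v * rGamma (v + 1)" by (rule rGamma_plus1[symmetric])
  show ?thesis unfolding a b gamma_part_def u' v' u_def[symmetric] v_def[symmetric] G R
    by simp
qed

text \<open>Downward induction from an order \<open>n + 2 N > -Re S\<close>, where both half-lines converge, replaces
analytic continuation in \<open>S\<close>.\<close>
theorem mellin_eq:
  assumes S: "Re S \<le> 0" and nz: "\<And>k. S + of_nat (n + 2 * k) \<noteq> 0"
  shows "mellin x n S = gamma_part x n S - pole_part x n S"
proof -
  obtain N :: nat where N: "real N > - Re S" using reals_Archimedean2 by blast
  hence "real (n + 2 * N) > - Re S" by simp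
  thus ?thesis using nz
  proof (induction N arbitrary: n)
    case 0
    hence "Re S > - real n" by simp
    thus ?case
      using LINT_mellin_full[OF S] mellin_integrand_split(2)[OF x S] LINT_mellin_neg[OF x]
          by (simp add: algebra_simps)
  next
    case (Suc N)
    have "mellin x (n + 2) S = gamma_part x (n + 2) S - pole_part x (n + 2) S"
    proof (rule Suc.IH)
      show "real (n + 2 + 2 * N) > - Re S" using Suc.prems(1) by simp
      show "S + of_nat (n + 2 + 2 * k) \<noteq> 0" for k using Suc.prems(2)[of "Suc k"] by (simp add: add_ac)
    qed
    moreover have 0: "S + of_nat n \<noteq> 0" using Suc.prems(2)[of 0] by simp
    ultimately have "(S + of_nat n) * mellin x n S = (S + of_nat n) * (gamma_part x n S - pole_part x n S)"
      using mellin_step[OF S, of n] gamma_part_step[OF 0] pole_part_step[OF Suc.prems(2)] by algebra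
    thus ?case using 0 by simp
  qed
qed

end

section \<open>Expansion of the half-line transform\<close>

lemma acoeff_int: "acoeff n (of_real y) = \<i> ^ nat \<bar>n\<bar> * of_real (besJ (nat \<bar>n\<bar>) y)"
proof (cases "n \<ge> 0")
  case True
  thus ?thesis using acoeff_nat[of "nat n" y] by simp
next
  case False
  have "acoeff n (of_real y) = acoeff (- n) (of_real y)" using acoeff_cnj[of n "of_real y"] by simp
  thus ?thesis using False acoeff_nat[of "nat (- n)" y] by simp
qed

context
  fixes z :: complex
begin

text \<open>The direction of \<open>z\<close> on the unit circle.\<close>
definition unit_dir :: complex where "unit_dir = z / of_real (norm z)"

text \<open>The factor between the angular coefficient of index \<open>n\<close> at \<open>z e^r\<close> and the Bessel function
\<open>J_{|n|}\<close> at \<open>|z| e^r\<close>.\<close>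
definition aphase :: "int \<Rightarrow> complex" where "aphase n = \<i> ^ nat \<bar>n\<bar> * unit_dir powi (- n)"

text \<open>The upper Mellin transform for arbitrary integer index and complex argument \<open>z\<close>.\<close>
definition amellin :: "int \<Rightarrow> complex \<Rightarrow> complex" where
  "amellin n S = (LINT r:{0<..}|lborel. exp (S * of_real r) * acoeff n (z * of_real (exp r)))"

text \<open>The frequency for which
\<open>2 Re (z cosh (r + i \<omega>)) = Re (freq r e^{i \<omega>})\<close>.\<close>
definition freq :: "real \<Rightarrow> complex" where "freq r = z * of_real (exp r) + cnj z * of_real (exp (- r))"

text \<open>The Fourier integral over \<open>r > 0\<close> of the angular coefficients of the plane wave
\<open>exp (2 i Re (z cosh (r + i \<omega>)))\<close>.\<close>
definition half_tr :: "int \<Rightarrow> complex \<Rightarrow> complex" where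
  "half_tr n s = (LINT r:{0<..}|lborel. exp (s * of_real r) * acoeff n (freq r))"

lemma freq_minus: "freq (- r) = cnj (freq r)" by (simp add: freq_def)

context
  assumes z: "z \<noteq> 0"
begin

lemma norm_unit_dir: "norm unit_dir = 1" using z by (simp add: unit_dir_def norm_divide)

lemma z_eq: "z = of_real (norm z) * unit_dir" using z by (simp add: unit_dir_def)

lemma norm_z_pos: "norm z > 0" using z by simp

lemma acoeff_z_exp: "acoeff n (z * of_real (exp r)) = aphase n * of_real (besJ (nat \<bar>n\<bar>) (norm z * exp r))"
proof -
  have "z * of_real (exp r) = of_real (norm z * exp r) * unit_dir"
    by (subst z_eq) simp
  hence "acoeff n (z * of_real (exp r)) = acoeff n (of_real (norm z * exp r)) * unit_dir powi (- n)"
    by (simp only: acoeff_rotate[OF norm_unit_dir])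
  thus ?thesis by (simp only: acoeff_int aphase_def mult_ac)
qed

lemma amellin_eq:
  assumes "Re S \<le> 0" "Im S \<noteq> 0"
  shows "amellin n S = aphase n * gamma_part (norm z) (nat \<bar>n\<bar>) S - aphase n * pole_part (norm z) (nat \<bar>n\<bar>) S"
proof -
  have "amellin n S = (LINT r:{0<..}|lborel. aphase n * (exp (S * of_real r)
      * of_real (besJ (nat \<bar>n\<bar>) (norm z * exp r))))"
    unfolding amellin_def acoeff_z_exp by (simp only: mult.left_commute)
  also have "\<dots> = aphase n * mellin (norm z) (nat \<bar>n\<bar>) S"
    by (simp add: mellin_def)
  also have "mellin (norm z) (nat \<bar>n\<bar>) S = gamma_part (norm z) (nat \<bar>n\<bar>) S - pole_part (norm z) (nat \<bar>n\<bar>) S"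
  proof (rule mellin_eq[OF norm_z_pos assms(1)])
    fix k
    have "Im (S + of_nat (nat \<bar>n\<bar> + 2 * k)) \<noteq> 0" using assms by simp
    thus "S + of_nat (nat \<bar>n\<bar> + 2 * k) \<noteq> 0" by (metis zero_complex.sel(2))
  qed
  finally show ?thesis by (simp add: algebra_simps)
qed

text \<open>In terms of the double series the simple fractions of the pole part are indexed by all pairs
\<open>(c, d)\<close> with \<open>d - c = n\<close>, whatever the sign of \<open>n\<close>.\<close>
lemma pole_part_pair_has_sum:
  "((\<lambda>(c, d). if int d - int c = n then ecoeff c d z / (S + of_nat (c + d)) else 0) has_sum
      (aphase n * pole_part (norm z) (nat \<bar>n\<bar>) S)) UNIV"
proof -
  define N where "N = nat \<bar>n\<bar>"
  define g where "g = (\<lambda>(c, d). ecoeff c d z / (S + of_nat (c + d)))"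
  define \<iota> where "\<iota> = (\<lambda>k. if n \<ge> 0 then (k, N + k) else (N + k, k))"
  have q: "g (\<iota> k) = aphase n * (of_real (scoeff (norm z) N k) / (S + of_nat (N + 2 * k)))" for k
  proof (cases "n \<ge> 0")
    case True
    have "ecoeff k (N + k) z = ecoeff k (N + k) (of_real (norm z) * unit_dir)" by (simp only: z_eq[symmetric])
    also have "\<dots> = aphase n * of_real (scoeff (norm z) N k)"
      unfolding ecoeff_rotate[OF norm_unit_dir] ecoeff_nat scoeff_def aphase_def using True by (simp add: N_def)
    finally have q: "ecoeff k (N + k) z = aphase n * of_real (scoeff (norm z) N k)" .
    have i: "\<iota> k = (k, N + k)" and j: "k + (N + k) = N + 2 * k" using True by (simp_all add: \<iota>_def)
    show ?thesis unfolding i g_def split q j by (rule times_divide_eq_right[symmetric])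
  next
    case False
    have "ecoeff (N + k) k z = ecoeff (N + k) k (of_real (norm z) * unit_dir)" by (simp only: z_eq[symmetric])
    also have "ecoeff (N + k) k (of_real (norm z) * unit_dir) = ecoeff k (N + k) (of_real (norm z))
        * unit_dir powi int N"
      unfolding ecoeff_rotate[OF norm_unit_dir] using ecoeff_cnj[of "N + k" k "of_real (norm z)"] by simp
    also have "\<dots> = aphase n * of_real (scoeff (norm z) N k)"
      unfolding ecoeff_nat scoeff_def aphase_def using False by (simp add: N_def)
    finally have q: "ecoeff (N + k) k z = aphase n * of_real (scoeff (norm z) N k)" .
    have i: "\<iota> k = (N + k, k)" and j: "N + k + k = N + 2 * k" using False by (simp_all add: \<iota>_def)
    show ?thesis unfolding i g_def split q j by (rule times_divide_eq_right[symmetric])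
  qed
  have "((\<lambda>k. aphase n * (of_real (scoeff (norm z) N k) / (S + of_nat (N + 2 * k)))) has_sum (aphase n
      * pole_part (norm z) N S)) UNIV"
    by (intro has_sum_cmult_right pole_part_has_sum norm_z_pos)
  hence "(g \<circ> \<iota> has_sum (aphase n * pole_part (norm z) N S)) UNIV"
    by (simp only: o_def q)
  hence "(g has_sum (aphase n * pole_part (norm z) N S)) (range \<iota>)"
    by (subst has_sum_reindex) (auto simp: inj_def \<iota>_def split: if_splits)
  hence "((\<lambda>(c, d). if int d - int c = n then ecoeff c d z / (S + of_nat (c + d)) else 0) has_sum
      (aphase n * pole_part (norm z) N S)) UNIV"
  proof (rule has_sum_cong_neutral[THEN iffD1, rotated -1])
    fix y assume y: "y \<in> UNIV - range \<iota>"
    obtain c d where cd: "y = (c, d)" by (cases y)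
    have "int d - int c \<noteq> n"
    proof
      assume *: "int d - int c = n"
      have "y = \<iota> (min c d)" using * by (auto simp: \<iota>_def cd N_def)
      thus False using y by auto
    qed
    thus "(case y of (c, d) \<Rightarrow> if int d - int c = n then ecoeff c d z / (S + of_nat (c + d)) else 0) = 0"
        by (simp add: cd)
  qed (auto simp: \<iota>_def g_def N_def split: if_splits)
  thus ?thesis by (simp add: N_def)
qed

lemma acoeff_freq_has_sum:
  "((\<lambda>(a, b). ecoeff a b z * (of_real (exp (- real (a + b) * r)) * acoeff (n - int a + int b) (z
      * of_real (exp r)))) has_sum acoeff n (freq r)) UNIV"
proof -
  have "((\<lambda>(b, a). ecoeff b a (cnj z * of_real (exp (- r))) * acoeff (n + int b - int a) (z
      * of_real (exp r))) has_sum acoeff n (freq r)) UNIV"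
    unfolding freq_def by (rule acoeff_add_has_sum)
  moreover have "ecoeff b a (cnj z * of_real (exp (- r))) = ecoeff a b z * of_real (exp (- real (a + b) * r))" for a b
  proof -
    have "exp (- real (a + b) * r) = exp (real a * (- r)) * exp (real b * (- r))"
      unfolding exp_add[symmetric] by (rule arg_cong[where f = exp]) (simp add: algebra_simps)
    hence e: "exp (- real (a + b) * r) = exp (- r) ^ a * exp (- r) ^ b"
      by (simp only: exp_of_nat_mult)
    show ?thesis unfolding e by (simp add: ecoeff_def power_mult_distrib field_simps)
  qed
  ultimately have "((\<lambda>(b, a). ecoeff a b z * of_real (exp (- real (a + b) * r)) * acoeff (n + int b
      - int a) (z * of_real (exp r))) has_sum acoeff n (freq r)) UNIV"
    by (simp only:)
  thus ?thesis
    by (subst has_sum_reindex_bij_witness[of _ prod.swap prod.swap]) (auto simp: algebra_simps)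
qed

lemma acoeff_z_bound:
  "norm (acoeff n (z * of_real (exp r))) \<le> 26 * (1 + \<bar>of_int n\<bar>) * norm z powr (- 1 / 3) * exp ((- 1 / 3) * r)"
proof -
  have "norm (acoeff n (z * of_real (exp r))) \<le> 26 * (1 + \<bar>of_int n\<bar>) * (norm z * exp r) powr (- 1 / 3)"
    using norm_acoeff_le[of "z * of_real (exp r)" n] z by (simp add: norm_mult)
  also have "(norm z * exp r) powr (- 1 / 3) = norm z powr (- 1 / 3) * exp ((- 1 / 3) * r)"
    using z by (simp add: powr_mult exp_powr_real)
  finally show ?thesis by simp
qed

text \<open>The factor \<open>exp (i Re (z e^{-w}))\<close> is expanded in powers of \<open>e^{-w}\<close> and its conjugate;
the decay of the remaining angular coefficients permits integration term by term on the line
\<open>Re s = 0\<close>.\<close>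
lemma
  assumes s: "Re s = 0"
  shows set_integrable_half_tr: "set_integrable lborel {0<..} (\<lambda>r. exp (s * of_real r) * acoeff n (freq r))"
    and half_tr_has_sum: "((\<lambda>(a, b). ecoeff a b z * amellin (n - int a + int b) (s - of_nat (a + b)))
        has_sum half_tr n s) UNIV"
proof -
  define f where "f = (\<lambda>(a, b) r. indicator {0<..} r *\<^sub>R (exp (s * of_real r) *
     (ecoeff a b z * (of_real (exp (- real (a + b) * r)) * acoeff (n - int a + int b) (z * of_real (exp r))))))"
  define C where "C = 26 * norm z powr (- 1 / 3) * (1 + \<bar>of_int n\<bar>)"
  have C: "C \<ge> 0" by (simp add: C_def)
  have bd: "norm (f i r) \<le> C * (case i of (a, b) \<Rightarrow> norm (ecoeff a b (2 * z)))
      * (indicator {0<..} r *\<^sub>R exp ((- 1 / 3) * r))" for i r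
  proof (cases "r > 0")
    case True
    obtain a b where i: "i = (a, b)" by (cases i)
    \<comment> \<open>The growth of the decay bound in the index is absorbed by passing from z to 2 z.\<close>
    have p2: "1 + real (a + b) \<le> 2 ^ (a + b)"
    proof -
      have "1 + m \<le> 2 ^ m" for m :: nat by (simp add: Suc_le_eq less_exp)
      from of_nat_mono[OF this[of "a + b"], where 'a = real] show ?thesis by simp
    qed
    have "norm (f i r) = norm (ecoeff a b z) * (exp (- real (a + b) * r) * norm (acoeff (n - int a
        + int b) (z * of_real (exp r))))"
      using True s by (simp add: f_def i norm_mult)
    also have "\<dots> \<le> norm (ecoeff a b z) * (1 * (26 * (1 + \<bar>of_int (n - int a + int b)\<bar>)
        * norm z powr (- 1 / 3) * exp ((- 1 / 3) * r)))"
      using True by (intro mult_left_mono mult_mono acoeff_z_bound) (auto intro: mult_nonpos_nonneg)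
    also have "\<dots> \<le> norm (ecoeff a b z) * (1 * (26 * ((1 + \<bar>of_int n\<bar>) * 2 ^ (a + b))
        * norm z powr (- 1 / 3) * exp ((- 1 / 3) * r)))"
    proof -
      have "1 + \<bar>of_int (n - int a + int b)\<bar> \<le> \<bar>of_int n\<bar> * 1 + (1 + real (a + b))" by simp
      also have "\<dots> \<le> \<bar>of_int n\<bar> * 2 ^ (a + b) + 2 ^ (a + b)"
        using p2 by (intro add_mono mult_left_mono) auto
      finally have "1 + \<bar>real_of_int (n - int a + int b)\<bar> \<le> (1 + \<bar>of_int n\<bar>) * 2 ^ (a + b)"
          by (simp add: algebra_simps)
      thus ?thesis by (intro mult_left_mono mult_right_mono) auto
    qed
    also have "\<dots> = C * (2 ^ (a + b) * norm (ecoeff a b z)) * exp ((- 1 / 3) * r)" by (simp add: C_def mult_ac)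
    also have "2 ^ (a + b) * norm (ecoeff a b z) = norm (ecoeff a b (2 * z))"
      by (simp add: norm_ecoeff norm_mult power_mult_distrib power_divide)
    finally show ?thesis using True by (simp add: i)
  qed (simp add: f_def case_prod_unfold)
  have cm: "(\<lambda>r. acoeff m (z * of_real (exp r))) \<in> borel_measurable borel" for m
    by measurable
  have fm: "f i \<in> borel_measurable borel" for i
    unfolding f_def case_prod_unfold by measurable
  note ie = set_integrable_exp_Ioi[of "- 1 / 3", unfolded set_integrable_def]
  have int: "integrable lborel (f i)" for i
    by (rule lborel_integrable_boundI[OF fm _ bd]) (intro integrable_mult_right ie, simp)
  have summ: "(\<lambda>i. \<integral>r. norm (f i r) \<partial>lborel) summable_on UNIV"
  proof (rule summable_on_comparison_test)
    define I :: real where "I = (\<integral>r. indicator {0<..} r *\<^sub>R exp ((- 1 / 3) * r) \<partial>lborel)"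
    show "(\<lambda>i. C * (case i of (a, b) \<Rightarrow> norm (ecoeff a b (2 * z))) * I) summable_on UNIV"
      by (intro summable_on_cmult_left summable_on_cmult_right has_sum_imp_summable[OF norm_ecoeff_has_sum])
    show "(\<integral>r. norm (f i r) \<partial>lborel) \<le> C * (case i of (a, b) \<Rightarrow> norm (ecoeff a b (2 * z))) * I" for i
    proof -
      have "(\<integral>r. norm (f i r) \<partial>lborel) \<le> (\<integral>r. C * (case i of (a, b) \<Rightarrow> norm (ecoeff a b (2 * z)))
          * (indicator {0<..} r *\<^sub>R exp ((- 1 / 3) * r)) \<partial>lborel)"
        by (intro integral_mono bd integrable_norm int integrable_mult_right ie) auto
      thus ?thesis by (simp add: I_def)
    qed
  qed auto
  have hs: "((\<lambda>i. f i r) has_sum (indicator {0<..} r *\<^sub>R (exp (s * of_real r) * acoeff n (freq r)))) UNIV" for r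
    unfolding f_def case_prod_unfold scaleR_conv_of_real
    using acoeff_freq_has_sum[of r n] by (intro has_sum_cmult_right) (simp add: case_prod_unfold)
  note H = has_sum_integral[OF lborel.sigma_finite_measure_axioms int summ hs]
  show "set_integrable lborel {0<..} (\<lambda>r. exp (s * of_real r) * acoeff n (freq r))"
    unfolding set_integrable_def by (rule H(1))
  have 0: "((\<lambda>i. \<integral>r. f i r \<partial>lborel) has_sum half_tr n s) UNIV"
    unfolding half_tr_def set_lebesgue_integral_def by (rule H(2))
  have "(\<integral>r. f (a, b) r \<partial>lborel) = ecoeff a b z * amellin (n - int a + int b) (s - of_nat (a + b))" for a b
  proof -
    have "f (a, b) r = ecoeff a b z * (indicator {0<..} r *\<^sub>R (exp ((s - of_nat (a + b)) * of_real r)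
        * acoeff (n - int a + int b) (z * of_real (exp r))))" for r
    proof -
      have "exp ((s - of_nat (a + b)) * of_real r) = exp (s * of_real r) * of_real (exp (- real (a + b) * r))"
        unfolding exp_of_real[symmetric] exp_add[symmetric] by (rule arg_cong[where f
            = exp]) (simp add: algebra_simps)
      thus ?thesis by (simp add: f_def mult_ac)
    qed
    thus ?thesis unfolding amellin_def set_lebesgue_integral_def by (simp only: integral_mult_right_zero)
  qed
  hence "(\<lambda>i. \<integral>r. f i r \<partial>lborel) = (\<lambda>(a, b). ecoeff a b z * amellin (n - int a + int b) (s - of_nat (a + b)))"
    by (intro ext) (simp only: split_paired_all split)
  with 0 show "((\<lambda>(a, b). ecoeff a b z * amellin (n - int a + int b) (s - of_nat (a + b))) has_sum half_tr n s) UNIV"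
    by (simp only:)
qed

end

end

section \<open>The Bessel kernel as a Fourier transform\<close>

lemma sin_shift_int: "sin (of_real pi * (\<nu> + of_int m)) = (-1) powi m * sin (of_real pi * \<nu> :: complex)"
proof -
  have c: "cos (of_real pi * of_int m :: complex) = (-1) powi m"
  proof -
    have "cos (of_real pi * of_int m :: complex) = of_real (cos (pi * of_int m))"
      by (simp only: cos_of_real[symmetric] of_real_mult of_real_of_int_eq)
    thus ?thesis by (simp add: cos_npi_int power_int_minus_left)
  qed
  have s: "sin (of_real pi * of_int m :: complex) = 0"
  proof -
    have "sin (of_real pi * of_int m :: complex) = of_real (sin (pi * of_int m))"
      by (simp only: sin_of_real[symmetric] of_real_mult of_real_of_int_eq)
    thus ?thesis by (simp add: sin_npi_int)
  qed
  show ?thesis unfolding distrib_left sin_add c s by simp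
qed

lemma Gamma_shift_reflect:
  assumes "sin (of_real pi * \<nu>) \<noteq> 0"
  shows "Gamma (\<nu> + of_int m) = (-1) powi m * (of_real pi / sin (of_real pi * \<nu>)) * rGamma (1 - (\<nu>
      + of_int m) :: complex)"
proof -
  define y where "y = \<nu> + of_int m"
  define e :: complex where "e = (-1) powi m"
  have e: "e * e = 1" by (simp add: e_def flip: power_int_mult_distrib)
  have R: "rGamma y * rGamma (1 - y) = e * sin (of_real pi * \<nu>) / of_real pi"
    unfolding e_def sin_shift_int[symmetric] y_def by (rule rGamma_reflection_complex)
  have "e * sin (of_real pi * \<nu>) / of_real pi \<noteq> 0" using assms e by auto
  hence "rGamma y \<noteq> 0" using R by auto
  hence G: "Gamma y * (e * sin (of_real pi * \<nu>) / of_real pi) = rGamma (1 - y)"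
    unfolding R[symmetric] by (simp add: Gamma_def)
  have "Gamma y * (e * e) * (sin (of_real pi * \<nu>) / of_real pi) = e * rGamma (1 - y)"
    unfolding G[symmetric] by (simp only: mult_ac times_divide_eq_right times_divide_eq_left)
  thus ?thesis unfolding e y_def[symmetric] e_def[symmetric] using assms
    by (simp add: field_simps)
qed

text \<open>By the reflection formula the quotient of Gamma factors becomes a product of two
reciprocal Gamma factors. This form is independent of the sign of \<open>2 p - a + b\<close>.\<close>
lemma Gamma_rGamma_symmetric:
  fixes a b :: nat and p :: int
  assumes \<nu>: "sin (of_real pi * \<nu>) \<noteq> 0"
  defines "N \<equiv> nat \<bar>2 * p - int a + int b\<bar>" and "S \<equiv> 2 * \<nu> - of_nat (a + b)"
  shows "\<i> ^ N * (Gamma ((of_nat N + S) / 2) * rGamma ((of_nat N - S) / 2 + 1))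
     = \<i> ^ (a + b) * (of_real pi / sin (of_real pi * \<nu>)) *
         (rGamma (- \<nu> - of_int p + of_nat a + 1) * rGamma (- \<nu> + of_int p + of_nat b + 1))"
proof -
  have iN: "\<i> ^ N = (-1) powi m * \<i> ^ (a + b)" if "int N = 2 * m + int (a + b)" for m
  proof -
    have "\<i> ^ N = \<i> powi (2 * m + int (a + b))" unfolding that[symmetric] by simp
    also have "\<dots> = (\<i> powi 2) powi m * \<i> powi int (a + b)"
      by (subst power_int_add) (simp_all add: power_int_mult)
    finally show ?thesis by (simp del: of_nat_add)
  qed
  have sg: "(-1) powi m * ((-1) powi m * x) = x" for m and x :: complex
    by (simp add: mult.assoc[symmetric] flip: power_int_mult_distrib)
  show ?thesis
  proof (cases "2 * p - int a + int b \<ge> 0")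
    case True
    hence N: "int N = 2 * (p - int a) + int (a + b)" by (simp add: N_def)
    have cN: "of_nat N = (2 * (of_int p - of_nat a) + of_nat (a + b) :: complex)"
      using arg_cong[OF N, of of_int] by simp
    have 1: "(of_nat N + S) / 2 = \<nu> + of_int (p - int a)" "(of_nat N - S) / 2 + 1 = - \<nu> + of_int p + of_nat b + 1"
      unfolding cN S_def by (simp_all add: field_simps)
    have 2: "1 - (\<nu> + of_int (p - int a)) = - \<nu> - of_int p + of_nat a + 1" by simp
    show ?thesis
      unfolding 1 iN[OF N] Gamma_shift_reflect[OF \<nu>, of "p - int a"] 2
      using sg[of "p - int a"] by (simp add: mult_ac)
  next
    case False
    hence N: "int N = 2 * (- p - int b) + int (a + b)" by (simp add: N_def)
    have cN: "of_nat N = (2 * (- of_int p - of_nat b) + of_nat (a + b) :: complex)"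
      using arg_cong[OF N, of of_int] by simp
    have 1: "(of_nat N + S) / 2 = \<nu> + of_int (- p - int b)" "(of_nat N - S) / 2 + 1 = - \<nu> - of_int p + of_nat a + 1"
      unfolding cN S_def by (simp_all add: field_simps)
    have 2: "1 - (\<nu> + of_int (- p - int b)) = - \<nu> + of_int p + of_nat b + 1" by simp
    show ?thesis
      unfolding 1 iN[OF N] Gamma_shift_reflect[OF \<nu>, of "- p - int b"] 2
      using sg[of "- p - int b"] by (simp add: mult_ac)
  qed
qed

text \<open>The terms of the series that defines \<open>J_\<mu>\<close> on the Riemann surface of the logarithm.\<close>
definition bessel_term :: "complex \<Rightarrow> complex \<Rightarrow> nat \<Rightarrow> complex" where
  "bessel_term \<mu> w n = (-1) ^ n * exp ((\<mu> + 2 * of_nat n) * (w - of_real (ln 2))) / (fact n * Gamma (\<mu>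
      + of_nat n + 1))"

lemma bessel_term_rGamma: "bessel_term \<mu> w n = (-1) ^ n * exp ((\<mu> + 2 * of_nat n) * (w
    - of_real (ln 2))) * rGamma (\<mu> + of_nat n + 1) / fact n"
  by (simp add: bessel_term_def Gamma_def divide_inverse mult_ac)

text \<open>Absolute convergence follows from convergence at \<open>w + 1\<close>, since up to a factor the series
is a power series in \<open>e^{2 w}\<close>.\<close>
lemma bessel_term_has_sum: "(bessel_term \<mu> w has_sum bessel_J_log \<mu> w) UNIV"
proof (rule norm_summable_imp_has_sum)
  define c where "c = (\<lambda>n. (-1) ^ n / (fact n * Gamma (\<mu> + of_nat n + 1)))"
  have bessel_term: "bessel_term \<mu> w n = exp (\<mu> * (w - of_real (ln 2))) * (c n * exp (2 * (w
      - of_real (ln 2))) ^ n)" for w n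
  proof -
    have "exp (2 * (w - of_real (ln 2))) ^ n = exp (of_nat n * (2 * (w - of_real (ln 2))))"
        by (rule exp_of_nat_mult[symmetric])
    moreover have "exp ((\<mu> + 2 * of_nat n) * (w - of_real (ln 2))) = exp (\<mu> * (w - of_real (ln 2)))
        * exp (of_nat n * (2 * (w - of_real (ln 2))))"
      unfolding exp_add[symmetric] by (rule arg_cong[where f = exp]) (simp add: algebra_simps)
    ultimately show ?thesis by (simp add: bessel_term_def c_def)
  qed
  have s: "summable (bessel_term \<mu> w)" for w
    unfolding bessel_term_def[abs_def] by (rule bessel_J_log_summable)
  show "bessel_term \<mu> w sums bessel_J_log \<mu> w"
    using summable_sums[OF s] unfolding bessel_J_log_def bessel_term_def[abs_def] .
  have "summable (\<lambda>n. c n * exp (2 * (w + 1 - of_real (ln 2))) ^ n)"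
    using s[of "w + 1"] unfolding bessel_term summable_cmult_iff by simp
  hence "summable (\<lambda>n. norm (c n * exp (2 * (w - of_real (ln 2))) ^ n))"
    by (rule powser_insidea) (simp add: algebra_simps)
  hence "summable (\<lambda>n. norm (exp (\<mu> * (w - of_real (ln 2)))) * norm (c n * exp (2 * (w - of_real (ln 2))) ^ n))"
    by (rule summable_mult)
  thus "summable (\<lambda>n. norm (bessel_term \<mu> w n))" unfolding bessel_term norm_mult .
qed

lemma sin_pi_i_nonzero:
  assumes "\<kappa> \<noteq> 0" shows "sin (of_real pi * (\<i> * of_real \<kappa>)) \<noteq> 0"
proof
  assume "sin (of_real pi * (\<i> * of_real \<kappa>)) = 0"
  then obtain m :: int where "of_real pi * (\<i> * of_real \<kappa>) = of_real (of_int m * pi)"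
    unfolding sin_eq_0 by (auto simp: mult.commute)
  hence "Im (of_real pi * (\<i> * of_real \<kappa>)) = 0" by simp
  thus False using assms by simp
qed

context
  fixes z :: complex
begin

text \<open>The terms of the quadruple sum of simple fractions.\<close>
definition cross :: "complex \<Rightarrow> int \<Rightarrow> (nat \<times> nat) \<times> (nat \<times> nat) \<Rightarrow> complex" where
  "cross \<nu> p = (\<lambda>((a, b), (c, d)). if int d - int c = 2 * p - int a + int b
     then ecoeff a b z * ecoeff c d z / (2 * \<nu> - of_nat (a + b) + of_nat (c + d)) else 0)"

lemma cross_swap: "cross (- \<nu>) (- p) (X, Y) = - cross \<nu> p (Y, X)"
proof -
  obtain a b c d where XY: "X = (a, b)" "Y = (c, d)" by (cases X, cases Y)
  define D where "D = 2 * \<nu> - of_nat (c + d) + of_nat (a + b)"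
  have e: "2 * (- \<nu>) - of_nat (a + b) + of_nat (c + d) = - D" by (simp add: D_def)
  have c: "int d - int c = 2 * (- p) - int a + int b \<longleftrightarrow> int b - int a = 2 * p - int c + int d" by auto
  show ?thesis unfolding XY cross_def split e c D_def[symmetric] by (simp add: mult.commute)
qed

lemma cross_summable:
  assumes "Im \<nu> \<noteq> 0"
  shows "cross \<nu> p summable_on UNIV \<times> UNIV"
proof -
  define \<delta> where "\<delta> = \<bar>2 * Im \<nu>\<bar>"
  have \<delta>: "\<delta> > 0" using assms by (simp add: \<delta>_def)
  define g where "g = (\<lambda>(X, Y). (case X of (a, b) \<Rightarrow> complex_of_real (norm (ecoeff a b z)))
      * ((case Y of (c, d) \<Rightarrow> complex_of_real (norm (ecoeff c d z))) / of_real \<delta>))"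
  have "((\<lambda>X. case X of (a, b) \<Rightarrow> complex_of_real (norm (ecoeff a b z))) has_sum of_real (exp (norm z))) UNIV"
    using has_sum_of_real[OF norm_ecoeff_has_sum[of z], where 'a = complex] by (simp add: case_prod_unfold)
  hence "(g has_sum of_real (exp (norm z)) * (of_real (exp (norm z)) / of_real \<delta>)) (UNIV \<times> UNIV)"
    unfolding g_def by (intro has_sum_mult_prod has_sum_divide_const)
  hence "g summable_on UNIV \<times> UNIV" by (rule has_sum_imp_summable)
  hence "(\<lambda>i. norm (g i)) summable_on UNIV \<times> UNIV" by (simp add: summable_on_iff_abs_summable_on_complex)
  hence "(\<lambda>i. norm (cross \<nu> p i)) summable_on UNIV \<times> UNIV"
  proof (rule Infinite_Sum.abs_summable_on_comparison_test)
    fix i :: "(nat \<times> nat) \<times> (nat \<times> nat)"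
    obtain a b c d where i: "i = ((a, b), (c, d))" by (cases i) auto
    have le: "\<delta> \<le> norm (2 * \<nu> - of_nat (a + b) + of_nat (c + d))"
      using abs_Im_le_cmod[of "2 * \<nu> - of_nat (a + b) + of_nat (c + d)"] by (simp add: \<delta>_def)
    have "norm (ecoeff a b z) * norm (ecoeff c d z) / norm (2 * \<nu> - of_nat (a + b) + of_nat (c + d))
        \<le> norm (ecoeff a b z) * norm (ecoeff c d z) / \<delta>"
      by (rule divide_left_mono[OF le _ mult_pos_pos[OF order.strict_trans2[OF \<delta> le] \<delta>]]) simp
    thus "norm (cross \<nu> p i) \<le> norm (g i)"
      using \<delta> by (auto simp: i cross_def g_def norm_mult norm_divide simp del: of_nat_add)
  qed
  thus ?thesis by (rule abs_summable_summable)
qed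

context
  assumes z: "z \<noteq> 0"
begin

text \<open>Every Gamma part contributes the product of one term from each of the two Bessel series; the
branches of the logarithm at \<open>z\<close> and at its conjugate are conjugate to each other.\<close>
lemma gamma_part_term:
  fixes a b :: nat and p :: int
  assumes \<nu>: "sin (of_real pi * \<nu>) \<noteq> 0"
  defines "n \<equiv> 2 * p - int a + int b"
  shows "ecoeff a b z * (aphase z n * gamma_part (norm z) (nat \<bar>n\<bar>) (2 * \<nu> - of_nat (a + b)))
    = of_real pi / (2 * sin (of_real pi * \<nu>)) * (bessel_term (- \<nu> - of_int p) (Ln z) a
        * bessel_term (- \<nu> + of_int p) (cnj (Ln z)) b)"
proof -
  define L where "L = ln (norm z / 2)"
  define \<phi> where "\<phi> = \<i> * complex_of_real (Im (Ln z))"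
  define S where "S = 2 * \<nu> - of_nat (a + b)"
  define N where "N = nat \<bar>n\<bar>"
  have L: "of_real L = of_real (ln (norm z)) - complex_of_real (ln 2)"
    unfolding L_def using z by (simp add: ln_div)
  have Lnz: "Ln z = of_real (ln (norm z)) + \<phi>"
    unfolding \<phi>_def using z by (simp add: complex_eq_iff)
  have w1: "Ln z - of_real (ln 2) = of_real L + \<phi>" unfolding L Lnz by simp
  have w2: "cnj (Ln z) - of_real (ln 2) = of_real L - \<phi>" unfolding L Lnz by (simp add: \<phi>_def)
  have "of_real (norm z) * exp \<phi> = exp (Ln z)"
    unfolding Lnz exp_add using z by (simp add: exp_of_real)
  hence unit_dir: "unit_dir z = exp \<phi>"
    using z unfolding unit_dir_def by (simp add: field_simps)
  have eL: "exp (of_real L) = (of_real (norm z / 2) :: complex)"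
    unfolding exp_of_real L_def using z by simp
  have q: "ecoeff a b z = \<i> ^ (a + b) * (exp (of_nat (a + b) * of_real L) * exp (of_int (int a - int b)
      * \<phi>)) / (fact a * fact b)"
  proof -
    have "ecoeff a b z = ecoeff a b (of_real (norm z) * unit_dir z)" by (simp only: z_eq[OF z, symmetric])
    also have "\<dots> = ecoeff a b (of_real (norm z)) * exp (of_int (int a - int b) * \<phi>)"
      unfolding ecoeff_rotate[OF norm_unit_dir[OF z]] unfolding unit_dir exp_power_int ..
    also have "ecoeff a b (of_real (norm z)) = \<i> ^ (a + b) * exp (of_real L) ^ (a + b) / (fact a * fact b)"
      unfolding eL by (simp add: ecoeff_def power_add power_mult_distrib power_divide)
    finally show ?thesis
      unfolding exp_of_nat_mult by (simp only: times_divide_eq_left times_divide_eq_right mult_ac)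
  qed
  define R where "R = rGamma (- \<nu> - of_int p + of_nat a + 1) * rGamma (- \<nu> + of_int p + of_nat b + 1)"
  have g: "aphase z n * gamma_part (norm z) N S = exp (of_int (- n) * \<phi>) * exp (- S * of_real L)
      * (\<i> ^ (a + b) * (of_real pi / sin (of_real pi * \<nu>)) * R) / 2"
  proof -
    have "aphase z n * gamma_part (norm z) N S = exp (of_int (- n) * \<phi>) * exp (- S * of_real L) *
        (\<i> ^ N * (Gamma ((of_nat N + S) / 2) * rGamma ((of_nat N - S) / 2 + 1))) / 2"
      unfolding aphase_def gamma_part_def unit_dir exp_power_int N_def[symmetric] L_def
      by (simp add: mult_ac)
    also have "\<i> ^ N * (Gamma ((of_nat N + S) / 2) * rGamma ((of_nat N - S) / 2 + 1))
       = \<i> ^ (a + b) * (of_real pi / sin (of_real pi * \<nu>)) * R"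
      unfolding N_def n_def S_def R_def by (rule Gamma_rGamma_symmetric[OF \<nu>])
    finally show ?thesis .
  qed
  define E where "E = exp (of_nat (a + b) * of_real L) * exp (of_int (int a - int b) * \<phi>)
      * (exp (of_int (- n) * \<phi>) * exp (- S * of_real L))"
  have E: "E = exp ((- \<nu> - of_int p + 2 * of_nat a) * (of_real L + \<phi>)) * exp ((- \<nu> + of_int p + 2
      * of_nat b) * (of_real L - \<phi>))"
    unfolding E_def exp_add[symmetric] by (rule arg_cong[where f = exp]) (simp add: n_def S_def algebra_simps)
  have ii: "\<i> ^ (a + b) * \<i> ^ (a + b) = (-1) ^ (a + b)"
    by (simp flip: power_mult_distrib)
  have "ecoeff a b z * (aphase z n * gamma_part (norm z) N S) = E * (\<i> ^ (a + b) * \<i> ^ (a + b))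
      * (of_real pi / (2 * sin (of_real pi * \<nu>))) * R / (fact a * fact b)"
    unfolding q g E_def by (simp add: mult_ac)
  also have "\<dots> = of_real pi / (2 * sin (of_real pi * \<nu>)) * (bessel_term (- \<nu> - of_int p) (Ln z) a
      * bessel_term (- \<nu> + of_int p) (cnj (Ln z)) b)"
    unfolding ii E bessel_term_rGamma w1 w2 R_def by (simp add: power_add mult_ac)
  finally show ?thesis unfolding N_def S_def .
qed

lemma half_tr_eq:
  assumes \<nu>: "Re \<nu> = 0" "Im \<nu> \<noteq> 0" and sin: "sin (of_real pi * \<nu>) \<noteq> 0"
  shows "half_tr z (2 * p) (2 * \<nu>) = of_real pi / (2 * sin (of_real pi * \<nu>)) * bessel_J2 (- \<nu>) (- p) z
      - infsum (cross \<nu> p) (UNIV \<times> UNIV)"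
proof -
  let ?c = "of_real pi / (2 * sin (of_real pi * \<nu>))"
  let ?T = "\<lambda>a b. bessel_term (- \<nu> - of_int p) (Ln z) a * bessel_term (- \<nu> + of_int p) (cnj (Ln z)) b"
  let ?m = "\<lambda>a b. 2 * p - int a + int b" and ?S = "\<lambda>a b. 2 * \<nu> - of_nat (a + b)"
  let ?U = "\<lambda>a b. aphase z (?m a b) * pole_part (norm z) (nat \<bar>?m a b\<bar>) (?S a b)"
  have "((\<lambda>(a, b). ecoeff a b z * amellin z (?m a b) (?S a b)) has_sum half_tr z (2 * p) (2 * \<nu>)) UNIV"
    using \<nu> by (intro half_tr_has_sum z) simp
  moreover have "ecoeff a b z * amellin z (?m a b) (?S a b) =
     ?c * ?T a b
     - ecoeff a b z * (?U a b)" for a b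
  proof -
    have "amellin z (?m a b) (?S a b) = aphase z (?m a b) * gamma_part (norm z) (nat \<bar>?m a b\<bar>) (?S a b) - ?U a b"
      using \<nu> by (intro amellin_eq z) auto
    thus ?thesis by (simp only: right_diff_distrib gamma_part_term[OF sin])
  qed
  ultimately have 1: "((\<lambda>(a, b). ?c * ?T a b
     - ecoeff a b z * (?U a b)) has_sum half_tr z (2 * p) (2 * \<nu>)) UNIV"
    by (simp only:)
  have "((\<lambda>(a, b). ?T a b) has_sum
      bessel_J_log (- \<nu> - of_int p) (Ln z) * bessel_J_log (- \<nu> + of_int p) (cnj (Ln z))) (UNIV \<times> UNIV)"
    by (intro has_sum_mult_prod bessel_term_has_sum)
  hence "((\<lambda>(a, b). ?T a b) has_sum bessel_J2 (- \<nu>) (- p) z) UNIV"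
    by (simp add: bessel_J2_def)
  from has_sum_cmult_right[OF this, of "?c"]
  have 2: "((\<lambda>(a, b). ?c * ?T a b) has_sum
     ?c * bessel_J2 (- \<nu>) (- p) z) UNIV"
    by (simp only: case_prod_unfold)
  have 3: "((\<lambda>(a, b). ecoeff a b z * (?U a b)) has_sum infsum (cross \<nu> p) (UNIV \<times> UNIV)) UNIV"
  proof (rule has_sum_SigmaD)
    show "(cross \<nu> p has_sum infsum (cross \<nu> p) (UNIV \<times> UNIV)) (UNIV \<times> UNIV)"
      using cross_summable[OF \<nu>(2)] by (rule has_sum_infsum)
    fix X :: "nat \<times> nat"
    obtain a b where X: "X = (a, b)" by (cases X)
    have "((\<lambda>Y. ecoeff a b z * (case Y of (c, d) \<Rightarrow> if int d - int c = ?m a b then ecoeff c d z / (?S a b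
        + of_nat (c + d)) else 0)) has_sum
       ecoeff a b z * (?U a b)) UNIV"
      by (intro has_sum_cmult_right pole_part_pair_has_sum z)
    moreover have "cross \<nu> p (X, Y) = ecoeff a b z * (case Y of (c, d) \<Rightarrow> if int d - int c
        = ?m a b then ecoeff c d z / (?S a b + of_nat (c + d)) else 0)" for Y
      by (simp add: cross_def X case_prod_unfold)
    ultimately show "((\<lambda>Y. cross \<nu> p (X, Y)) has_sum (case X of (a, b) \<Rightarrow> ecoeff a b z * (?U a b))) UNIV"
      by (simp only: X split)
  qed
  have "((\<lambda>(a, b). ?c * ?T a b
     - ecoeff a b z * (?U a b)) has_sum
     ?c * bessel_J2 (- \<nu>) (- p) z - infsum (cross \<nu> p) (UNIV \<times> UNIV)) UNIV"
    using has_sum_add[OF 2 has_sum_cmult_right[OF 3, of "- 1"]]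
    by (simp only: case_prod_unfold diff_conv_add_uminus mult_minus1)
  with 1 show ?thesis by (rule has_sum_unique)
qed

text \<open>The quadruple sums of the two half-lines cancel by antisymmetry. The value \<open>\<kappa> = 0\<close>, where
the kernel is a limit in the order, is left out; it forms a null set.\<close>
lemma bold_J_eq_half_tr:
  assumes "\<kappa> \<noteq> 0"
  shows "bold_J (\<i> * of_real \<kappa>) p z = 4 * of_real pi * (half_tr z (2 * p) (2 * (\<i> * of_real \<kappa>))
      + half_tr z (- (2 * p)) (- (2 * (\<i> * of_real \<kappa>))))"
proof -
  define \<nu> where "\<nu> = \<i> * complex_of_real \<kappa>"
  have \<nu>: "Re \<nu> = 0" "Im \<nu> \<noteq> 0" "sin (of_real pi * \<nu>) \<noteq> 0"
    using assms sin_pi_i_nonzero[OF assms] by (auto simp: \<nu>_def)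
  define s where "s = sin (of_real pi * \<nu>)"
  have sm: "sin (of_real pi * (- \<nu>)) = - s" by (simp add: s_def)
  have "infsum (cross (- \<nu>) (- p)) (UNIV \<times> UNIV) = - infsum (cross \<nu> p) (UNIV \<times> UNIV)"
  proof (rule infsumI)
    have "((\<lambda>i. - cross \<nu> p i) has_sum - infsum (cross \<nu> p) (UNIV \<times> UNIV)) (UNIV \<times> UNIV)"
      using has_sum_infsum[OF cross_summable[OF \<nu>(2)]] by (simp add: has_sum_uminus)
    moreover have "(cross (- \<nu>) (- p) has_sum - infsum (cross \<nu> p) (UNIV \<times> UNIV)) (UNIV \<times> UNIV)
      \<longleftrightarrow> ((\<lambda>i. - cross \<nu> p i) has_sum - infsum (cross \<nu> p) (UNIV \<times> UNIV)) (UNIV \<times> UNIV)"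
      by (rule has_sum_reindex_bij_witness[of _ prod.swap prod.swap]) (auto simp: cross_swap)
    ultimately show "(cross (- \<nu>) (- p) has_sum - infsum (cross \<nu> p) (UNIV \<times> UNIV)) (UNIV \<times> UNIV)"
      by blast
  qed
  moreover have "half_tr z (2 * (- p)) (2 * (- \<nu>)) = of_real pi / (2 * (- s)) * bessel_J2 \<nu> p z
      - infsum (cross (- \<nu>) (- p)) (UNIV \<times> UNIV)"
    using half_tr_eq[of "- \<nu>" "- p"] \<nu> by (simp add: s_def)
  ultimately have "half_tr z (2 * p) (2 * \<nu>) + half_tr z (- (2 * p)) (- (2 * \<nu>))
     = of_real pi / (2 * s) * (bessel_J2 (- \<nu>) (- p) z - bessel_J2 \<nu> p z)"
    using half_tr_eq[OF \<nu>, of p] \<nu>(3) by (simp add: s_def[symmetric] right_diff_distrib)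
  moreover have "bold_J \<nu> p z = 4 * of_real pi * (of_real pi / (2 * s) * (bessel_J2 (- \<nu>) (- p) z - bessel_J2 \<nu> p z))"
    using \<nu>(3) by (simp add: bold_J_def bessel_quot_def s_def power2_eq_square)
  ultimately show ?thesis by (simp add: \<nu>_def)
qed

end

end

context
  fixes z :: complex
begin

text \<open>The constant in the bound for the angular coefficients by \<open>(1 + |n|) e^{-|r|/3}\<close>; the second
summand covers \<open>|r| < 1\<close>, where the trivial bound 1 is used.\<close>
definition decay_const :: real where "decay_const = 26 * (norm z / 2) powr (- 1 / 3) + exp (1 / 3)"

lemma decay_const_nonneg: "decay_const \<ge> 0" by (simp add: decay_const_def)

context
  assumes z: "z \<noteq> 0"
begin

lemma norm_acoeff_freq_le_pos:
  assumes "r \<ge> 0"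
  shows "norm (acoeff n (freq z r)) \<le> decay_const * (1 + \<bar>of_int n\<bar>) * exp ((- 1 / 3) * r)"
proof (cases "r \<ge> 1")
  case True
  have "2 \<le> 1 + 2 * r" using True by simp
  also have "\<dots> \<le> exp (2 * r)" by (rule exp_ge_add_one_self)
  finally have "2 * exp (- r) \<le> exp (2 * r) * exp (- r)" by (intro mult_right_mono) auto
  also have "exp (2 * r) * exp (- r) = exp r" unfolding exp_add[symmetric] by simp
  finally have e: "exp (- r) \<le> exp r / 2" by simp
  have "norm z * exp r / 2 = norm z * exp r - norm z * (exp r / 2)" by simp
  also have "\<dots> \<le> norm z * exp r - norm z * exp (- r)"
    using e by (intro diff_left_mono mult_left_mono) auto
  also have "\<dots> \<le> norm (freq z r)"
    using norm_diff_ineq[of "z * of_real (exp r)" "cnj z * of_real (exp (- r))"]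
    by (simp add: freq_def norm_mult)
  finally have Z: "norm z / 2 * exp r \<le> norm (freq z r)" by simp
  have pos: "norm z / 2 * exp r > 0" using z by simp
  have "norm (acoeff n (freq z r)) \<le> 26 * (1 + \<bar>of_int n\<bar>) * norm (freq z r) powr (- 1 / 3)"
    using Z pos by (intro norm_acoeff_le) auto
  also have "\<dots> \<le> 26 * (1 + \<bar>of_int n\<bar>) * (norm z / 2 * exp r) powr (- 1 / 3)"
    using Z pos by (intro mult_left_mono powr_mono2') auto
  also have "(norm z / 2 * exp r) powr (- 1 / 3) = (norm z / 2) powr (- 1 / 3) * exp ((- 1 / 3) * r)"
    using z by (simp only: powr_mult) (simp add: exp_powr_real)
  also have "26 * (1 + \<bar>of_int n\<bar>) * ((norm z / 2) powr (- 1 / 3) * exp ((- 1 / 3) * r))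
     = (26 * (norm z / 2) powr (- 1 / 3) + 0) * (1 + \<bar>of_int n\<bar>) * exp ((- 1 / 3) * r)"
    by simp
  also have "\<dots> \<le> (26 * (norm z / 2) powr (- 1 / 3) + exp (1 / 3)) * (1 + \<bar>of_int n\<bar>) * exp ((- 1 / 3) * r)"
    by (intro mult_right_mono add_left_mono) auto
  finally show ?thesis unfolding decay_const_def .
next
  case False
  have "1 * 1 \<le> (exp (1 / 3) * exp ((- 1 / 3) * r)) * (1 + \<bar>real_of_int n\<bar>)"
    unfolding exp_add[symmetric] using False by (intro mult_mono) auto
  also have "\<dots> = (0 + exp (1 / 3)) * (1 + \<bar>real_of_int n\<bar>) * exp ((- 1 / 3) * r)" by simp
  also have "\<dots> \<le> (26 * (norm z / 2) powr (- 1 / 3) + exp (1 / 3)) * (1 + \<bar>of_int n\<bar>) * exp ((- 1 / 3) * r)"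
    by (intro mult_right_mono add_right_mono) auto
  finally show ?thesis unfolding decay_const_def using norm_acoeff_le_1[of n "freq z r"] by simp
qed

lemma acoeff_freq_minus: "acoeff n (freq z (- r)) = acoeff (- n) (freq z r)"
  by (simp add: freq_minus acoeff_cnj)

lemma norm_acoeff_freq_le:
  "norm (acoeff n (freq z r)) \<le> decay_const * (1 + \<bar>of_int n\<bar>) * exp ((- 1 / 3) * \<bar>r\<bar>)"
proof (cases "r \<ge> 0")
  case True
  thus ?thesis using norm_acoeff_freq_le_pos[OF True, of n] by simp
next
  case False
  thus ?thesis using norm_acoeff_freq_le_pos[of "- r" "- n"] acoeff_freq_minus[of "- n" r] by simp
qed

lemma borel_measurable_acoeff_freq: "(\<lambda>r. acoeff n (freq z r)) \<in> borel_measurable borel"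
  unfolding freq_def by measurable

lemma integrable_acoeff_freq:
  assumes "Re s = 0"
  shows "integrable lborel (\<lambda>r. exp (s * of_real r) * acoeff n (freq z r))"
proof (rule lborel_integrable_boundI)
  show "(\<lambda>r. exp (s * of_real r) * acoeff n (freq z r)) \<in> borel_measurable borel"
    using borel_measurable_acoeff_freq by measurable
  show "integrable lborel (\<lambda>r. decay_const * (1 + \<bar>of_int n\<bar>) * exp ((- 1 / 3) * \<bar>r\<bar>))"
    by (intro integrable_mult_right integrable_exp_abs) auto
  show "norm (exp (s * of_real r) * acoeff n (freq z r)) \<le> decay_const * (1 + \<bar>of_int n\<bar>)
      * exp ((- 1 / 3) * \<bar>r\<bar>)" for r
    using norm_acoeff_freq_le[of n r] assms by (simp add: norm_mult)
qed

text \<open>An absolutely convergent form of the Bruggeman-Motohashi integral.\<close>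
lemma bold_J_eq_integral:
  assumes "\<kappa> \<noteq> 0"
  shows "bold_J (\<i> * of_real \<kappa>) p z = 4 * of_real pi * (\<integral>r. exp (2 * (\<i> * of_real \<kappa>) * of_real r)
      * acoeff (2 * p) (freq z r) \<partial>lborel)"
proof -
  define s where "s = 2 * (\<i> * complex_of_real \<kappa>)"
  have s: "Re s = 0" "Re (- s) = 0" by (simp_all add: s_def)
  note i1 = set_integrable_half_tr[OF z s(1), of "2 * p", unfolded set_integrable_def]
    and i2 = set_integrable_half_tr[OF z s(2), of "- (2 * p)", unfolded set_integrable_def]
  have i2': "integrable lborel (\<lambda>r. indicator {0<..} (-r) *\<^sub>R (exp (- s * of_real (-r)) * acoeff (- (2
      * p)) (freq z (- r))))"
    using lborel_integrable_real_affine[OF i2, of "- 1" 0] by simp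
  have "half_tr z (- (2 * p)) (- s) = (\<integral>r. indicator {0<..} (-r) *\<^sub>R (exp (- s * of_real (-r))
      * acoeff (- (2 * p)) (freq z (- r))) \<partial>lborel)"
    unfolding half_tr_def set_lebesgue_integral_def
    by (subst lborel_integral_real_affine[where c = "- 1" and t = 0]) auto
  hence "half_tr z (2 * p) s + half_tr z (- (2 * p)) (- s) =
     (\<integral>r. indicator {0<..} r *\<^sub>R (exp (s * of_real r) * acoeff (2 * p) (freq z r)) +
       indicator {0<..} (-r) *\<^sub>R (exp (- s * of_real (-r)) * acoeff (- (2 * p)) (freq z (- r))) \<partial>lborel)"
    unfolding half_tr_def[of z "2 * p"] set_lebesgue_integral_def
    by (simp only: Bochner_Integration.integral_add[OF i1 i2'])
  also have "\<dots> = (\<integral>r. exp (s * of_real r) * acoeff (2 * p) (freq z r) \<partial>lborel)"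
  proof (rule integral_cong_AE)
    show "AE r in lborel. indicator {0<..} r *\<^sub>R (exp (s * of_real r) * acoeff (2 * p) (freq z r)) +
       indicator {0<..} (-r) *\<^sub>R (exp (- s * of_real (-r)) * acoeff (- (2 * p)) (freq z (- r))) = exp (s
           * of_real r) * acoeff (2 * p) (freq z r)"
      using AE_lborel_singleton[of 0]
      by eventually_elim (auto simp: indicator_def acoeff_freq_minus)
    show "(\<lambda>r. indicator {0<..} r *\<^sub>R (exp (s * of_real r) * acoeff (2 * p) (freq z r)) +
       indicator {0<..} (-r) *\<^sub>R (exp (- s * of_real (-r)) * acoeff (- (2
           * p)) (freq z (- r)))) \<in> borel_measurable lborel"
      using Bochner_Integration.integrable_add[OF i1 i2'] by (rule borel_measurable_integrable)
    show "(\<lambda>r. exp (s * of_real r) * acoeff (2 * p) (freq z r)) \<in> borel_measurable lborel"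
      using integrable_acoeff_freq[OF s(1)] by (rule borel_measurable_integrable)
  qed
  finally show ?thesis
    unfolding bold_J_eq_half_tr[OF z assms] s_def[symmetric] by simp
qed

end

end

section \<open>Gaussian integrals\<close>

text \<open>Completing the square.\<close>
lemma exp_gauss_le:
  fixes a c x :: real
  assumes "a > 0"
  shows "exp (c * \<bar>x\<bar> - a * x\<^sup>2) \<le> exp ((c + 1)\<^sup>2 / (4 * a)) * exp ((- 1) * \<bar>x\<bar>)"
proof -
  have "0 \<le> (2 * a * \<bar>x\<bar> - (c + 1))\<^sup>2" by simp
  also have "(2 * a * \<bar>x\<bar> - (c + 1))\<^sup>2 = 4 * a * (a * x\<^sup>2 - (c + 1) * \<bar>x\<bar>) + (c + 1)\<^sup>2"
    by (simp add: power2_eq_square algebra_simps)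
  finally have "0 \<le> (a * x\<^sup>2 - (c + 1) * \<bar>x\<bar>) + (c + 1)\<^sup>2 / (4 * a)"
    using assms by (simp add: field_simps)
  hence "c * \<bar>x\<bar> - a * x\<^sup>2 \<le> (c + 1)\<^sup>2 / (4 * a) + (- 1) * \<bar>x\<bar>"
    by (simp add: algebra_simps)
  thus ?thesis unfolding exp_add[symmetric] by simp
qed

lemma integrable_exp_gauss: "a > 0 \<Longrightarrow> integrable lborel (\<lambda>x::real. exp (c * \<bar>x\<bar> - a * x\<^sup>2))"
proof -
  assume a: "a > 0"
  have "integrable lborel (\<lambda>x::real. exp ((c + 1)\<^sup>2 / (4 * a)) * exp ((- 1) * \<bar>x\<bar>))"
    by (intro integrable_mult_right integrable_exp_abs) auto
  thus ?thesis
    by (rule Bochner_Integration.integrable_bound) (use exp_gauss_le[OF a] in auto)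
qed

lemma gauss_bound_tendsto_0:
  fixes f :: "real \<Rightarrow> 'a::real_normed_vector"
  assumes a: "a > 0" and f: "\<And>x. norm (f x) \<le> C * exp (c * \<bar>x\<bar> - a * x\<^sup>2)" and C: "C \<ge> 0"
  shows "(f \<longlongrightarrow> 0) at_top" "(f \<longlongrightarrow> 0) at_bot"
proof -
  define D where "D = C * exp ((c + 1)\<^sup>2 / (4 * a))"
  have le: "norm (f x) \<le> D * exp (- \<bar>x\<bar>)" for x
    using order.trans[OF f mult_left_mono[OF exp_gauss_le[OF a] C]] by (simp add: D_def mult.assoc)
  have "filterlim (\<lambda>x :: real. - \<bar>x\<bar>) at_bot F" if "filterlim (\<lambda>x. \<bar>x\<bar>) at_top F" for F
    using that by (simp add: filterlim_uminus_at_top)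
  hence "((\<lambda>x. exp (- \<bar>x\<bar>)) \<longlongrightarrow> 0) (F :: real filter)" if "filterlim (\<lambda>x. \<bar>x\<bar>) at_top F" for F
    using that by (intro filterlim_compose[OF exp_at_bot]) auto
  hence "((\<lambda>x. D * exp (- \<bar>x\<bar>)) \<longlongrightarrow> 0) (F :: real filter)" if "filterlim (\<lambda>x. \<bar>x\<bar>) at_top F" for F
    using that by (intro tendsto_mult_right_zero) auto
  hence *: "(f \<longlongrightarrow> 0) F" if "filterlim (\<lambda>x. \<bar>x\<bar>) at_top F" for F
    using that le by (intro Lim_null_comparison[of f "\<lambda>x. D * exp (- \<bar>x\<bar>)"]) auto
  show "(f \<longlongrightarrow> 0) at_top" by (rule *[OF filterlim_abs_real])
  show "(f \<longlongrightarrow> 0) at_bot"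
  proof (rule *)
    have "filterlim (\<lambda>x::real. - x) at_top at_bot" by (rule filterlim_uminus_at_top_at_bot)
    thus "filterlim (\<lambda>x::real. \<bar>x\<bar>) at_top at_bot"
      by (rule filterlim_at_top_mono) (auto simp: eventually_at_bot_linorder intro!: exI[of _ 0])
  qed
qed

lemma integrable_gauss_bound:
  fixes f :: "real \<Rightarrow> 'a::{banach,second_countable_topology}"
  assumes a: "a > 0" and f: "\<And>x. norm (f x) \<le> C * exp (c * \<bar>x\<bar> - a * x\<^sup>2)" and m: "f \<in> borel_measurable borel"
  shows "integrable lborel f"
  by (rule lborel_integrable_boundI[OF m _ f]) (intro integrable_mult_right integrable_exp_gauss a)

lemma integral_gauss_cis:
  fixes a t :: real
  assumes a: "a > 0"
  shows "(\<integral>x. of_real (exp (- a * x\<^sup>2)) * cis (t * x) \<partial>lborel) = of_real (sqrt (pi / a) * exp (- t\<^sup>2 / (4 * a)))"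
proof -
  define c where "c = sqrt (2 * a)"
  have c: "c > 0" "c\<^sup>2 = 2 * a" using a by (simp_all add: c_def)
  define s where "s = t / c"
  have "complex_of_real (exp (- s\<^sup>2 / 2)) = char std_normal_distribution s"
    by (simp add: char_std_normal_distribution)
  also have "\<dots> = (\<integral>x. std_normal_density x *\<^sub>R cis (s * x) \<partial>lborel)"
    unfolding char_def by (subst integral_density) (auto simp: cis_conv_exp normal_density_nonneg)
  also have "\<dots> = \<bar>c\<bar> *\<^sub>R (\<integral>x. std_normal_density (0 + c * x) *\<^sub>R cis (s * (0 + c * x)) \<partial>lborel)"
    using c by (intro lborel_integral_real_affine) auto
  also have "(\<lambda>x. std_normal_density (0 + c * x) *\<^sub>R cis (s * (0 + c * x)))
      = (\<lambda>x. of_real (1 / sqrt (2 * pi)) * (of_real (exp (- a * x\<^sup>2)) * cis (t * x)))"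
    using c by (simp add: fun_eq_iff std_normal_density_def s_def power_mult_distrib scaleR_conv_of_real)
  also have "(\<integral>x. of_real (1 / sqrt (2 * pi)) * (of_real (exp (- a * x\<^sup>2)) * cis (t * x)) \<partial>lborel)
     = of_real (1 / sqrt (2 * pi)) * (\<integral>x. of_real (exp (- a * x\<^sup>2)) * cis (t * x) \<partial>lborel)"
    by (rule integral_mult_right_zero)
  finally have "of_real (sqrt (2 * pi) / c) * complex_of_real (exp (- s\<^sup>2 / 2)) = (\<integral>x. of_real (exp (- a
      * x\<^sup>2)) * cis (t * x) \<partial>lborel)"
    using c by (simp add: scaleR_conv_of_real field_simps)
  moreover have "sqrt (2 * pi) / c = sqrt (pi / a)"
    using a by (simp add: c_def real_sqrt_divide real_sqrt_mult)
  moreover have "s\<^sup>2 / 2 = t\<^sup>2 / (4 * a)" using c by (simp add: s_def power_divide)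
  ultimately show ?thesis by simp
qed

lemma abs_le_exp_abs: "\<bar>x\<bar> \<le> exp \<bar>x :: real\<bar>"
  using exp_ge_add_one_self[of "\<bar>x\<bar>"] by linarith

lemma power2_le_exp_abs: "x\<^sup>2 \<le> exp (2 * \<bar>x :: real\<bar>)"
proof -
  have "\<bar>x\<bar>\<^sup>2 \<le> (exp \<bar>x\<bar>)\<^sup>2" by (intro power_mono abs_le_exp_abs) auto
  thus ?thesis by (simp add: exp_double)
qed

lemma
  fixes a t :: real
  assumes a: "a > 0"
  shows integrable_gauss_cis: "integrable lborel (\<lambda>x. of_real (exp (- a * x\<^sup>2)) * cis (t * x))"
    and integrable_gauss2_cis: "integrable lborel (\<lambda>x. of_real (x\<^sup>2 * exp (- a * x\<^sup>2)) * cis (t * x))"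
    and integral_gauss2_cis: "(\<integral>x. of_real (x\<^sup>2 * exp (- a * x\<^sup>2)) * cis (t * x) \<partial>lborel)
      = of_real (sqrt (pi / a) * exp (- t\<^sup>2 / (4 * a)) * (1 / (2 * a) - t\<^sup>2 / (4 * a\<^sup>2)))"
proof -
  let ?g = "\<lambda>x. complex_of_real (exp (- a * x\<^sup>2)) * cis (t * x)"
  let ?m0 = "\<integral>x. ?g x \<partial>lborel"
  let ?g1 = "\<lambda>x. complex_of_real (x * exp (- a * x\<^sup>2)) * cis (t * x)"
  let ?g2 = "\<lambda>x. complex_of_real (x\<^sup>2 * exp (- a * x\<^sup>2)) * cis (t * x)"
  have b0: "norm (?g x) \<le> 1 * exp (0 * \<bar>x\<bar> - a * x\<^sup>2)" for x by (simp add: norm_mult)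
  have b1: "norm (?g1 x) \<le> 1 * exp (1 * \<bar>x\<bar> - a * x\<^sup>2)" for x
    using mult_right_mono[OF abs_le_exp_abs[of x], of "exp (- a * x\<^sup>2)"]
    by (simp add: norm_mult abs_mult flip: exp_add)
  have b2: "norm (?g2 x) \<le> 1 * exp (2 * \<bar>x\<bar> - a * x\<^sup>2)" for x
    using mult_right_mono[OF power2_le_exp_abs[of x], of "exp (- a * x\<^sup>2)"]
    by (simp add: norm_mult norm_power flip: exp_add)
  show i0: "integrable lborel ?g"
    by (rule integrable_gauss_bound[OF a b0]) (intro borel_measurable_continuous_onI continuous_intros)
  have i1: "integrable lborel ?g1"
    by (rule integrable_gauss_bound[OF a b1]) (intro borel_measurable_continuous_onI continuous_intros)
  show i2: "integrable lborel ?g2"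
    by (rule integrable_gauss_bound[OF a b2]) (intro borel_measurable_continuous_onI continuous_intros)
  \<comment> \<open>The second moment is obtained from the zeroth one by integrating the derivatives of the functions g and g1.\<close>
  have dg: "(?g has_vector_derivative (\<i> * of_real t * ?g x - 2 * of_real a * ?g1 x)) (at x)" for x
  proof -
    have "((\<lambda>w. exp (- of_real a * w\<^sup>2) * exp (\<i> * (of_real t * w))) has_field_derivative
      (\<i> * of_real t * (exp (- of_real a * w\<^sup>2) * exp (\<i> * (of_real t * w))) - 2 * of_real a * (w
          * exp (- of_real a * w\<^sup>2) * exp (\<i> * (of_real t * w))))) (at w)" for w :: complex
      by (auto intro!: derivative_eq_intros simp: algebra_simps)
    from has_vector_derivative_real_field[OF this[of "of_real x"], of UNIV]
    show ?thesis by (simp add: o_def cis_conv_exp exp_of_real[symmetric])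
  qed
  have dg1: "(?g1 has_vector_derivative (?g x + \<i> * of_real t * ?g1 x - 2 * of_real a * ?g2 x)) (at x)" for x
  proof -
    have "((\<lambda>w. w * exp (- of_real a * w\<^sup>2) * exp (\<i> * (of_real t * w))) has_field_derivative
      (exp (- of_real a * w\<^sup>2) * exp (\<i> * (of_real t * w)) + \<i> * of_real t * (w * exp (- of_real a
          * w\<^sup>2) * exp (\<i> * (of_real t * w))) - 2 * of_real a * (w\<^sup>2 * exp (- of_real a * w\<^sup>2) * exp (\<i>
          * (of_real t * w))))) (at w)" for w :: complex
      by (auto intro!: derivative_eq_intros simp: algebra_simps power2_eq_square)
    from has_vector_derivative_real_field[OF this[of "of_real x"], of UNIV]
    show ?thesis by (simp add: o_def cis_conv_exp exp_of_real[symmetric])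
  qed
  have "(\<integral>x. \<i> * of_real t * ?g x - 2 * of_real a * ?g1 x \<partial>lborel) = 0"
    by (rule integral_deriv_eq_0[OF dg _ _ gauss_bound_tendsto_0[OF a b0]])
       (intro continuous_intros, intro Bochner_Integration.integrable_diff integrable_mult_right i0 i1, simp_all)
  hence e1: "\<i> * of_real t * ?m0 - 2 * of_real a * (\<integral>x. ?g1 x \<partial>lborel) = 0"
    using i0 i1 by (simp only: Bochner_Integration.integral_diff integrable_mult_right integral_mult_right_zero)
  have "(\<integral>x. ?g x + \<i> * of_real t * ?g1 x - 2 * of_real a * ?g2 x \<partial>lborel) = 0"
    by (rule integral_deriv_eq_0[OF dg1 _ _ gauss_bound_tendsto_0[OF a b1]])
       (intro continuous_intros, intro Bochner_Integration.integrable_diff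
           Bochner_Integration.integrable_add integrable_mult_right i0 i1 i2, simp_all)
  hence e2: "?m0 + \<i> * of_real t * (\<integral>x. ?g1 x \<partial>lborel) - 2 * of_real a * (\<integral>x. ?g2 x \<partial>lborel) = 0"
    using i0 i1 i2 by (simp only: Bochner_Integration.integral_diff Bochner_Integration.integral_add
        Bochner_Integration.integrable_add integrable_mult_right integral_mult_right_zero)
  have "(\<integral>x. ?g1 x \<partial>lborel) = \<i> * of_real t * ?m0 / (2 * of_real a)"
    using e1 a by (simp add: field_simps)
  hence "2 * of_real a * (\<integral>x. ?g2 x \<partial>lborel) = ?m0 + \<i> * of_real t * (\<i> * of_real t * ?m0 / (2 * of_real a))"
    using e2 by simp
  hence "(\<integral>x. ?g2 x \<partial>lborel) = ?m0 * of_real (1 / (2 * a) - t\<^sup>2 / (4 * a\<^sup>2))"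
    using a by (simp add: field_simps power2_eq_square)
  thus "(\<integral>x. ?g2 x \<partial>lborel) = of_real (sqrt (pi / a) * exp (- t\<^sup>2 / (4 * a)) * (1 / (2 * a) - t\<^sup>2 / (4 * a\<^sup>2)))"
    unfolding integral_gauss_cis[OF a] by simp
qed

section \<open>Unfolding the theta function\<close>

lemma summable_on_exp_int: "c < 0 \<Longrightarrow> (\<lambda>q::int. exp (c * \<bar>real_of_int q\<bar>)) summable_on UNIV"
proof -
  assume c: "c < 0"
  have "summable (\<lambda>n. norm (exp c ^ n))" using c by (simp add: summable_geometric)
  hence s: "(\<lambda>n. exp c ^ n) summable_on UNIV" by (rule norm_summable_imp_summable_on)
  have e: "exp (c * real n) = exp c ^ n" for n using exp_of_nat_mult[of n c] by (simp add: mult.commute)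
  have 1: "(\<lambda>q::int. exp (c * \<bar>real_of_int q\<bar>)) summable_on range int"
    by (subst summable_on_reindex) (use s in \<open>simp_all add: o_def e\<close>)
  have 2: "(\<lambda>q::int. exp (c * \<bar>real_of_int q\<bar>)) summable_on range (\<lambda>n. - int n)"
    by (subst summable_on_reindex) (use s in \<open>simp_all add: o_def e inj_def\<close>)
  have "range int \<union> range (\<lambda>n. - int n) = UNIV"
    by (auto simp: image_iff) (metis int_cases2)
  thus ?thesis using summable_on_union[OF 1 2] by simp
qed

lemma summable_on_comparison_real:
  fixes f :: "'a \<Rightarrow> real"
  assumes "g summable_on A" "\<And>x. x \<in> A \<Longrightarrow> 0 \<le> f x" "\<And>x. x \<in> A \<Longrightarrow> f x \<le> g x"
  shows "f summable_on A"
  by (rule summable_on_comparison_test[OF assms(1)]) (use assms(2,3) in auto)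

text \<open>A constant such that the summand of index \<open>q\<close> of the theta function is at most
this constant times \<open>e^{-\<pi> |q|}\<close> on the period \<open>[0, \<pi>)\<close>.\<close>
definition theta_const :: "real \<Rightarrow> real" where
  "theta_const P = sqrt pi * P * exp (1 / (4 * P\<^sup>2)) * exp pi"

lemma gauss_k_shift_le:
  assumes P: "P > 0" and \<omega>: "0 \<le> \<omega>" "\<omega> < pi"
  shows "gauss_k P (\<omega> + pi * of_int q)
    \<le> theta_const P * exp (- pi * \<bar>of_int q\<bar>)"
proof -
  have "pi * \<bar>of_int q\<bar> - pi \<le> \<bar>\<omega> + pi * of_int q\<bar>"
    using \<omega> by (cases "q \<ge> 0") (auto simp: abs_if algebra_simps)
  hence 1: "exp (- 1 * \<bar>\<omega> + pi * of_int q\<bar>) \<le> exp pi * exp (- pi * \<bar>of_int q\<bar>)"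
    unfolding exp_add[symmetric] by simp
  have "exp (- (P * (\<omega> + pi * of_int q))\<^sup>2) = exp (0 * \<bar>\<omega> + pi * of_int q\<bar> - P\<^sup>2 * (\<omega> + pi * of_int q)\<^sup>2)"
    by (simp add: power_mult_distrib)
  also have "\<dots> \<le> exp ((0 + 1)\<^sup>2 / (4 * P\<^sup>2)) * exp ((- 1) * \<bar>\<omega> + pi * of_int q\<bar>)"
    using P by (intro exp_gauss_le) auto
  also have "\<dots> \<le> exp ((0 + 1)\<^sup>2 / (4 * P\<^sup>2)) * (exp pi * exp (- pi * \<bar>of_int q\<bar>))"
    using 1 by (intro mult_left_mono) auto
  finally have "sqrt pi * P * exp (- (P * (\<omega> + pi * of_int q))\<^sup>2) \<le> sqrt pi * P * (exp ((0 + 1)\<^sup>2 / (4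
      * P\<^sup>2)) * (exp pi * exp (- pi * \<bar>of_int q\<bar>)))"
    using P by (intro mult_left_mono) auto
  thus ?thesis by (simp add: gauss_k_def theta_const_def mult_ac)
qed

lemma gauss_k_nonneg: "P \<ge> 0 \<Longrightarrow> 0 \<le> gauss_k P x"
  by (simp add: gauss_k_def)

lemma continuous_on_gauss_k [continuous_intros]: "continuous_on A f \<Longrightarrow> continuous_on A (\<lambda>x. gauss_k P (f x))"
  unfolding gauss_k_def by (intro continuous_intros)

lemma borel_measurable_gauss_k [measurable]: "gauss_k P \<in> borel_measurable borel"
  by (intro borel_measurable_continuous_onI continuous_intros)

lemma theta_has_sum:
  assumes P: "P > 0" and \<omega>: "0 \<le> \<omega>" "\<omega> < pi"
  shows "((\<lambda>q. gauss_k P (\<omega> + pi * of_int q)) has_sum theta P \<omega>) UNIV"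
proof -
  have "(\<lambda>q::int. theta_const P * exp (- pi * \<bar>of_int q\<bar>)) summable_on UNIV"
    by (intro summable_on_cmult_right summable_on_exp_int) auto
  hence s: "(\<lambda>q. gauss_k P (\<omega> + pi * of_int q)) summable_on UNIV"
    by (rule summable_on_comparison_real) (use gauss_k_shift_le[OF assms] gauss_k_nonneg P in auto)
  have "infsum (\<lambda>q. gauss_k P (\<omega> + pi * of_int q)) UNIV = theta P \<omega>"
    unfolding theta_def gauss_k_def by (rule infsum_cmult_right')
  thus ?thesis using has_sum_infsum[OF s] by simp
qed

lemma theta_bounds:
  assumes P: "P > 0" and \<omega>: "0 \<le> \<omega>" "\<omega> < pi"
  shows "0 \<le> theta P \<omega>"
    and "theta P \<omega> \<le> (\<Sum>\<^sub>\<infinity>q::int. theta_const P * exp (- pi * \<bar>of_int q\<bar>))"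
proof -
  show "0 \<le> theta P \<omega>"
    using has_sum_nonneg[OF theta_has_sum[OF assms]] gauss_k_nonneg P by simp
  have "(\<lambda>q::int. theta_const P * exp (- pi * \<bar>of_int q\<bar>)) summable_on UNIV"
    by (intro summable_on_cmult_right summable_on_exp_int) auto
  thus "theta P \<omega> \<le> (\<Sum>\<^sub>\<infinity>q::int. theta_const P * exp (- pi * \<bar>of_int q\<bar>))"
    by (intro has_sum_mono[OF theta_has_sum[OF assms] has_sum_infsum] gauss_k_shift_le assms)
qed

text \<open>The measure on the second factor of the dual space.\<close>
abbreviation period_measure :: "real measure" where
  "period_measure \<equiv> restrict_space lborel {0..<pi}"

lemma finite_period_measure: "finite_measure period_measure"
  by (rule finite_measureI) (simp add: emeasure_restrict_space space_restrict_space)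

lemma integrable_gauss_k: "P > 0 \<Longrightarrow> integrable lborel (gauss_k P)"
  by (rule integrable_gauss_bound[of "P\<^sup>2" _ "sqrt pi * P" 0]) (auto simp: gauss_k_def power_mult_distrib)

text \<open>The integral over one period of a \<open>\<pi>\<close>-periodic function against the theta function
unfolds to an integral over the real line against a single Gaussian.\<close>
lemma
  fixes X :: "real \<Rightarrow> real"
  assumes P: "P > 0" and X [measurable]: "X \<in> borel_measurable borel"
    and B: "\<And>\<omega>. \<bar>X \<omega>\<bar> \<le> B" and per: "\<And>\<omega> q. X (\<omega> + pi * of_int q) = X \<omega>"
  shows integrable_theta_unfold: "integrable period_measure (\<lambda>\<omega>. of_real (X \<omega> * theta P \<omega>) :: complex)"
    and integral_theta_unfold: "(\<integral>\<omega>. of_real (X \<omega> * theta P \<omega>) \<partial>period_measure)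
        = (\<integral>\<omega>. complex_of_real (X \<omega> * gauss_k P \<omega>) \<partial>lborel)"
proof -
  interpret U: finite_measure period_measure by (rule finite_period_measure)
  define f where "f = (\<lambda>(q::int) \<omega>. complex_of_real (X \<omega> * gauss_k P (\<omega> + pi * of_int q)))"
  define D where "D = B * (theta_const P)"
  have B0: "B \<ge> 0" using B[of 0] by linarith
  have fb: "norm (f q \<omega>) \<le> D * exp (- pi * \<bar>of_int q\<bar>)" if "0 \<le> \<omega>" "\<omega> < pi" for q \<omega>
  proof -
    have "norm (f q \<omega>) = \<bar>X \<omega>\<bar> * gauss_k P (\<omega> + pi * of_int q)"
      using gauss_k_nonneg[of P] P by (simp add: f_def norm_mult)
    also have "\<dots> \<le> B * (theta_const P * exp (- pi * \<bar>of_int q\<bar>))"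
      using B0 P by (intro mult_mono B gauss_k_shift_le that gauss_k_nonneg) auto
    finally show ?thesis by (simp add: D_def mult.assoc)
  qed
  have fm: "f q \<in> borel_measurable borel" for q
    unfolding f_def by measurable
  have fi: "integrable period_measure (f q)" for q
    by (rule U.integrable_const_bound[where B = "D * exp (- pi * \<bar>of_int q\<bar>)"])
       (use fb in \<open>auto intro!: AE_I2 measurable_restrict_space1 fm simp: space_restrict_space\<close>)
  have fs: "(\<lambda>q. \<integral>\<omega>. norm (f q \<omega>) \<partial>period_measure) summable_on UNIV"
  proof (rule summable_on_comparison_real)
    show "(\<lambda>q::int. (D * exp (- pi * \<bar>of_int q\<bar>)) * pi) summable_on UNIV"
      by (intro summable_on_cmult_left summable_on_cmult_right summable_on_exp_int) auto
    show "(\<integral>\<omega>. norm (f q \<omega>) \<partial>period_measure) \<le> (D * exp (- pi * \<bar>of_int q\<bar>)) * pi" for q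
    proof -
      have "(\<integral>\<omega>. norm (f q \<omega>) \<partial>period_measure) \<le> (\<integral>\<omega>. D * exp (- pi * \<bar>of_int q\<bar>) \<partial>period_measure)"
        by (intro integral_mono fi integrable_norm) (use fb in \<open>auto simp: space_restrict_space\<close>)
      thus ?thesis by (simp add: measure_restrict_space mult_ac)
    qed
  qed auto
  have fh: "((\<lambda>q. f q \<omega>) has_sum of_real (X \<omega> * theta P \<omega>)) UNIV" if "\<omega> \<in> space period_measure" for \<omega>
    unfolding f_def using that P
    by (intro has_sum_of_real has_sum_cmult_right theta_has_sum) (auto simp: space_restrict_space)
  note H = has_sum_integral[OF U.sigma_finite_measure_axioms fi fs fh]
  show "integrable period_measure (\<lambda>\<omega>. of_real (X \<omega> * theta P \<omega>) :: complex)" by (rule H(1))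
  define g where "g = (\<lambda>\<omega>. complex_of_real (X \<omega> * gauss_k P \<omega>))"
  define A where "A = (\<lambda>q::int. {\<omega>. pi * of_int q \<le> \<omega> \<and> \<omega> < pi * of_int q + pi})"
  have [measurable]: "A q \<in> sets borel" for q unfolding A_def by measurable
  have gm [measurable]: "g \<in> borel_measurable borel" unfolding g_def by measurable
  have gi: "integrable lborel g"
    unfolding g_def by (intro integrable_of_real Bochner_Integration.integrable_bound[OF
        integrable_mult_right[OF integrable_gauss_k[OF P], of B]])
       (use B B0 P in \<open>auto simp: abs_mult gauss_k_nonneg intro!: mult_right_mono\<close>)
  define g' where "g' = (\<lambda>q \<omega>. indicator (A q) \<omega> *\<^sub>R g \<omega>)"
  have g'i: "integrable lborel (g' q)" for q
    unfolding g'_def by (rule integrable_mult_indicator[OF _ gi]) simp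
  have shift: "g' q (pi * of_int q + 1 * \<omega>) = indicator {0..<pi} \<omega> *\<^sub>R f q \<omega>" for q \<omega>
    using per[of \<omega> q] by (simp add: g'_def g_def f_def A_def indicator_def add.commute)
  have eq: "(\<integral>\<omega>. f q \<omega> \<partial>period_measure) = (\<integral>\<omega>. g' q \<omega> \<partial>lborel)" for q
    by (subst lborel_integral_real_affine[where c = 1 and t = "pi * of_int q"])
       (simp_all only: shift, simp_all add: integral_restrict_space)
  have eqn: "(\<integral>\<omega>. norm (f q \<omega>) \<partial>period_measure) = (\<integral>\<omega>. norm (g' q \<omega>) \<partial>lborel)" for q
    by (subst lborel_integral_real_affine[where c = 1 and t = "pi * of_int q"])
       (simp_all only: shift, simp_all add: integral_restrict_space)
  have gs: "(\<lambda>q. \<integral>\<omega>. norm (g' q \<omega>) \<partial>lborel) summable_on UNIV"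
    using fs by (simp only: eqn)
  have gh: "((\<lambda>q. g' q \<omega>) has_sum g \<omega>) UNIV" for \<omega>
  proof -
    define q where "q = \<lfloor>\<omega> / pi\<rfloor>"
    have Aq: "\<omega> \<in> A r \<longleftrightarrow> r = q" for r
    proof -
      have "\<omega> \<in> A r \<longleftrightarrow> of_int r \<le> \<omega> / pi \<and> \<omega> / pi < of_int r + 1"
        by (auto simp: A_def field_simps)
      also have "\<dots> \<longleftrightarrow> q = r" unfolding q_def by (rule floor_eq_iff[symmetric])
      finally show ?thesis by auto
    qed
    have "((\<lambda>q. g' q \<omega>) has_sum g \<omega>) UNIV \<longleftrightarrow> ((\<lambda>q. g' q \<omega>) has_sum g \<omega>) {q}"
      by (rule has_sum_cong_neutral) (auto simp: g'_def Aq)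
    thus ?thesis by (simp add: has_sum_finite_iff g'_def Aq)
  qed
  have "((\<lambda>q. \<integral>\<omega>. g' q \<omega> \<partial>lborel) has_sum (\<integral>\<omega>. g \<omega> \<partial>lborel)) UNIV"
    by (rule has_sum_integral(2)[OF lborel.sigma_finite_measure_axioms g'i gs gh])
  with H(2) have "(\<integral>\<omega>. of_real (X \<omega> * theta P \<omega>) \<partial>period_measure) = (\<integral>\<omega>. g \<omega> \<partial>lborel)"
    unfolding eq by (rule has_sum_unique)
  thus "(\<integral>\<omega>. of_real (X \<omega> * theta P \<omega>) \<partial>period_measure) = (\<integral>\<omega>. complex_of_real (X \<omega> * gauss_k P \<omega>) \<partial>lborel)"
    by (simp only: g_def)
qed

text \<open>Parseval's formula in the angular variable, for a weight on the real line with Fourier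
transform \<open>V\<close>. The cosine is even under \<open>Z \<mapsto> -Z\<close>, so only the angular coefficients with even
index occur.\<close>
lemma has_sum_cos_acoeff:
  fixes W :: "real \<Rightarrow> real" and V :: "int \<Rightarrow> complex"
  assumes W: "integrable lborel W"
    and V: "\<And>m. (\<integral>\<omega>. of_real (W \<omega>) * cis (of_int m * \<omega>) \<partial>lborel) = V m"
  shows "((\<lambda>p. acoeff (2 * p) Z * V (- (2 * p))) has_sum (\<integral>\<omega>. of_real (cos (Re (Z * cis \<omega>)) * W \<omega>) \<partial>lborel)) UNIV"
proof -
  have Wc: "integrable lborel (\<lambda>\<omega>. complex_of_real (W \<omega>))" using W by simp
  have Wm [measurable]: "W \<in> borel_measurable borel" using borel_measurable_integrable[OF W] by simp
  have [measurable]: "cis \<in> borel_measurable borel"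
    by (intro borel_measurable_continuous_onI continuous_intros)
  define I where "I = (\<lambda>Z. \<integral>\<omega>. exp (\<i> * of_real (Re (Z * cis \<omega>))) * of_real (W \<omega>) \<partial>lborel)"
  have int: "integrable lborel (\<lambda>\<omega>. exp (\<i> * of_real (Re (Z * cis \<omega>))) * complex_of_real (W \<omega>))" for Z
    by (rule Bochner_Integration.integrable_bound[OF Wc]) (auto simp: norm_mult)
  have 1: "((\<lambda>(c, d). ecoeff c d Z * V (int c - int d)) has_sum I Z) UNIV" for Z
    using has_sum_integral_exp_Re[OF lborel.sigma_finite_measure_axioms _ Wc, of Z]
    by (simp only: I_def V[symmetric] mult.commute[of "of_real (W _)"]) simp
  have cosI: "(I Z + I (- Z)) * (1 / 2) = (\<integral>\<omega>. of_real (cos (Re (Z * cis \<omega>)) * W \<omega>) \<partial>lborel)"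
  proof -
    have "(I Z + I (- Z)) * (1 / 2) = (\<integral>\<omega>. (exp (\<i> * of_real (Re (Z * cis \<omega>))) * complex_of_real (W \<omega>)
       + exp (\<i> * of_real (Re (- Z * cis \<omega>))) * complex_of_real (W \<omega>)) * (1 / 2) \<partial>lborel)"
      unfolding I_def integral_mult_left_zero by (subst Bochner_Integration.integral_add[OF int int]) (rule refl)
    also have "\<dots> = (\<integral>\<omega>. of_real (cos (Re (Z * cis \<omega>)) * W \<omega>) \<partial>lborel)"
    proof (rule Bochner_Integration.integral_cong[OF refl])
      fix \<omega> :: real
      define x where "x = Re (Z * cis \<omega>)"
      have x': "Re (- Z * cis \<omega>) = - x" by (simp add: x_def)
      have e: "(exp (\<i> * of_real x) + exp (\<i> * of_real (- x))) * (1 / 2) = complex_of_real (cos x)"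
        unfolding cis_conv_exp[symmetric] by (simp add: complex_eq_iff)
      thus "(exp (\<i> * of_real (Re (Z * cis \<omega>))) * complex_of_real (W \<omega>)
       + exp (\<i> * of_real (Re (- Z * cis \<omega>))) * complex_of_real (W \<omega>)) * (1 / 2) = of_real (cos (Re (Z
           * cis \<omega>)) * W \<omega>)"
        unfolding x' x_def[symmetric] of_real_mult e[symmetric] by (simp only: algebra_simps)
    qed
    finally show ?thesis .
  qed
  have qm: "ecoeff c d (- Z) = (-1) ^ (c + d) * ecoeff c d Z" for c d
    by (simp add: ecoeff_def power_add power_minus[of "\<i> * Z / 2"] power_minus[of "\<i> * cnj Z / 2"])
  have "((\<lambda>x. ((case x of (c, d) \<Rightarrow> ecoeff c d Z * V (int c - int d))
      + (case x of (c, d) \<Rightarrow> ecoeff c d (- Z) * V (int c - int d))) * (1 / 2)) has_sum (I Z + I (- Z)) * (1 / 2)) UNIV"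
    by (intro has_sum_cmult_left has_sum_add 1)
  hence 2: "((\<lambda>(c, d). if even (int d - int c) then ecoeff c d Z * V (int c - int d) else 0)
      has_sum (I Z + I (- Z)) * (1 / 2)) UNIV"
    by (rule has_sum_cong[THEN iffD1, rotated]) (auto simp: qm)
  define g where "g = (\<lambda>(p, (c, d)). if int d - int c = 2 * p then ecoeff c d Z * V (int c - int d) else 0)"
  define \<iota> where "\<iota> = (\<lambda>(c, d). ((int d - int c) div 2, (c, d)))"
  have "((\<lambda>(c, d). if even (int d - int c) then ecoeff c d Z * V (int c - int d) else 0) has_sum (I Z
      + I (- Z)) * (1 / 2)) UNIV
    \<longleftrightarrow> (g \<circ> \<iota> has_sum (I Z + I (- Z)) * (1 / 2)) UNIV"
  proof (rule has_sum_cong)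
    fix x :: "nat \<times> nat"
    obtain c d where x: "x = (c, d)" by (cases x)
    have "even (int d - int c) \<longleftrightarrow> int d - int c = 2 * ((int d - int c) div 2)" by presburger
    thus "(case x of (c, d) \<Rightarrow> if even (int d - int c) then ecoeff c d Z * V (int c - int d) else 0) = (g \<circ> \<iota>) x"
      by (simp only: g_def \<iota>_def x o_def split)
  qed
  also have "\<dots> \<longleftrightarrow> (g has_sum (I Z + I (- Z)) * (1 / 2)) (range \<iota>)"
    by (subst has_sum_reindex) (auto simp: inj_def \<iota>_def)
  also have "\<dots> \<longleftrightarrow> (g has_sum (I Z + I (- Z)) * (1 / 2)) (UNIV \<times> UNIV)"
  proof (rule has_sum_cong_neutral)
    fix y assume y: "y \<in> UNIV \<times> UNIV - range \<iota>"
    obtain p c d where pcd: "y = (p, (c, d))" by (cases y) auto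
    have "int d - int c \<noteq> 2 * p"
    proof
      assume "int d - int c = 2 * p"
      hence "y = \<iota> (c, d)" by (simp add: pcd \<iota>_def)
      thus False using y by auto
    qed
    thus "g y = 0" by (simp add: g_def pcd)
  qed auto
  finally have "(g has_sum (I Z + I (- Z)) * (1 / 2)) (UNIV \<times> UNIV)" using 2 by simp
  hence "((\<lambda>p. acoeff (2 * p) Z * V (- (2 * p))) has_sum (I Z + I (- Z)) * (1 / 2)) UNIV"
  proof (rule has_sum_SigmaD)
    fix p :: int
    have "((\<lambda>x. (case x of (c, d) \<Rightarrow> if int d - int c = 2 * p then ecoeff c d Z else 0) * V (- (2 * p)))
        has_sum acoeff (2 * p) Z * V (- (2 * p))) UNIV"
      by (intro has_sum_cmult_left acoeff_has_sum)
    moreover have "g (p, y) = (case y of (c, d) \<Rightarrow> if int d - int c = 2 * p then ecoeff c d Z else 0)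
        * V (- (2 * p))" for y
    proof -
      obtain c d where y: "y = (c, d)" by (cases y)
      show ?thesis
      proof (cases "int d - int c = 2 * p")
        case True
        hence *: "int c - int d = - (2 * p)" by simp
        show ?thesis unfolding y g_def split * using True by simp
      qed (simp add: y g_def)
    qed
    ultimately show "((\<lambda>y. g (p, y)) has_sum acoeff (2 * p) Z * V (- (2 * p))) UNIV" by (simp only:)
  qed
  thus ?thesis by (simp only: cosI)
qed

section \<open>Integration by parts against Gaussians\<close>

lemma (in pair_sigma_finite) integrable_prod_bound:
  fixes f :: "_ \<Rightarrow> 'c::{banach,second_countable_topology}" and g :: "'a \<Rightarrow> real" and h :: "'b \<Rightarrow> real"
  assumes f: "f \<in> borel_measurable (M1 \<Otimes>\<^sub>M M2)" and g: "integrable M1 g" and h: "integrable M2 h"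
    and le: "\<And>x y. x \<in> space M1 \<Longrightarrow> y \<in> space M2 \<Longrightarrow> norm (f (x, y)) \<le> g x * h y"
  shows "integrable (M1 \<Otimes>\<^sub>M M2) f"
proof -
  have [measurable]: "g \<in> borel_measurable M1" "h \<in> borel_measurable M2"
    using g h by (auto intro: borel_measurable_integrable)
  have "integrable (M1 \<Otimes>\<^sub>M M2) (\<lambda>(x, y). g x * h y)"
  proof (rule Fubini_integrable)
    show "integrable M1 (\<lambda>x. \<integral>y. norm (case (x, y) of (x, y) \<Rightarrow> g x * h y) \<partial>M2)"
      using g by (simp add: abs_mult)
    show "AE x in M1. integrable M2 (\<lambda>y. case (x, y) of (x, y) \<Rightarrow> g x * h y)"
      using h by simp
  qed measurable
  thus ?thesis
  proof (rule Bochner_Integration.integrable_bound[OF _ f])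
    show "AE p in M1 \<Otimes>\<^sub>M M2. norm (f p) \<le> norm (case p of (x, y) \<Rightarrow> g x * h y)"
      using le by (auto intro!: AE_I2 simp: space_pair_measure intro: order.trans[OF _ abs_ge_self])
  qed
qed

text \<open>The first and second derivatives of the Gaussian, and a Gaussian weight that dominates these
functions together with the exponential growth of the phase.\<close>
definition gauss_k1 :: "real \<Rightarrow> real \<Rightarrow> real" where "gauss_k1 K r = - 2 * K\<^sup>2 * r * gauss_k K r"
definition gauss_k2 :: "real \<Rightarrow> real \<Rightarrow> real" where "gauss_k2 K r = (4 * K ^ 4 * r\<^sup>2 - 2 * K\<^sup>2) * gauss_k K r"
definition gauss_wt :: "real \<Rightarrow> real \<Rightarrow> real" where "gauss_wt K r = exp (2 * \<bar>r\<bar>) * gauss_k K r"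

lemma gauss_wt_eq: "gauss_wt K r = sqrt pi * K * exp (2 * \<bar>r\<bar> - K\<^sup>2 * r\<^sup>2)"
  by (simp add: gauss_wt_def gauss_k_def power_mult_distrib exp_diff exp_minus divide_inverse)

lemma gauss_wt_nonneg: "K \<ge> 0 \<Longrightarrow> 0 \<le> gauss_wt K r" by (simp add: gauss_wt_def gauss_k_nonneg)

lemma integrable_gauss_wt: "K > 0 \<Longrightarrow> integrable lborel (gauss_wt K)"
  unfolding gauss_wt_eq[abs_def] by (intro integrable_mult_right integrable_exp_gauss) auto

lemma gauss_k_deriv [derivative_intros]:
  "(f has_real_derivative f') (at r) \<Longrightarrow> ((\<lambda>r. gauss_k K (f r)) has_real_derivative (gauss_k1 K (f r) * f')) (at r)"
  unfolding gauss_k_def gauss_k1_def by (auto intro!: derivative_eq_intros simp: power2_eq_square algebra_simps)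

lemma gauss_k1_deriv [derivative_intros]:
  "(f has_real_derivative f') (at r) \<Longrightarrow> ((\<lambda>r. gauss_k1 K (f r)) has_real_derivative (gauss_k2 K (f r) * f')) (at r)"
  unfolding gauss_k1_def by (auto intro!: derivative_eq_intros simp: gauss_k1_def gauss_k2_def
      power2_eq_square power4_eq_xxxx algebra_simps)

lemma continuous_on_gauss_k1 [continuous_intros]: "continuous_on A f \<Longrightarrow> continuous_on A (\<lambda>x. gauss_k1 P (f x))"
  unfolding gauss_k1_def by (intro continuous_intros)
lemma continuous_on_gauss_k2 [continuous_intros]: "continuous_on A f \<Longrightarrow> continuous_on A (\<lambda>x. gauss_k2 P (f x))"
  unfolding gauss_k2_def by (intro continuous_intros)

lemma exp_abs_mono: "exp \<bar>r :: real\<bar> \<le> exp (2 * \<bar>r\<bar>)" "1 \<le> exp (2 * \<bar>r\<bar>)" by auto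

lemma gauss_k1_le: "K > 0 \<Longrightarrow> \<bar>gauss_k1 K r\<bar> \<le> 2 * K\<^sup>2 * gauss_wt K r"
proof -
  assume K: "K > 0"
  have "\<bar>r\<bar> \<le> exp (2 * \<bar>r\<bar>)" using abs_le_exp_abs[of r] exp_abs_mono(1)[of r] by linarith
  hence "\<bar>r\<bar> * gauss_k K r \<le> gauss_wt K r"
    unfolding gauss_wt_def using K by (intro mult_right_mono gauss_k_nonneg) auto
  hence "2 * K\<^sup>2 * (\<bar>r\<bar> * gauss_k K r) \<le> 2 * K\<^sup>2 * gauss_wt K r" by (intro mult_left_mono) auto
  thus ?thesis using K gauss_k_nonneg[of K r] by (simp add: gauss_k1_def abs_mult mult_ac)
qed

lemma gauss_k2_le: "K > 0 \<Longrightarrow> \<bar>gauss_k2 K r\<bar> \<le> (4 * K ^ 4 + 2 * K\<^sup>2) * gauss_wt K r"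
proof -
  assume K: "K > 0"
  have "\<bar>4 * K ^ 4 * r\<^sup>2 - 2 * K\<^sup>2\<bar> \<le> 4 * K ^ 4 * r\<^sup>2 + 2 * K\<^sup>2 * 1"
    by (smt (verit) mult_nonneg_nonneg zero_le_power2 zero_le_even_power even_numeral)
  also have "\<dots> \<le> 4 * K ^ 4 * exp (2 * \<bar>r\<bar>) + 2 * K\<^sup>2 * exp (2 * \<bar>r\<bar>)"
    by (intro add_mono mult_left_mono power2_le_exp_abs exp_abs_mono) auto
  finally have "\<bar>4 * K ^ 4 * r\<^sup>2 - 2 * K\<^sup>2\<bar> * gauss_k K r \<le> (4 * K ^ 4 * exp (2 * \<bar>r\<bar>) + 2 * K\<^sup>2
      * exp (2 * \<bar>r\<bar>)) * gauss_k K r"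
    using K by (intro mult_right_mono gauss_k_nonneg) auto
  moreover have "\<bar>gauss_k2 K r\<bar> = \<bar>4 * K ^ 4 * r\<^sup>2 - 2 * K\<^sup>2\<bar> * gauss_k K r"
    using gauss_k_nonneg[of K r] K by (simp only: gauss_k2_def abs_mult abs_of_nonneg less_imp_le)
  ultimately show ?thesis by (simp add: gauss_wt_def algebra_simps)
qed

lemma gauss_k_le_gauss_wt: "K > 0 \<Longrightarrow> gauss_k K r \<le> gauss_wt K r"
  using mult_right_mono[OF exp_abs_mono(2)[of r] gauss_k_nonneg[of K r]] by (simp add: gauss_wt_def)

lemma cosh_le_exp_abs: "\<bar>cosh r\<bar> \<le> exp \<bar>r :: real\<bar>" "\<bar>sinh r\<bar> \<le> exp \<bar>r :: real\<bar>"
proof -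
  have e: "exp r \<le> exp \<bar>r\<bar>" "exp (- r) \<le> exp \<bar>r\<bar>" "exp r > 0" "exp (- r) > 0" by auto
  have aux: "\<bar>(a + b) / 2\<bar> \<le> c" "\<bar>(a - b) / 2\<bar> \<le> c" if "a \<le> c" "b \<le> c" "a > 0" "b > 0" for a b c :: real
    using that by auto
  show "\<bar>cosh r\<bar> \<le> exp \<bar>r\<bar>" "\<bar>sinh r\<bar> \<le> exp \<bar>r\<bar>"
    using aux[OF e] by (simp_all only: cosh_field_def sinh_field_def)
qed

text \<open>For a phase \<open>u\<close> with derivatives \<open>v\<close> and \<open>u2\<close> this is
\<open>(cos u)'' k - (cos u) k''\<close>, the derivative of \<open>(cos u)' k - (cos u) k'\<close>, with \<open>k\<close> the Gaussian.\<close>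
definition ibp_fun :: "real \<Rightarrow> real \<Rightarrow> real \<Rightarrow> real \<Rightarrow> real \<Rightarrow> real" where
  "ibp_fun K u v u2 x = (- (cos u * v\<^sup>2) - sin u * u2) * gauss_k K x - cos u * gauss_k2 K x"

lemma abs_ibp_fun_le:
  assumes K: "K > 0" and v: "\<bar>v\<bar> \<le> M" and u2: "\<bar>u2\<bar> \<le> M"
  shows "\<bar>ibp_fun K u v u2 x\<bar> \<le> (M\<^sup>2 + M) * gauss_k K x + (4 * K ^ 4 + 2 * K\<^sup>2) * gauss_wt K x"
proof -
  have "\<bar>v\<bar>\<^sup>2 \<le> M\<^sup>2" using v by (intro power_mono) auto
  hence "\<bar>cos u\<bar> * \<bar>v\<bar>\<^sup>2 \<le> 1 * M\<^sup>2" by (intro mult_mono) auto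
  moreover have "\<bar>sin u\<bar> * \<bar>u2\<bar> \<le> 1 * M" using u2 by (intro mult_mono) auto
  ultimately have "\<bar>- (cos u * v\<^sup>2) - sin u * u2\<bar> \<le> M\<^sup>2 + M"
    using abs_triangle_ineq4[of "- (cos u * v\<^sup>2)" "sin u * u2"] by (simp add: abs_mult)
  hence "\<bar>- (cos u * v\<^sup>2) - sin u * u2\<bar> * gauss_k K x \<le> (M\<^sup>2 + M) * gauss_k K x"
    using K by (intro mult_right_mono gauss_k_nonneg) auto
  moreover have "\<bar>cos u\<bar> * \<bar>gauss_k2 K x\<bar> \<le> 1 * ((4 * K ^ 4 + 2 * K\<^sup>2) * gauss_wt K x)"
    by (intro mult_mono gauss_k2_le K) auto
  moreover have "\<bar>ibp_fun K u v u2 x\<bar> \<le> \<bar>- (cos u * v\<^sup>2) - sin u * u2\<bar> * gauss_k K x + \<bar>cos u\<bar> * \<bar>gauss_k2 K x\<bar>"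
    unfolding ibp_fun_def
    using abs_triangle_ineq4[of "(- (cos u * v\<^sup>2) - sin u * u2) * gauss_k K x" "cos u * gauss_k2 K x"]
      gauss_k_nonneg[of K x] K by (simp add: abs_mult)
  ultimately show ?thesis by simp
qed

lemma integral_ibp_fun:
  fixes u v u2 :: "real \<Rightarrow> real"
  assumes K: "K > 0"
    and u: "\<And>x. (u has_real_derivative v x) (at x)" and v: "\<And>x. (v has_real_derivative u2 x) (at x)"
    and u2: "continuous_on UNIV u2"
    and v_le: "\<And>x. \<bar>v x\<bar> \<le> M * exp \<bar>x\<bar>" and u2_le: "\<And>x. \<bar>u2 x\<bar> \<le> M * exp \<bar>x\<bar>"
  shows "(\<integral>x. ibp_fun K (u x) (v x) (u2 x) x \<partial>lborel) = 0"
proof -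
  define f where "f = (\<lambda>x. - sin (u x) * v x * gauss_k K x - cos (u x) * gauss_k1 K x)"
  have M: "M \<ge> 0" using v_le[of 0] by simp
  have d: "(f has_vector_derivative ibp_fun K (u x) (v x) (u2 x) x) (at x)" for x
    unfolding f_def ibp_fun_def has_real_derivative_iff_has_vector_derivative[symmetric]
    by (auto intro!: derivative_eq_intros u v simp: power2_eq_square algebra_simps)
  have c: "continuous_on UNIV (\<lambda>x. ibp_fun K (u x) (v x) (u2 x) x)"
    unfolding ibp_fun_def
    by (intro continuous_intros u2 DERIV_continuous_on[OF has_field_derivative_at_within[OF u]]
          DERIV_continuous_on[OF has_field_derivative_at_within[OF v]])
  have b: "norm (ibp_fun K (u x) (v x) (u2 x) x)
      \<le> ((M\<^sup>2 + M + (4 * K ^ 4 + 2 * K\<^sup>2)) * (sqrt pi * K)) * exp (2 * \<bar>x\<bar> - K\<^sup>2 * x\<^sup>2)" for x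
  proof -
    have "M * exp \<bar>x\<bar> \<le> M * exp (2 * \<bar>x\<bar>)" using M by (intro mult_left_mono) auto
    hence "(M * exp \<bar>x\<bar>)\<^sup>2 + M * exp \<bar>x\<bar> \<le> (M\<^sup>2 + M) * exp (2 * \<bar>x\<bar>)"
      unfolding exp_double power_mult_distrib by (simp add: algebra_simps)
    hence "((M * exp \<bar>x\<bar>)\<^sup>2 + M * exp \<bar>x\<bar>) * gauss_k K x \<le> (M\<^sup>2 + M) * gauss_wt K x"
      unfolding gauss_wt_def mult.assoc[symmetric] using K by (intro mult_right_mono gauss_k_nonneg) auto
    hence "\<bar>ibp_fun K (u x) (v x) (u2 x) x\<bar> \<le> (M\<^sup>2 + M + (4 * K ^ 4 + 2 * K\<^sup>2)) * gauss_wt K x"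
      using abs_ibp_fun_le[OF K v_le u2_le, of "u x" x x] by (simp add: algebra_simps)
    thus ?thesis by (simp add: gauss_wt_eq mult_ac)
  qed
  have fb: "norm (f x) \<le> ((M + 2 * K\<^sup>2) * (sqrt pi * K)) * exp (2 * \<bar>x\<bar> - K\<^sup>2 * x\<^sup>2)" for x
  proof -
    have "\<bar>sin (u x)\<bar> * \<bar>v x\<bar> * gauss_k K x \<le> 1 * (M * exp (2 * \<bar>x\<bar>)) * gauss_k K x"
      using K order.trans[OF v_le mult_left_mono[OF exp_abs_mono(1) M]]
      by (intro mult_right_mono mult_mono gauss_k_nonneg) auto
    moreover have "\<bar>cos (u x)\<bar> * \<bar>gauss_k1 K x\<bar> \<le> 1 * (2 * K\<^sup>2 * gauss_wt K x)"
      by (intro mult_mono gauss_k1_le K) auto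
    moreover have "\<bar>f x\<bar> \<le> \<bar>sin (u x)\<bar> * \<bar>v x\<bar> * gauss_k K x + \<bar>cos (u x)\<bar> * \<bar>gauss_k1 K x\<bar>"
      unfolding f_def
      using abs_triangle_ineq4[of "- sin (u x) * v x * gauss_k K x" "cos (u x) * gauss_k1 K x"]
        gauss_k_nonneg[of K x] K by (simp add: abs_mult)
    ultimately have "\<bar>f x\<bar> \<le> (M + 2 * K\<^sup>2) * gauss_wt K x" by (simp add: gauss_wt_def algebra_simps)
    thus ?thesis by (simp add: gauss_wt_eq mult_ac)
  qed
  have K2: "K\<^sup>2 > 0" using K by simp
  have C: "(M + 2 * K\<^sup>2) * (sqrt pi * K) \<ge> 0" using K M by simp
  show ?thesis
    by (rule integral_deriv_eq_0[OF d c integrable_gauss_bound[OF K2 b borel_measurable_continuous_onI[OF c]]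
          gauss_bound_tendsto_0(1)[OF K2 fb C] gauss_bound_tendsto_0(2)[OF K2 fb C]])
qed

lemma sinh_sin_le: "(sinh r)\<^sup>2 + (sin w)\<^sup>2 \<le> 2 * exp (2 * \<bar>r :: real\<bar>)"
proof -
  have "\<bar>sinh r\<bar>\<^sup>2 \<le> (exp \<bar>r\<bar>)\<^sup>2" by (intro power_mono cosh_le_exp_abs) auto
  hence "(sinh r)\<^sup>2 \<le> exp (2 * \<bar>r\<bar>)" by (simp add: exp_double)
  moreover have "(sin w)\<^sup>2 \<le> 1" using abs_sin_le_one[of w] by (simp add: abs_square_le_1)
  ultimately show ?thesis using exp_abs_mono(2)[of r] by linarith
qed

context
  fixes z :: complex
begin

text \<open>The phase \<open>2 Re (z cosh (r + i w))\<close> and its partial derivatives in \<open>r\<close> and \<open>w\<close>. It is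
harmonic: its second derivatives are the phase itself and its negative.\<close>
definition osc :: "real \<Rightarrow> real \<Rightarrow> real" where
  "osc r w = 2 * (Re z * cosh r * cos w - Im z * sinh r * sin w)"
definition osc_r :: "real \<Rightarrow> real \<Rightarrow> real" where
  "osc_r r w = 2 * (Re z * sinh r * cos w - Im z * cosh r * sin w)"
definition osc_w :: "real \<Rightarrow> real \<Rightarrow> real" where
  "osc_w r w = 2 * (- Re z * cosh r * sin w - Im z * sinh r * cos w)"

lemma osc_trh: "2 * Re (z * trh r w) = osc r w"
  by (simp add: trh_def osc_def)

lemma osc_freq: "osc r w = Re (freq z r * cis w)"
  by (simp add: osc_def freq_def cosh_field_def sinh_field_def field_simps)

text \<open>The squared length of the gradient is \<open>|2 z sinh (r + i w)|^2\<close>.\<close>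
lemma grad_osc: "(osc_r r w)\<^sup>2 + (osc_w r w)\<^sup>2 = (cmod (2 * z))\<^sup>2 * ((sinh r)\<^sup>2 + (sin w)\<^sup>2)"
proof -
  have c: "(cosh r)\<^sup>2 = 1 + (sinh r)\<^sup>2" using cosh_square_eq[of r] by simp
  have cw: "(cos w)\<^sup>2 = 1 - (sin w)\<^sup>2" by (rule cos_squared_eq)
  have "(osc_r r w)\<^sup>2 + (osc_w r w)\<^sup>2 = 4 * ((Re z)\<^sup>2 + (Im z)\<^sup>2) * ((sinh r)\<^sup>2 * (cos w)\<^sup>2 + (cosh r)\<^sup>2 * (sin w)\<^sup>2)"
    by (simp add: osc_r_def osc_w_def power2_eq_square algebra_simps)
  also have "(sinh r)\<^sup>2 * (cos w)\<^sup>2 + (cosh r)\<^sup>2 * (sin w)\<^sup>2 = (sinh r)\<^sup>2 + (sin w)\<^sup>2"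
    unfolding c cw by (simp add: algebra_simps)
  also have "4 * ((Re z)\<^sup>2 + (Im z)\<^sup>2) = (cmod (2 * z))\<^sup>2" by (simp add: norm_mult power_mult_distrib cmod_power2)
  finally show ?thesis .
qed

lemma osc_bound_aux:
  assumes "\<bar>a\<bar> \<le> cmod z" "\<bar>b\<bar> \<le> cmod z" "\<bar>u\<bar> \<le> exp \<bar>r\<bar>" "\<bar>v\<bar> \<le> exp \<bar>r\<bar>" "\<bar>s\<bar> \<le> 1" "\<bar>t\<bar> \<le> 1"
  shows "\<bar>2 * (a * u * s - b * v * t)\<bar> \<le> 4 * cmod z * exp \<bar>r\<bar>"
proof -
  have "\<bar>a * u * s\<bar> \<le> cmod z * exp \<bar>r\<bar> * 1" "\<bar>b * v * t\<bar> \<le> cmod z * exp \<bar>r\<bar> * 1"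
    unfolding abs_mult by (intro mult_mono assms mult_nonneg_nonneg; simp)+
  thus ?thesis by simp
qed

lemma osc_bounds: "\<bar>osc r w\<bar> \<le> 4 * cmod z * exp \<bar>r\<bar>" "\<bar>osc_r r w\<bar> \<le> 4 * cmod z * exp \<bar>r\<bar>" "\<bar>osc_w r w\<bar>
    \<le> 4 * cmod z * exp \<bar>r\<bar>"
  unfolding osc_def osc_r_def osc_w_def
  by (intro osc_bound_aux cosh_le_exp_abs; simp add: abs_Re_le_cmod abs_Im_le_cmod)+

lemma osc_deriv_r: "((\<lambda>r. osc r w) has_real_derivative osc_r r w) (at r)"
  unfolding osc_def osc_r_def by (auto intro!: derivative_eq_intros simp: algebra_simps)
lemma osc_r_deriv_r: "((\<lambda>r. osc_r r w) has_real_derivative osc r w) (at r)"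
  unfolding osc_def osc_r_def by (auto intro!: derivative_eq_intros simp: algebra_simps)
lemma osc_deriv_w: "((\<lambda>w. osc r w) has_real_derivative osc_w r w) (at w)"
  unfolding osc_def osc_w_def by (auto intro!: derivative_eq_intros simp: algebra_simps)
lemma osc_w_deriv_w: "((\<lambda>w. osc_w r w) has_real_derivative - osc r w) (at w)"
  unfolding osc_def osc_w_def by (auto intro!: derivative_eq_intros simp: algebra_simps)

lemma continuous_on_osc [continuous_intros]:
  fixes f g :: "'x::t2_space \<Rightarrow> real"
  assumes "continuous_on A f" "continuous_on A g"
  shows "continuous_on A (\<lambda>x. osc (f x) (g x))" "continuous_on A (\<lambda>x. osc_r (f x) (g x))" "continuous_on
      A (\<lambda>x. osc_w (f x) (g x))"
  unfolding osc_def osc_r_def osc_w_def using assms by (auto intro!: continuous_intros)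

text \<open>The exact derivatives to be integrated in the variables \<open>r\<close> and \<open>w\<close>.\<close>
definition ibp_r :: "real \<Rightarrow> real \<Rightarrow> real \<Rightarrow> real" where
  "ibp_r K r w = ibp_fun K (osc r w) (osc_r r w) (osc r w) r"
definition ibp_w :: "real \<Rightarrow> real \<Rightarrow> real \<Rightarrow> real" where
  "ibp_w P r w = ibp_fun P (osc r w) (osc_w r w) (- osc r w) w"

text \<open>A constant for which the first and second derivatives of the cosine of the phase are bounded
by the constant times \<open>e^{2 |r|}\<close>.\<close>
definition osc_const :: real where "osc_const = (4 * cmod z)\<^sup>2 + 4 * cmod z"

lemma osc_const_nonneg: "osc_const \<ge> 0" by (simp add: osc_const_def)

lemma osc_const_ge: "(4 * cmod z * exp \<bar>r\<bar>)\<^sup>2 + 4 * cmod z * exp \<bar>r\<bar> \<le> osc_const * exp (2 * \<bar>r\<bar>)"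
proof -
  have "4 * cmod z * exp \<bar>r\<bar> \<le> 4 * cmod z * exp (2 * \<bar>r\<bar>)" by (intro mult_left_mono) auto
  thus ?thesis unfolding osc_const_def exp_double power_mult_distrib by (simp add: algebra_simps)
qed

lemma ibp_r_bound:
  assumes K: "K > 0" shows "\<bar>ibp_r K r w\<bar> \<le> (osc_const + (4 * K ^ 4 + 2 * K\<^sup>2)) * gauss_wt K r"
  using abs_ibp_fun_le[OF K osc_bounds(2) osc_bounds(1), of "osc r w" r w w r]
    mult_right_mono[OF osc_const_ge[of r] gauss_k_nonneg[of K r]] K
  by (simp add: ibp_r_def gauss_wt_def algebra_simps)

lemma ibp_w_bound:
  assumes P: "P > 0" shows "\<bar>ibp_w P r w\<bar> \<le> (osc_const + (4 * P ^ 4 + 2 * P\<^sup>2)) * exp (2 * \<bar>r\<bar>) * gauss_wt P w"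
proof -
  let ?M = "4 * cmod z * exp \<bar>r\<bar>"
  have "\<bar>ibp_w P r w\<bar> \<le> (?M\<^sup>2 + ?M) * gauss_k P w + (4 * P ^ 4 + 2 * P\<^sup>2) * gauss_wt P w"
    unfolding ibp_w_def by (rule abs_ibp_fun_le[OF P osc_bounds(3)]) (simp add: osc_bounds(1))
  also have "\<dots> \<le> (osc_const * exp (2 * \<bar>r\<bar>)) * gauss_wt P w + (4 * P ^ 4 + 2 * P\<^sup>2) * (exp (2 * \<bar>r\<bar>) * gauss_wt P w)"
    using osc_const_nonneg P gauss_wt_nonneg[of P w] mult_right_mono[OF exp_abs_mono(2)[of r] gauss_wt_nonneg[of P w]]
    by (intro add_mono mult_mono mult_left_mono osc_const_ge gauss_k_le_gauss_wt gauss_k_nonneg) auto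
  finally show ?thesis by (simp add: algebra_simps)
qed

lemma integral_ibp_r:
  assumes K: "K > 0" shows "(\<integral>r. ibp_r K r w \<partial>lborel) = 0"
  unfolding ibp_r_def
  by (rule integral_ibp_fun[OF K osc_deriv_r osc_r_deriv_r _ osc_bounds(2) osc_bounds(1)])
     (intro continuous_intros)

lemma integral_ibp_w:
  assumes P: "P > 0" shows "(\<integral>w. ibp_w P r w \<partial>lborel) = 0"
  unfolding ibp_w_def
proof (rule integral_ibp_fun[OF P osc_deriv_w osc_w_deriv_w])
  let ?M = "4 * cmod z * exp \<bar>r\<bar>"
  have "?M \<le> ?M * exp \<bar>w\<bar>" for w :: real
    using mult_left_mono[of 1 "exp \<bar>w\<bar>" ?M] by simp
  thus "\<bar>osc_w r w\<bar> \<le> ?M * exp \<bar>w\<bar>" "\<bar>- osc r w\<bar> \<le> ?M * exp \<bar>w\<bar>" for w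
    using order.trans[OF osc_bounds(3)] order.trans[OF osc_bounds(1)] by simp_all
qed (intro continuous_intros)

text \<open>The integrand of the unfolded dual side, and the product of the cosine of the phase with the
negative Laplacian of the Gaussian.\<close>
definition dens0 :: "real \<Rightarrow> real \<Rightarrow> real \<Rightarrow> real \<Rightarrow> real" where
  "dens0 K P r w = cos (osc r w) * ((sinh r)\<^sup>2 + (sin w)\<^sup>2) * gauss_k K r * gauss_k P w"
definition dens1 :: "real \<Rightarrow> real \<Rightarrow> real \<Rightarrow> real \<Rightarrow> real" where
  "dens1 K P r w = cos (osc r w) * - (gauss_k2 K r * gauss_k P w + gauss_k K r * gauss_k2 P w)"

text \<open>The identity behind the integration by parts; the terms that contain the second derivatives of
the phase cancel, as the phase is harmonic.\<close>
lemma dens0_eq: "(cmod (2 * z))\<^sup>2 * dens0 K P r w = dens1 K P r w - ibp_r K r w * gauss_k P w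
    - ibp_w P r w * gauss_k K r"
proof -
  have "(cmod (2 * z))\<^sup>2 * dens0 K P r w = cos (osc r w) * ((osc_r r w)\<^sup>2 + (osc_w r w)\<^sup>2) * gauss_k K r
      * gauss_k P w"
    unfolding grad_osc dens0_def by (simp add: mult_ac)
  also have "\<dots> = dens1 K P r w - ibp_r K r w * gauss_k P w - ibp_w P r w * gauss_k K r"
    by (simp add: dens1_def ibp_r_def ibp_w_def ibp_fun_def algebra_simps)
  finally show ?thesis .
qed

lemma integrable_pair_gauss_wt:
  fixes f :: "real \<Rightarrow> real \<Rightarrow> real"
  assumes K: "K > 0" and P: "P > 0" and c: "continuous_on UNIV (\<lambda>x. f (fst x) (snd x))"
    and b: "\<And>r w. \<bar>f r w\<bar> \<le> C * gauss_wt K r * gauss_wt P w"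
  shows "integrable (lborel \<Otimes>\<^sub>M lborel) (\<lambda>(r, w). f r w)"
proof (rule lborel_pair.integrable_prod_bound)
  show "(\<lambda>(r, w). f r w) \<in> borel_measurable (lborel \<Otimes>\<^sub>M lborel)"
    using borel_measurable_continuous_onI[OF c] by (simp add: lborel_prod case_prod_unfold)
  show "integrable lborel (\<lambda>r. C * gauss_wt K r)" "integrable lborel (gauss_wt P)"
    using integrable_gauss_wt K P by auto
qed (use b in auto)

lemma
  assumes K: "K > 0" and P: "P > 0"
  shows integrable_dens1: "integrable (lborel \<Otimes>\<^sub>M lborel) (\<lambda>(r, w). dens1 K P r w)"
    and integral_dens0_dens1: "(cmod (2 * z))\<^sup>2 * (\<integral>r. (\<integral>w. dens0 K P r w \<partial>lborel) \<partial>lborel)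
        = (\<integral>r. (\<integral>w. dens1 K P r w \<partial>lborel) \<partial>lborel)"
proof -
  note nn = gauss_wt_nonneg[OF less_imp_le[OF K]] gauss_wt_nonneg[OF less_imp_le[OF P]]
      gauss_k_nonneg[OF less_imp_le[OF K]] gauss_k_nonneg[OF less_imp_le[OF P]]
  have i0: "integrable (lborel \<Otimes>\<^sub>M lborel) (\<lambda>(r, w). dens0 K P r w)"
  proof (rule integrable_pair_gauss_wt[OF K P, where C = 2])
    show "continuous_on UNIV (\<lambda>x. dens0 K P (fst x) (snd x))" unfolding dens0_def by (intro continuous_intros)
    fix r w :: real
    have "\<bar>cos (osc r w)\<bar> * ((sinh r)\<^sup>2 + (sin w)\<^sup>2) * gauss_k K r * gauss_k P w \<le> 1 * (2 * exp (2
        * \<bar>r\<bar>)) * gauss_k K r * gauss_wt P w"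
      using nn sinh_sin_le[of r w] by (intro mult_mono mult_right_mono gauss_k_le_gauss_wt P) auto
    thus "\<bar>dens0 K P r w\<bar> \<le> 2 * gauss_wt K r * gauss_wt P w" using nn
        by (simp add: dens0_def abs_mult gauss_wt_def mult_ac)
  qed
  show i1: "integrable (lborel \<Otimes>\<^sub>M lborel) (\<lambda>(r, w). dens1 K P r w)"
  proof (rule integrable_pair_gauss_wt[OF K P, where C = "(4 * K ^ 4 + 2 * K\<^sup>2) + (4 * P ^ 4 + 2 * P\<^sup>2)"])
    show "continuous_on UNIV (\<lambda>x. dens1 K P (fst x) (snd x))" unfolding dens1_def by (intro continuous_intros)
    fix r w :: real
    have "\<bar>gauss_k2 K r\<bar> * gauss_k P w \<le> (4 * K ^ 4 + 2 * K\<^sup>2) * gauss_wt K r * gauss_wt P w"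
      using nn by (intro mult_mono gauss_k2_le gauss_k_le_gauss_wt K P) auto
    moreover have "gauss_k K r * \<bar>gauss_k2 P w\<bar> \<le> gauss_wt K r * ((4 * P ^ 4 + 2 * P\<^sup>2) * gauss_wt P w)"
      using nn by (intro mult_mono gauss_k2_le gauss_k_le_gauss_wt K P) auto
    moreover have "\<bar>gauss_k2 K r * gauss_k P w + gauss_k K r * gauss_k2 P w\<bar> \<le> \<bar>gauss_k2 K r\<bar>
        * gauss_k P w + gauss_k K r * \<bar>gauss_k2 P w\<bar>"
      using abs_triangle_ineq[of "gauss_k2 K r * gauss_k P w" "gauss_k K r * gauss_k2 P w"] nn by (simp add: abs_mult)
    moreover have "\<bar>dens1 K P r w\<bar> \<le> 1 * \<bar>gauss_k2 K r * gauss_k P w + gauss_k K r * gauss_k2 P w\<bar>"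
      unfolding dens1_def abs_mult abs_minus_cancel by (intro mult_right_mono) auto
    ultimately show "\<bar>dens1 K P r w\<bar> \<le> ((4 * K ^ 4 + 2 * K\<^sup>2) + (4 * P ^ 4 + 2 * P\<^sup>2)) * gauss_wt K r * gauss_wt P w"
      by (simp add: algebra_simps)
  qed
  have j1: "integrable (lborel \<Otimes>\<^sub>M lborel) (\<lambda>(r, w). ibp_r K r w * gauss_k P w)"
  proof (rule integrable_pair_gauss_wt[OF K P, where C = "osc_const + (4 * K ^ 4 + 2 * K\<^sup>2)"])
    show "continuous_on UNIV (\<lambda>x. ibp_r K (fst x) (snd x)
        * gauss_k P (snd x))" unfolding ibp_r_def ibp_fun_def by (intro continuous_intros)
    fix r w :: real
    have "\<bar>ibp_r K r w\<bar> * gauss_k P w \<le> (osc_const + (4 * K ^ 4 + 2 * K\<^sup>2)) * gauss_wt K r * gauss_wt P w"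
      using nn osc_const_nonneg by (intro mult_mono ibp_r_bound gauss_k_le_gauss_wt K P) auto
    thus "\<bar>ibp_r K r w * gauss_k P w\<bar> \<le> (osc_const + (4 * K ^ 4 + 2 * K\<^sup>2)) * gauss_wt K r * gauss_wt P w"
      using nn by (simp add: abs_mult)
  qed
  have j2: "integrable (lborel \<Otimes>\<^sub>M lborel) (\<lambda>(r, w). ibp_w P r w * gauss_k K r)"
  proof (rule integrable_pair_gauss_wt[OF K P, where C = "osc_const + (4 * P ^ 4 + 2 * P\<^sup>2)"])
    show "continuous_on UNIV (\<lambda>x. ibp_w P (fst x) (snd x)
        * gauss_k K (fst x))" unfolding ibp_w_def ibp_fun_def by (intro continuous_intros)
    fix r w :: real
    have "\<bar>ibp_w P r w\<bar> * gauss_k K r \<le> (osc_const + (4 * P ^ 4 + 2 * P\<^sup>2)) * exp (2 * \<bar>r\<bar>)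
        * gauss_wt P w * gauss_k K r"
      using nn by (intro mult_right_mono ibp_w_bound P) auto
    thus "\<bar>ibp_w P r w * gauss_k K r\<bar> \<le> (osc_const + (4 * P ^ 4 + 2 * P\<^sup>2)) * gauss_wt K r * gauss_wt P w"
      using nn by (simp add: abs_mult gauss_wt_def mult_ac)
  qed
  have z1: "(\<integral>(r, w). ibp_r K r w * gauss_k P w \<partial>(lborel \<Otimes>\<^sub>M lborel)) = 0"
    using lborel_pair.integral_snd[OF j1] integral_ibp_r[OF K] by simp
  have z2: "(\<integral>(r, w). ibp_w P r w * gauss_k K r \<partial>(lborel \<Otimes>\<^sub>M lborel)) = 0"
    using lborel_pair.integral_fst[OF j2] integral_ibp_w[OF P] by simp
  have "(cmod (2 * z))\<^sup>2 * (\<integral>r. (\<integral>w. dens0 K P r w \<partial>lborel) \<partial>lborel) = (cmod (2 * z))\<^sup>2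
      * (\<integral>(r, w). dens0 K P r w \<partial>(lborel \<Otimes>\<^sub>M lborel))"
    using lborel_pair.integral_fst[OF i0] by simp
  also have "\<dots> = (\<integral>x. (case x of (r, w) \<Rightarrow> dens1 K P r w) - (case x of (r, w) \<Rightarrow> ibp_r K r w
      * gauss_k P w) - (case x of (r, w) \<Rightarrow> ibp_w P r w * gauss_k K r) \<partial>(lborel \<Otimes>\<^sub>M lborel))"
    unfolding integral_mult_right_zero[symmetric]
    by (intro Bochner_Integration.integral_cong refl) (simp only: split_paired_all split dens0_eq)
  also have "\<dots> = (\<integral>(r, w). dens1 K P r w \<partial>(lborel \<Otimes>\<^sub>M lborel))"
    unfolding Bochner_Integration.integral_diff[OF Bochner_Integration.integrable_diff[OF i1 j1] j2]
      Bochner_Integration.integral_diff[OF i1 j1] z1 z2 by simp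
  also have "\<dots> = (\<integral>r. (\<integral>w. dens1 K P r w \<partial>lborel) \<partial>lborel)"
    using lborel_pair.integral_fst[OF i1] by simp
  finally show "(cmod (2 * z))\<^sup>2 * (\<integral>r. (\<integral>w. dens0 K P r w \<partial>lborel) \<partial>lborel)
      = (\<integral>r. (\<integral>w. dens1 K P r w \<partial>lborel) \<partial>lborel)" .
qed

end

section \<open>Comparison of the two sides\<close>

text \<open>The Fourier transform of \<open>(\<kappa>^2 + p^2) e^{-(\<kappa>/K)^2}\<close>, with \<open>c\<close> in place of \<open>p^2\<close>, is
\<open>p^2 k - k''/4\<close>, where \<open>k\<close> is the Gaussian in \<open>r\<close> with parameter \<open>K\<close>.\<close>
lemma gauss_k2_fourier:
  assumes K: "K > 0"
  shows "integrable lborel (\<lambda>x. of_real (exp (- (x / K)\<^sup>2)) * (of_real (x\<^sup>2 + c) * cis (2 * r * x)))"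
    and "(\<integral>x. of_real (exp (- (x / K)\<^sup>2)) * (of_real (x\<^sup>2 + c) * cis (2 * r * x)) \<partial>lborel)
        = complex_of_real (c * gauss_k K r - gauss_k2 K r / 4)"
proof -
  define a where "a = 1 / K\<^sup>2"
  have a: "a > 0" using K by (simp add: a_def)
  have eq: "of_real (exp (- (x / K)\<^sup>2)) * (of_real (x\<^sup>2 + c) * cis (2 * r * x))
     = of_real (x\<^sup>2 * exp (- a * x\<^sup>2)) * cis (2 * r * x) + of_real c * (of_real (exp (- a * x\<^sup>2))
         * cis (2 * r * x))" for x
    by (simp add: a_def power_divide algebra_simps)
  note i2 = integrable_gauss2_cis[OF a, of "2 * r"] and i0 = integrable_gauss_cis[OF a, of "2 * r"]
  show "integrable lborel (\<lambda>x. of_real (exp (- (x / K)\<^sup>2)) * (of_real (x\<^sup>2 + c) * cis (2 * r * x)))"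
    unfolding eq by (intro Bochner_Integration.integrable_add integrable_mult_right i2 i0)
  have g: "sqrt (pi / a) * exp (- (2 * r)\<^sup>2 / (4 * a)) = gauss_k K r"
    using K by (simp add: a_def gauss_k_def real_sqrt_mult power_mult_distrib mult_ac)
  have h: "1 / (2 * a) - (2 * r)\<^sup>2 / (4 * a\<^sup>2) = K\<^sup>2 / 2 - K ^ 4 * r\<^sup>2"
    using K by (simp add: a_def power2_eq_square power4_eq_xxxx field_simps)
  have "(\<integral>x. of_real (exp (- (x / K)\<^sup>2)) * (of_real (x\<^sup>2 + c) * cis (2 * r * x)) \<partial>lborel)
    = of_real (gauss_k K r * (K\<^sup>2 / 2 - K ^ 4 * r\<^sup>2)) + of_real c * of_real (gauss_k K r)"
    unfolding eq Bochner_Integration.integral_add[OF i2 integrable_mult_right[OF i0]] integral_mult_right_zero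
      integral_gauss2_cis[OF a] integral_gauss_cis[OF a] g h ..
  also have "\<dots> = of_real (gauss_k K r * (K\<^sup>2 / 2 - K ^ 4 * r\<^sup>2) + c * gauss_k K r)"
    by (simp only: of_real_add of_real_mult)
  also have "gauss_k K r * (K\<^sup>2 / 2 - K ^ 4 * r\<^sup>2) + c * gauss_k K r = c * gauss_k K r - gauss_k2 K r / 4"
    by (simp add: gauss_k2_def field_simps)
  finally show "(\<integral>x. of_real (exp (- (x / K)\<^sup>2)) * (of_real (x\<^sup>2 + c) * cis (2 * r * x)) \<partial>lborel)
      = complex_of_real (c * gauss_k K r - gauss_k2 K r / 4)" .
qed

lemma gk_dual_fourier:
  fixes A B P :: real
  assumes P: "P > 0"
  defines "W \<equiv> \<lambda>\<omega>. - (B * gauss_k P \<omega> + A * gauss_k2 P \<omega>)"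
  shows "integrable lborel W"
    and "(\<integral>\<omega>. of_real (W \<omega>) * cis (of_int m * \<omega>) \<partial>lborel) = complex_of_real (pi
        * exp (- (of_int m)\<^sup>2 / (4 * P\<^sup>2)) * ((of_int m)\<^sup>2 * A - B))"
proof -
  define a where "a = P\<^sup>2"
  define C where "C = sqrt pi * P"
  have a: "a > 0" using P by (simp add: a_def)
  define f0 where "f0 = (\<lambda>x. complex_of_real (exp (- a * x\<^sup>2)) * cis (of_int m * x))"
  define f2 where "f2 = (\<lambda>x. complex_of_real (x\<^sup>2 * exp (- a * x\<^sup>2)) * cis (of_int m * x))"
  have W: "of_real (W x) * cis (of_int m * x) = of_real (C * (2 * P\<^sup>2 * A - B)) * f0 x + of_real (- C
      * A * 4 * P ^ 4) * f2 x" for x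
  proof -
    have W': "W x = C * (2 * P\<^sup>2 * A - B) * exp (- a * x\<^sup>2) + (- C * A * 4 * P ^ 4) * (x\<^sup>2 * exp (- a * x\<^sup>2))"
      by (simp add: W_def gauss_k2_def gauss_k_def C_def a_def power_mult_distrib algebra_simps)
    show ?thesis unfolding W' f0_def f2_def of_real_add of_real_mult[of "C * (2 * P\<^sup>2 * A - B)"]
        of_real_mult[of "- C * A * 4 * P ^ 4"] distrib_right by (simp only: mult.assoc)
  qed
  have i: "integrable lborel f0" "integrable lborel f2"
    unfolding f0_def f2_def by (rule integrable_gauss_cis[OF a] integrable_gauss2_cis[OF a])+
  have "(\<integral>\<omega>. of_real (W \<omega>) * cis (of_int m * \<omega>) \<partial>lborel) = of_real (C * (2 * P\<^sup>2 * A - B))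
      * (\<integral>x. f0 x \<partial>lborel) + of_real (- C * A * 4 * P ^ 4) * (\<integral>x. f2 x \<partial>lborel)"
    unfolding W using i by simp
  also have "\<dots> = of_real (C * (2 * P\<^sup>2 * A - B) * (sqrt (pi / a) * exp (- (of_int m)\<^sup>2 / (4 * a)))
      + (- C * A * 4 * P ^ 4) * (sqrt (pi / a) * exp (- (of_int m)\<^sup>2 / (4 * a)) * (1 / (2 * a)
          - (of_int m)\<^sup>2 / (4 * a\<^sup>2))))"
    unfolding f0_def f2_def integral_gauss2_cis[OF a] integral_gauss_cis[OF a] by simp
  also have "C * (2 * P\<^sup>2 * A - B) * (sqrt (pi / a) * exp (- (of_int m)\<^sup>2 / (4 * a)))
      + (- C * A * 4 * P ^ 4) * (sqrt (pi / a) * exp (- (of_int m)\<^sup>2 / (4 * a)) * (1 / (2 * a)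
          - (of_int m)\<^sup>2 / (4 * a\<^sup>2)))
     = (C * sqrt (pi / a)) * exp (- (of_int m)\<^sup>2 / (4 * a)) * ((2 * P\<^sup>2 * A - B) - A * (4 * P ^ 4
         * (1 / (2 * a) - (of_int m)\<^sup>2 / (4 * a\<^sup>2))))"
    by (simp add: algebra_simps)
  also have "C * sqrt (pi / a) = pi"
    using P by (simp add: C_def a_def real_sqrt_divide)
  also have "4 * P ^ 4 * (1 / (2 * a) - (of_int m)\<^sup>2 / (4 * a\<^sup>2)) = 2 * P\<^sup>2 - (of_int m)\<^sup>2"
    using P by (simp add: a_def power2_eq_square power4_eq_xxxx field_simps)
  also have "(2 * P\<^sup>2 * A - B) - A * (2 * P\<^sup>2 - (of_int m)\<^sup>2) = (of_int m)\<^sup>2 * A - B" by (simp add: algebra_simps)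
  finally show "(\<integral>\<omega>. of_real (W \<omega>) * cis (of_int m * \<omega>) \<partial>lborel) = complex_of_real (pi
      * exp (- (of_int m)\<^sup>2 / (4 * P\<^sup>2)) * ((of_int m)\<^sup>2 * A - B))"
    by (simp add: a_def)
  show "integrable lborel W"
  proof (rule lborel_integrable_boundI)
    show "W \<in> borel_measurable borel"
      unfolding W_def by (intro borel_measurable_continuous_onI continuous_intros)
    show "integrable lborel (\<lambda>x. (\<bar>B\<bar> + \<bar>A\<bar> * (4 * P ^ 4 + 2 * P\<^sup>2)) * gauss_wt P x)"
      by (intro integrable_mult_right integrable_gauss_wt P)
    fix x
    have "\<bar>W x\<bar> \<le> \<bar>B\<bar> * gauss_k P x + \<bar>A\<bar> * \<bar>gauss_k2 P x\<bar>"
      unfolding W_def abs_minus_cancel using abs_triangle_ineq[of "B * gauss_k P x" "A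
          * gauss_k2 P x"] gauss_k_nonneg[of P x] P
      by (simp add: abs_mult)
    also have "\<dots> \<le> \<bar>B\<bar> * gauss_wt P x + \<bar>A\<bar> * ((4 * P ^ 4 + 2 * P\<^sup>2) * gauss_wt P x)"
      by (intro add_mono mult_left_mono gauss_k_le_gauss_wt gauss_k2_le P) auto
    finally show "norm (W x) \<le> (\<bar>B\<bar> + \<bar>A\<bar> * (4 * P ^ 4 + 2 * P\<^sup>2)) * gauss_wt P x" by (simp add: algebra_simps)
  qed
qed

context
  fixes z :: complex and K P :: real
begin

text \<open>The Fourier transform in the angular variable, at frequency \<open>m\<close>, of the negative Laplacian
of the Gaussian.\<close>
definition dual_coeff :: "real \<Rightarrow> int \<Rightarrow> complex" where
  "dual_coeff r m = complex_of_real (pi * exp (- (of_int m)\<^sup>2 / (4 * P\<^sup>2)) * ((of_int m)\<^sup>2 * gauss_k K r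
      - gauss_k2 K r))"

text \<open>The integrand on \<open>(\<real> \<times> \<int>) \<times> \<real>\<close> whose integral over \<open>r\<close> is the integrand of the
spectral side.\<close>
definition joint :: "(real \<times> int) \<times> real \<Rightarrow> complex" where
  "joint = (\<lambda>((\<kappa>, p), r). of_real (gauss_h K P \<kappa> p) * (4 * of_real pi * (exp (2 * (\<i> * of_real \<kappa>)
      * of_real r) * acoeff (2 * p) (freq z r))) * of_real (\<kappa>\<^sup>2 + (of_int p)\<^sup>2))"

text \<open>The factor of the dual integrand that multiplies the theta function.\<close>
definition dual_factor :: "real \<Rightarrow> real \<Rightarrow> real" where
  "dual_factor r w = cos (osc z r w) * ((sinh r)\<^sup>2 + (sin w)\<^sup>2) * gauss_k K r"

context
  assumes z: "z \<noteq> 0" and K: "K > 0" and P: "P > 0"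
begin

lemma dens1_has_sum: "((\<lambda>p. acoeff (2 * p) (freq z r) * dual_coeff r (- (2 * p)))
    has_sum of_real (\<integral>w. dens1 z K P r w \<partial>lborel)) UNIV"
proof -
  have "((\<lambda>p. acoeff (2 * p) (freq z r) * dual_coeff r (- (2 * p))) has_sum
     (\<integral>w. of_real (cos (Re (freq z r * cis w)) * - (gauss_k2 K r * gauss_k P w + gauss_k K r
         * gauss_k2 P w)) \<partial>lborel)) UNIV"
    unfolding dual_coeff_def by (rule has_sum_cos_acoeff[OF gk_dual_fourier[OF P]])
  thus ?thesis by (simp only: osc_freq[symmetric] dens1_def[symmetric] integral_complex_of_real)
qed

lemma sigma_finite_mu_A: "sigma_finite_measure mu_A"
proof -
  interpret N: sigma_finite_measure "count_space (UNIV :: int set)"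
    by (rule sigma_finite_measure_count_space)
  interpret pair_sigma_finite "lborel :: real measure" "count_space (UNIV :: int set)" ..
  show ?thesis unfolding mu_A_def by unfold_locales
qed

lemma joint_measurable: "joint \<in> borel_measurable (mu_A \<Otimes>\<^sub>M lborel)"
proof -
  define F where "F = (\<lambda>(p::int) (x :: (real \<times> int) \<times> real). complex_of_real (gauss_h K P (fst (fst x))
      p) * (4 * of_real pi * (exp (2 * (\<i> * of_real (fst (fst x))) * of_real (snd x)) * acoeff (2
      * p) (freq z (snd x)))) * of_real ((fst (fst x))\<^sup>2 + (of_int p)\<^sup>2))"
  note [measurable] = borel_measurable_acoeff_freq[OF z]
  have [measurable]: "(\<lambda>x. fst (fst x)) \<in> borel_measurable (mu_A \<Otimes>\<^sub>M (lborel :: real measure))"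
    unfolding mu_A_def by measurable
  have [measurable]: "snd \<in> borel_measurable (mu_A \<Otimes>\<^sub>M (lborel :: real measure))"
    using measurable_snd[of mu_A "lborel :: real measure"] by simp
  have "F p \<in> borel_measurable (mu_A \<Otimes>\<^sub>M lborel)" for p
    unfolding F_def gauss_h_def by measurable
  moreover have "(\<lambda>x. snd (fst x)) \<in> measurable (mu_A \<Otimes>\<^sub>M (lborel :: real measure)) (count_space UNIV)"
    unfolding mu_A_def by measurable
  ultimately have "(\<lambda>x. F (snd (fst x)) x) \<in> borel_measurable (mu_A \<Otimes>\<^sub>M lborel)"
    by (rule measurable_compose_countable)
  thus ?thesis by (simp add: F_def joint_def case_prod_unfold)
qed

lemma gauss_h_eq: "gauss_h K P \<kappa> p = exp (- (\<kappa> / K)\<^sup>2) * exp (- (of_int p / P)\<^sup>2)"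
  by (simp add: gauss_h_def exp_diff exp_minus divide_inverse)

lemma joint_integrable: "integrable (mu_A \<Otimes>\<^sub>M lborel) joint"
proof -
  interpret A: sigma_finite_measure mu_A by (rule sigma_finite_mu_A)
  interpret AL: pair_sigma_finite mu_A "lborel :: real measure" ..
  interpret N: sigma_finite_measure "count_space (UNIV :: int set)"
    by (rule sigma_finite_measure_count_space)
  interpret LN: pair_sigma_finite "lborel :: real measure" "count_space (UNIV :: int set)" ..
  note decay_const = decay_const_nonneg[of z]
  define g where "g = (\<lambda>(\<kappa>, p). gauss_h K P \<kappa> p * (4 * pi * (decay_const z * (1 + \<bar>of_int (2 * p)\<bar>)))
      * (\<kappa>\<^sup>2 + (of_int p)\<^sup>2))"
  define g1 where "g1 = (\<lambda>\<kappa>. (8 * pi * decay_const z) * exp (2 * \<bar>\<kappa>\<bar> - (1 / K\<^sup>2) * \<kappa>\<^sup>2))"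
  define g2 where "g2 = (\<lambda>p::int. exp (4 * \<bar>of_int p\<bar> - (1 / P\<^sup>2) * (of_int p)\<^sup>2))"
  have "integrable mu_A g"
    unfolding mu_A_def
  proof (rule LN.integrable_prod_bound)
    have "(\<lambda>x. g (fst x, p)) \<in> borel_measurable (lborel \<Otimes>\<^sub>M count_space UNIV)" for p
      unfolding g_def gauss_h_def split by measurable
    hence "(\<lambda>x. (\<lambda>p x. g (fst x, p)) (snd x) x) \<in> borel_measurable (lborel \<Otimes>\<^sub>M count_space UNIV)"
      by (rule measurable_compose_countable) measurable
    thus "g \<in> borel_measurable (lborel \<Otimes>\<^sub>M count_space UNIV)" by simp
    show "integrable lborel g1"
      unfolding g1_def using K by (intro integrable_mult_right integrable_exp_gauss) auto
    have "(\<lambda>p::int. exp ((4 + 1)\<^sup>2 / (4 * (1 / P\<^sup>2))) * exp ((- 1) * \<bar>of_int p\<bar>)) summable_on UNIV"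
      by (intro summable_on_cmult_right summable_on_exp_int) auto
    hence "g2 summable_on UNIV"
      by (rule summable_on_comparison_real) (use exp_gauss_le[of "1 / P\<^sup>2" 4] P in \<open>auto simp: g2_def\<close>)
    thus "integrable (count_space UNIV) g2"
      unfolding integrable_count_space_iff by (simp add: g2_def)
    fix \<kappa> :: real and p :: int
    define E where "E = exp (2 * \<bar>\<kappa>\<bar>)"
    define F where "F = exp (2 * \<bar>real_of_int p\<bar>)"
    have EF: "E \<ge> 1" "F \<ge> 1" by (auto simp: E_def F_def)
    have 1: "1 + \<bar>real_of_int (2 * p)\<bar> \<le> F" unfolding F_def
      using exp_ge_add_one_self[of "2 * \<bar>real_of_int p\<bar>"] by (simp add: abs_mult)
    have "\<kappa>\<^sup>2 + (of_int p)\<^sup>2 \<le> E + F" unfolding E_def F_def by (intro add_mono power2_le_exp_abs)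
    also have "\<dots> \<le> E * F + E * F" using EF by (intro add_mono) (auto simp: mult_le_cancel_left1 mult_le_cancel_right1)
    finally have 2: "\<kappa>\<^sup>2 + (of_int p)\<^sup>2 \<le> 2 * (E * F)" by simp
    have "norm (g (\<kappa>, p)) = gauss_h K P \<kappa> p * (4 * pi * (decay_const z * (1 + \<bar>of_int (2 * p)\<bar>))) * (\<kappa>\<^sup>2
        + (of_int p)\<^sup>2)"
      using decay_const by (simp add: g_def gauss_h_def abs_mult)
    also have "\<dots> \<le> gauss_h K P \<kappa> p * (4 * pi * (decay_const z * F)) * (2 * (E * F))"
      using decay_const 1 2 EF by (intro mult_mono mult_left_mono) (auto simp: gauss_h_def)
    also have "\<dots> = ((8 * pi * decay_const z) * (E * exp (- (\<kappa> / K)\<^sup>2))) * (F * F * exp (- (of_int p / P)\<^sup>2))"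
      unfolding gauss_h_eq by simp
    also have "E * exp (- (\<kappa> / K)\<^sup>2) = exp (2 * \<bar>\<kappa>\<bar> - (1 / K\<^sup>2) * \<kappa>\<^sup>2)"
      unfolding E_def exp_add[symmetric] by (simp add: power_divide)
    also have "F * F * exp (- (of_int p / P)\<^sup>2) = g2 p"
      unfolding F_def g2_def exp_add[symmetric] by (simp add: power_divide)
    finally show "norm (g (\<kappa>, p)) \<le> g1 \<kappa> * g2 p" by (simp add: g1_def)
  qed
  thus ?thesis
  proof (rule AL.integrable_prod_bound[OF joint_measurable])
    show "integrable lborel (\<lambda>r::real. exp ((- 1 / 3) * \<bar>r\<bar>))" by (rule integrable_exp_abs) simp
    fix x :: "real \<times> int" and r :: real
    obtain \<kappa> p where x: "x = (\<kappa>, p)" by (cases x)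
    have "norm (joint (x, r)) = gauss_h K P \<kappa> p * (4 * pi * norm (acoeff (2 * p) (freq z r))) * (\<kappa>\<^sup>2 + (of_int p)\<^sup>2)"
      unfolding joint_def x split norm_mult norm_of_real by (simp add: gauss_h_def)
    also have "\<dots> \<le> gauss_h K P \<kappa> p * (4 * pi * (decay_const z * (1 + \<bar>of_int (2 * p)\<bar>) * exp ((- 1 / 3)
        * \<bar>r\<bar>))) * (\<kappa>\<^sup>2 + (of_int p)\<^sup>2)"
      by (intro mult_right_mono mult_left_mono norm_acoeff_freq_le z) (auto simp: gauss_h_def)
    finally show "norm (joint (x, r)) \<le> g x * exp ((- 1 / 3) * \<bar>r\<bar>)"
      by (simp only: g_def x split mult_ac)
  qed
qed

lemma joint_integral_r:
  assumes "\<kappa> \<noteq> 0"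
  shows "(\<integral>r. joint ((\<kappa>, p), r) \<partial>lborel) = H_integrand K P z (\<kappa>, p)"
  unfolding joint_def H_integrand_def split bold_J_eq_integral[OF z assms]
  by (simp only: integral_mult_right_zero integral_mult_left_zero)

text \<open>The integral over \<open>r\<close> agrees with the given integrand for \<open>\<kappa> \<noteq> 0\<close>. On the null set
\<open>\<kappa> = 0\<close> no information is needed: any function of \<open>p\<close> alone is measurable there.\<close>
lemma H_integrand_integrable:
  shows "integrable mu_A (H_integrand K P z)"
    and "(\<integral>x. H_integrand K P z x \<partial>mu_A) = (\<integral>x. (\<integral>r. joint (x, r) \<partial>lborel) \<partial>mu_A)"
proof -
  interpret A: sigma_finite_measure mu_A by (rule sigma_finite_mu_A)
  interpret AL: pair_sigma_finite mu_A "lborel :: real measure" ..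
  interpret N: sigma_finite_measure "count_space (UNIV :: int set)"
    by (rule sigma_finite_measure_count_space)
  interpret LN: pair_sigma_finite "lborel :: real measure" "count_space (UNIV :: int set)" ..
  let ?J = "\<lambda>x. \<integral>r. joint (x, r) \<partial>lborel"
  have J: "integrable mu_A ?J" by (rule AL.integrable_fst'[OF joint_integrable])
  have Jm [measurable]: "?J \<in> borel_measurable mu_A" using J by (rule borel_measurable_integrable)
  have fst_m [measurable]: "fst \<in> borel_measurable mu_A"
    unfolding mu_A_def using measurable_fst[of "lborel :: real measure" "count_space (UNIV :: int set)"] by simp
  have snd_m [measurable]: "snd \<in> measurable mu_A (count_space UNIV)" unfolding mu_A_def by measurable
  have eq: "H_integrand K P z = (\<lambda>x. if fst x = 0 then (\<lambda>p. H_integrand K P z (0, p)) (snd x) else ?J x)"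
    by (auto simp: fun_eq_iff joint_integral_r)
  have "(\<lambda>x. (\<lambda>p. H_integrand K P z (0, p)) (snd x)) \<in> borel_measurable mu_A"
    by (rule measurable_compose[OF snd_m]) simp
  moreover have "Measurable.pred mu_A (\<lambda>x. fst x = 0)" by measurable
  ultimately have Hm: "H_integrand K P z \<in> borel_measurable mu_A"
    by (subst eq) (intro measurable_If Jm; simp)
  have ae: "AE x in mu_A. ?J x = H_integrand K P z x"
  proof -
    have "AE x in mu_A. fst x \<noteq> 0"
      unfolding mu_A_def
    proof (rule LN.AE_pair_measure)
      show "{x \<in> space (lborel \<Otimes>\<^sub>M count_space UNIV). fst x \<noteq> (0::real)} \<in> sets (lborel \<Otimes>\<^sub>M count_space
          (UNIV :: int set))"
        by measurable
      have "AE \<kappa> in lborel. \<kappa> \<noteq> (0 :: real)" by (rule AE_lborel_singleton)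
      thus "AE \<kappa> in lborel. AE p in count_space (UNIV :: int set). fst (\<kappa>, p) \<noteq> (0 :: real)" by auto
    qed
    thus ?thesis by eventually_elim (auto simp: eq)
  qed
  show "integrable mu_A (H_integrand K P z)"
    by (rule integrable_cong_AE_imp[OF J Hm]) (use ae in \<open>auto elim: eventually_mono\<close>)
  show "(\<integral>x. H_integrand K P z x \<partial>mu_A) = (\<integral>x. ?J x \<partial>mu_A)"
    by (rule integral_cong_AE[OF Hm Jm]) (use ae in \<open>auto elim: eventually_mono\<close>)
qed

text \<open>Integration over the spectral parameters for fixed \<open>r\<close> gives the inner integral of the dual
side, by the Fourier transforms of the Gaussians in both variables.\<close>
lemma joint_integral_mu_A:
  assumes int: "integrable mu_A (\<lambda>x. joint (x, r))"
  shows "(\<integral>x. joint (x, r) \<partial>mu_A) = of_real (\<integral>w. dens1 z K P r w \<partial>lborel)"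
proof -
  interpret N: sigma_finite_measure "count_space (UNIV :: int set)"
    by (rule sigma_finite_measure_count_space)
  interpret LN: pair_sigma_finite "lborel :: real measure" "count_space (UNIV :: int set)" ..
  have int': "integrable (lborel \<Otimes>\<^sub>M count_space UNIV) (\<lambda>(\<kappa>, p). joint ((\<kappa>, p), r))"
    using int unfolding mu_A_def by (simp add: case_prod_unfold)
  have inner: "(\<integral>\<kappa>. joint ((\<kappa>, p), r) \<partial>lborel) = acoeff (2 * p) (freq z r) * dual_coeff r (- (2 * p))" for p
  proof -
    have "joint ((\<kappa>, p), r) = (of_real (4 * pi * exp (- (of_int p / P)\<^sup>2)) * acoeff (2 * p) (freq z r))
        * (of_real (exp (- (\<kappa> / K)\<^sup>2)) * (of_real (\<kappa>\<^sup>2 + (of_int p)\<^sup>2) * cis (2 * r * \<kappa>)))" for \<kappa>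
    proof -
      have "exp (2 * (\<i> * of_real \<kappa>) * of_real r) = cis (2 * r * \<kappa>)"
        unfolding cis_conv_exp by (rule arg_cong[where f = exp]) simp
      thus ?thesis unfolding joint_def split gauss_h_eq by (simp only: of_real_mult mult_ac) simp
    qed
    hence "(\<integral>\<kappa>. joint ((\<kappa>, p), r) \<partial>lborel) = (of_real (4 * pi * exp (- (of_int p / P)\<^sup>2)) * acoeff (2
        * p) (freq z r)) * of_real ((of_int p)\<^sup>2 * gauss_k K r - gauss_k2 K r / 4)"
      by (simp only: integral_mult_right_zero gauss_k2_fourier(2)[OF K])
    also have "\<dots> = acoeff (2 * p) (freq z r) * of_real (4 * pi * exp (- (of_int p / P)\<^sup>2)
        * ((of_int p)\<^sup>2 * gauss_k K r - gauss_k2 K r / 4))"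
      by (simp only: of_real_mult mult_ac)
    also have "4 * pi * exp (- (of_int p / P)\<^sup>2) * ((of_int p)\<^sup>2 * gauss_k K r - gauss_k2 K r / 4) =
       pi * exp (- (of_int (- (2 * p)))\<^sup>2 / (4 * P\<^sup>2)) * ((of_int (- (2 * p)))\<^sup>2 * gauss_k K r - gauss_k2 K r)"
      by (simp add: power_mult_distrib power_divide algebra_simps)
    finally show ?thesis by (simp only: dual_coeff_def)
  qed
  have hs: "((\<lambda>p. acoeff (2 * p) (freq z r) * dual_coeff r (- (2 * p)))
      has_sum of_real (\<integral>w. dens1 z K P r w \<partial>lborel)) UNIV"
    by (rule dens1_has_sum)
  have "(\<integral>x. joint (x, r) \<partial>mu_A) = (\<integral>p. (\<integral>\<kappa>. joint ((\<kappa>, p), r) \<partial>lborel) \<partial>count_space UNIV)"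
    using LN.integral_snd[OF int'] unfolding mu_A_def by (simp add: case_prod_unfold)
  also have "\<dots> = infsum (\<lambda>p. acoeff (2 * p) (freq z r) * dual_coeff r (- (2 * p))) UNIV"
    unfolding inner
    by (rule lebesgue_integral_count_space_eq_infsum)
       (use has_sum_imp_summable[OF hs] in \<open>simp add: summable_on_iff_abs_summable_on_complex\<close>)
  also have "\<dots> = of_real (\<integral>w. dens1 z K P r w \<partial>lborel)" by (rule infsumI[OF hs])
  finally show ?thesis .
qed

lemma H_transform_eq: "H_transform K P z = of_real (\<integral>r. (\<integral>w. dens1 z K P r w \<partial>lborel) \<partial>lborel)"
proof -
  interpret A: sigma_finite_measure mu_A by (rule sigma_finite_mu_A)
  interpret AL: pair_sigma_finite mu_A "lborel :: real measure" ..
  have i: "integrable (mu_A \<Otimes>\<^sub>M lborel) (\<lambda>(x, r). joint (x, r))" using joint_integrable by simp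
  have "H_transform K P z = (\<integral>x. (\<integral>r. joint (x, r) \<partial>lborel) \<partial>mu_A)"
    unfolding H_transform_def by (rule H_integrand_integrable(2))
  also have "\<dots> = (\<integral>r. (\<integral>x. joint (x, r) \<partial>mu_A) \<partial>lborel)"
    by (rule AL.Fubini_integral[OF i, symmetric])
  also have "\<dots> = (\<integral>r. of_real (\<integral>w. dens1 z K P r w \<partial>lborel) \<partial>lborel)"
  proof (rule integral_cong_AE)
    have "AE r in lborel. integrable mu_A (\<lambda>x. joint (x, r))" by (rule AL.AE_integrable_snd[OF i])
    thus "AE r in lborel. (\<integral>x. joint (x, r) \<partial>mu_A) = of_real (\<integral>w. dens1 z K P r w \<partial>lborel)"
      by eventually_elim (rule joint_integral_mu_A)
    show "(\<lambda>r. \<integral>x. joint (x, r) \<partial>mu_A) \<in> borel_measurable lborel"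
      using AL.integrable_snd[OF i] by (rule borel_measurable_integrable)
    have "(\<lambda>r. \<integral>w. dens1 z K P r w \<partial>lborel) \<in> borel_measurable lborel"
      using lborel_pair.integrable_fst[OF integrable_dens1[OF K P]] by (rule borel_measurable_integrable)
    thus "(\<lambda>r. complex_of_real (\<integral>w. dens1 z K P r w \<partial>lborel)) \<in> borel_measurable lborel" by measurable
  qed
  also have "\<dots> = of_real (\<integral>r. (\<integral>w. dens1 z K P r w \<partial>lborel) \<partial>lborel)"
    by (rule integral_complex_of_real)
  finally show ?thesis .
qed

lemma dual_factor_bound: "\<bar>dual_factor r w\<bar> \<le> 2 * gauss_wt K r"
proof -
  have "\<bar>cos (osc z r w)\<bar> * ((sinh r)\<^sup>2 + (sin w)\<^sup>2) * gauss_k K r \<le> 1 * (2 * exp (2 * \<bar>r\<bar>)) * gauss_k K r"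
    using K sinh_sin_le[of r w] by (intro mult_mono mult_right_mono gauss_k_nonneg) auto
  thus ?thesis using gauss_k_nonneg[of K r] K by (simp add: dual_factor_def abs_mult gauss_wt_def mult_ac)
qed

lemma dual_factor_periodic: "dual_factor r (w + pi * of_int q) = dual_factor r w"
proof -
  have "cos (w + pi * of_int q) = (if even q then 1 else -1) * cos w" "sin (w + pi * of_int q)
      = (if even q then 1 else -1) * sin w"
    by (simp_all add: cos_add sin_add cos_npi_int sin_npi_int)
  hence "(cos (w + pi * of_int q) = cos w \<and> sin (w + pi * of_int q) = sin w) \<or> (cos (w + pi * of_int q)
      = - cos w \<and> sin (w + pi * of_int q) = - sin w)"
    by auto
  thus ?thesis
  proof
    assume "cos (w + pi * of_int q) = cos w \<and> sin (w + pi * of_int q) = sin w"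
    thus ?thesis by (simp add: dual_factor_def osc_def)
  next
    assume "cos (w + pi * of_int q) = - cos w \<and> sin (w + pi * of_int q) = - sin w"
    hence "osc z r (w + pi * of_int q) = - osc z r w" "(sin (w + pi * of_int q))\<^sup>2 = (sin w)\<^sup>2"
        by (simp_all add: osc_def)
    thus ?thesis by (simp add: dual_factor_def)
  qed
qed

lemma continuous_on_dual_factor:
  fixes f g :: "'x::t2_space \<Rightarrow> real"
  assumes "continuous_on A f" "continuous_on A g"
  shows "continuous_on A (\<lambda>x. dual_factor (f x) (g x))"
  unfolding dual_factor_def using assms by (auto intro!: continuous_intros continuous_on_osc)

lemma dual_integrand_eq: "dual_integrand K P z (r, w) = dual_factor r w * theta P w"
  by (simp only: dual_integrand_def dual_factor_def osc_trh split)

lemma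
  shows dual_integrable: "integrable mu_A_hat (dual_integrand K P z)"
    and dual_integral: "integral\<^sup>L mu_A_hat (dual_integrand K P z) = (\<integral>r. (\<integral>w. dens0 z K P r w \<partial>lborel) \<partial>lborel)"
proof -
  interpret U: finite_measure period_measure by (rule finite_period_measure)
  interpret LU: pair_sigma_finite "lborel :: real measure" period_measure ..
  define \<Theta> where "\<Theta> = (\<Sum>\<^sub>\<infinity>q::int. theta_const P * exp (- pi * \<bar>of_int q\<bar>))"
  have "integrable period_measure (\<lambda>\<omega>. complex_of_real (1 * theta P \<omega>))"
    by (rule integrable_theta_unfold[OF P, where B = 1]) auto
  hence "(\<lambda>\<omega>. complex_of_real (1 * theta P \<omega>)) \<in> borel_measurable period_measure"
    by (rule borel_measurable_integrable)
  from measurable_compose[OF this borel_measurable_continuous_onI[OF continuous_on_Re[OF continuous_on_id]]]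
  have th [measurable]: "theta P \<in> borel_measurable period_measure" by simp
  have snd_m: "snd \<in> borel_measurable (lborel \<Otimes>\<^sub>M period_measure :: (real \<times> real) measure)"
  proof -
    have "(\<lambda>x. x) \<in> borel_measurable period_measure" by (rule measurable_restrict_space1) simp
    thus ?thesis by (rule measurable_compose[OF measurable_snd])
  qed
  have fst_m: "fst \<in> borel_measurable (lborel \<Otimes>\<^sub>M period_measure :: (real \<times> real) measure)"
    using measurable_fst[of "lborel :: real measure" period_measure] by simp
  have "(\<lambda>x. dual_factor (fst x) (snd x)) \<in> borel_measurable (lborel \<Otimes>\<^sub>M period_measure)"
  proof -
    have c: "(\<lambda>x. dual_factor (fst x) (snd x)) \<in> borel_measurable borel"
      by (intro borel_measurable_continuous_onI continuous_on_dual_factor continuous_intros)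
    have "(\<lambda>x. (fst x, snd x)) \<in> borel_measurable (lborel \<Otimes>\<^sub>M period_measure :: (real \<times> real) measure)"
      by (rule borel_measurable_Pair[OF fst_m snd_m])
    from measurable_compose[OF this c] show ?thesis by simp
  qed
  hence m: "dual_integrand K P z \<in> borel_measurable (lborel \<Otimes>\<^sub>M period_measure)"
    using measurable_compose[OF measurable_snd th, of "lborel :: real measure"]
    unfolding dual_integrand_eq[unfolded split_def]
    by (subst measurable_cong[where g = "\<lambda>x. dual_factor (fst x) (snd x) * theta P (snd x)"])
       (auto simp: dual_integrand_eq)
  show i: "integrable mu_A_hat (dual_integrand K P z)"
    unfolding mu_A_hat_def
  proof (rule LU.integrable_prod_bound[OF m])
    show "integrable lborel (\<lambda>r. 2 * gauss_wt K r)" by (intro integrable_mult_right integrable_gauss_wt K)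
    show "integrable period_measure (\<lambda>_. \<Theta>)" by simp
    fix r w :: real assume "w \<in> space period_measure"
    hence w: "0 \<le> w" "w < pi" by (auto simp: space_restrict_space)
    have "\<bar>dual_factor r w\<bar> * theta P w \<le> 2 * gauss_wt K r * \<Theta>"
      unfolding \<Theta>_def using K by (intro mult_mono dual_factor_bound theta_bounds[OF P w]) (simp add: gauss_wt_nonneg)
    thus "norm (dual_integrand K P z (r, w)) \<le> 2 * gauss_wt K r * \<Theta>"
      using theta_bounds(1)[OF P w] by (simp add: dual_integrand_eq abs_mult)
  qed
  have "integral\<^sup>L mu_A_hat (dual_integrand K P z) = (\<integral>r. (\<integral>w. dual_integrand K P z (r, w) \<partial>period_measure) \<partial>lborel)"
    using LU.integral_fst'[OF i[unfolded mu_A_hat_def]] by (simp add: mu_A_hat_def)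
  also have "(\<lambda>r. \<integral>w. dual_integrand K P z (r, w) \<partial>period_measure) = (\<lambda>r. \<integral>w. dens0 z K P r w \<partial>lborel)"
  proof
    fix r
    have "(\<integral>\<omega>. complex_of_real (dual_factor r \<omega> * theta P \<omega>) \<partial>period_measure)
        = (\<integral>\<omega>. complex_of_real (dual_factor r \<omega> * gauss_k P \<omega>) \<partial>lborel)"
      by (rule integral_theta_unfold[OF P _ dual_factor_bound dual_factor_periodic])
         (intro borel_measurable_continuous_onI continuous_on_dual_factor continuous_intros)
    hence "(\<integral>\<omega>. dual_factor r \<omega> * theta P \<omega> \<partial>period_measure) = (\<integral>\<omega>. dual_factor r \<omega> * gauss_k P \<omega> \<partial>lborel)"
      unfolding integral_complex_of_real of_real_eq_iff .
    thus "(\<integral>w. dual_integrand K P z (r, w) \<partial>period_measure) = (\<integral>w. dens0 z K P r w \<partial>lborel)"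
      by (simp add: dual_integrand_eq dual_factor_def dens0_def)
  qed
  finally show "integral\<^sup>L mu_A_hat (dual_integrand K P z) = (\<integral>r. (\<integral>w. dens0 z K P r w \<partial>lborel) \<partial>lborel)" .
qed

end

end

theorem lemma6:
  fixes K P :: real and z :: complex
  assumes "K \<ge> 1/2" and "P \<ge> 1/2" and "z \<noteq> 0"
  shows "integrable mu_A (H_integrand K P z) \<and>
    integrable mu_A_hat (dual_integrand K P z) \<and>
    H_transform K P z =
      of_real ((cmod (2 * z))\<^sup>2 * integral\<^sup>L mu_A_hat (dual_integrand K P z))"
proof -
  have K: "K > 0" and P: "P > 0" using assms by auto
  show ?thesis
    using H_integrand_integrable(1)[OF assms(3) K P] dual_integrable[OF assms(3) K P]
    unfolding H_transform_eq[OF assms(3) K P] dual_integral[OF assms(3) K P] integral_dens0_dens1[OF K P]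
    by simp
qed

end
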